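(* Let $X=(X_n)_{n\in\mathbb{Z}}$ be the i.i.d. increments of a skip-free to the left random walk. If $\mathbb{E}[X_0]=0$, then the $R$-probability of $[\mathbb{Z},0,X]$ exists (where $R$ is the record vertex-shift), and it is equal to the push-forward of the ordered Eternal Kesten Tree distribution $EKT(\pi)$ under the backward map $\Phi_R$, where $\pi$ is the distribution of $X_0+1$.
   Context: **Increments.** "I.i.d. increments of a skip-free to the left random walk" means: $X=(X_n)_{n\in\mathbb{Z}}$ is i.i.d., each $X_n$ takes values in $\{-1,0,1,2,\dots\}$, $\mathbb{P}[X_0=-1]>0$ and $\mathbb{E}[X_0]<\infty$. **Networks and $R$-probability.** $[\mathbb{Z},i,x]$ denotes the equivalence class, up to translation, of the line $\mathbb{Z}$ rooted at $i$ with mark $x_n$ on the edge $(n,n+1)$; it is identified with the sequence $(x_{n+i})_{n\in\mathbb{Z}}$, and the local topology is the product topology on integer sequences. The record map is $R_x(i)=\inf\{j>i:\sum_{l=i}^{j-1}x_l\ge 0\}$ if the infimum exists and $R_x(i)=i$ otherwise. The $R$-probability of $[\mathbb{Z},0,X]$ is the weak limit as $n\to\infty$ of the distributions of $[\mathbb{Z},R_X^n(0),X]$, if it exists. **Family Trees.** A Family Tree is a locally finite directed tree with out-degrees at most $1$; $F(v)$ is the parent of $v$ (endpoint of its outgoing edge). It is ordered if the children of every vertex are totally ordered by $<$; it is eternal if each vertex has a parent. $d_1(u)$ is the number of children of $u$. Rooted ordered Family Trees are considered up to isomorphism, with the local topology. **$EKT(\pi)$.** Let $\pi$ be a distribution on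 $\{0,1,\dots\}$ with mean $1$ and $\hat\pi(k)=k\pi(k)$. $EKT(\pi)$ is the random rooted ordered Eternal Family Tree with a bi-infinite directed path $(\mathbf{o}_n)_{n\in\mathbb{Z}}$, $F(\mathbf{o}_{n-1})=\mathbf{o}_n$, rooted at $\mathbf{o}_0$, where each $\mathbf{o}_n$ has offspring distribution $\hat\pi$ (one of the children being $\mathbf{o}_{n-1}$), all other vertices have offspring distribution $\pi$, all vertices reproduce independently, and the order among the children of every vertex is uniform. **RLS order and succession line.** On an ordered Family Tree, write $u\prec v$ if either $v=F^k(u)$ for some $k>0$, or $u,v$ have a common ancestor $w=F^m(u)=F^n(v)$, with $m,n$ smallest positive such integers, and $F^{m-1}(u)<F^{n-1}(v)$. Put $b(u)=\max\{v:v\prec u\}$ and $a(u)=\min\{v:v\succ u\}$ (with respect to $\prec$) when they exist. The succession line of $(T,o)$ is the sequence $(u_n)_{n\in\mathbb{Z}}$ with $u_0=o$; for $n<0$, $u_n=b(u_{n+1})$ if it exists and $u_n=u_{n+1}$ otherwise; for $n>0$, $u_n=a(u_{n-1})$ if it exists and $u_n=u_{n-1}$ otherwise. **Backward map.** For $[T,o]$ a rooted ordered Family Tree with at most one bi-infinite directed path, $\Phi_R([T,o])=[\mathbb{Z},0,x]$ with $x_n=d_1(u_{n+1})-1$, $n\in\mathbb{Z}$, where $(u_n)$ is the succession line of $(T,o)$. *)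

theory Defs
  imports "HOL-Probability.Probability" "HOL-Combinatorics.Multiset_Permutations"
begin

section \<open>Weak limits and the record map\<close>

text \<open>The class of the line \<open>\<int>\<close> rooted at \<open>i\<close> with marks \<open>x\<close> is represented by the
  sequence re-indexed so that its root is at \<open>0\<close>. The type \<open>int \<Rightarrow> int\<close> carries the product
  topology, with \<open>int\<close> discrete.\<close>

definition rooted_line :: "int \<Rightarrow> (int \<Rightarrow> int) \<Rightarrow> (int \<Rightarrow> int)" where
  "rooted_line i x = (\<lambda>n. x (n + i))"

definition record_map :: "(int \<Rightarrow> int) \<Rightarrow> int \<Rightarrow> int" where
  "record_map x i =
    (let J = {j. i < j \<and> 0 \<le> (\<Sum>l\<in>{i..<j}. x l)} in if J = {} then i else Inf J)"

definition is_weak_limit ::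
    "(nat \<Rightarrow> 'a::topological_space measure) \<Rightarrow> 'a measure \<Rightarrow> bool" where
  "is_weak_limit N L \<longleftrightarrow>
     prob_space L \<and> sets L = sets borel \<and>
     (\<forall>f :: 'a \<Rightarrow> real. continuous_on UNIV f \<longrightarrow> bounded (range f) \<longrightarrow>
        (\<lambda>n. integral\<^sup>L (N n) f) \<longlonglongrightarrow> integral\<^sup>L L f)"

definition is_R_probability ::
    "'w measure \<Rightarrow> (int \<Rightarrow> 'w \<Rightarrow> int) \<Rightarrow> (int \<Rightarrow> int) measure \<Rightarrow> bool" where
  "is_R_probability M X L \<longleftrightarrow>
     is_weak_limit
       (\<lambda>n. distr M borel
          (\<lambda>\<omega>. rooted_line ((record_map (\<lambda>i. X i \<omega>) ^^ n) 0) (\<lambda>i. X i \<omega>))) L"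

definition skip_free_iid_increments :: "'w measure \<Rightarrow> (int \<Rightarrow> 'w \<Rightarrow> int) \<Rightarrow> bool" where
  "skip_free_iid_increments M X \<longleftrightarrow>
     prob_space M \<and>
     prob_space.indep_vars M (\<lambda>_. count_space UNIV) X UNIV \<and>
     (\<forall>n. distr M (count_space UNIV) (X n) = distr M (count_space UNIV) (X 0)) \<and>
     (\<forall>n. \<forall>\<omega>\<in>space M. -1 \<le> X n \<omega>) \<and>
     0 < measure M {\<omega> \<in> space M. X 0 \<omega> = -1} \<and>
     integrable M (\<lambda>\<omega>. real_of_int (X 0 \<omega>))"


section \<open>Rooted ordered Family Trees\<close>

text \<open>The edges of the directed graph are the pairs \<open>(v, w)\<close> with \<open>parent T v = Some w\<close>, so that
  out-degrees are at most one by construction. The relation \<open>sibling_less T\<close> matters only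
  between children of the same vertex.\<close>

record 'v rooted_tree =
  verts :: "'v set"
  parent :: "'v \<Rightarrow> 'v option"
  sibling_less :: "'v \<Rightarrow> 'v \<Rightarrow> bool"
  root :: 'v

definition children :: "'v rooted_tree \<Rightarrow> 'v \<Rightarrow> 'v set" where
  "children T v = {w \<in> verts T. parent T w = Some v}"

definition adjacent :: "'v rooted_tree \<Rightarrow> 'v \<Rightarrow> 'v \<Rightarrow> bool" where
  "adjacent T u v \<longleftrightarrow>
     u \<in> verts T \<and> v \<in> verts T \<and> (parent T u = Some v \<or> parent T v = Some u)"

text \<open>The third and fourth clauses exclude loops and pairs of opposite edges, the only cycles of the
  underlying undirected multigraph of length at most two; the fifth excludes longer ones.\<close>

definition directed_tree :: "'v rooted_tree \<Rightarrow> bool" where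
  "directed_tree T \<longleftrightarrow>
     (\<forall>v\<in>verts T. \<forall>w. parent T v = Some w \<longrightarrow> w \<in> verts T) \<and>
     (\<forall>u\<in>verts T. \<forall>v\<in>verts T. (adjacent T)\<^sup>*\<^sup>* u v) \<and>
     (\<forall>v\<in>verts T. parent T v \<noteq> Some v) \<and>
     (\<forall>u\<in>verts T. \<forall>v\<in>verts T. \<not> (parent T u = Some v \<and> parent T v = Some u)) \<and>
     \<not> (\<exists>vs. 3 \<le> length vs \<and> distinct vs \<and>
          (\<forall>i<length vs. adjacent T (vs ! i) (vs ! (Suc i mod length vs))))"

definition ordered_family_tree :: "'v rooted_tree \<Rightarrow> bool" where
  "ordered_family_tree T \<longleftrightarrow>
     directed_tree T \<and>
     (\<forall>v\<in>verts T. finite {w. adjacent T v w}) \<and>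
     (\<forall>v\<in>verts T.
        (\<forall>a\<in>children T v. \<not> sibling_less T a a) \<and>
        (\<forall>a\<in>children T v. \<forall>b\<in>children T v. \<forall>c\<in>children T v.
           sibling_less T a b \<longrightarrow> sibling_less T b c \<longrightarrow> sibling_less T a c) \<and>
        (\<forall>a\<in>children T v. \<forall>b\<in>children T v.
           a \<noteq> b \<longrightarrow> sibling_less T a b \<or> sibling_less T b a)) \<and>
     root T \<in> verts T"

subsection \<open>Isomorphism classes and the local topology\<close>

definition tree_iso_on ::
    "'u rooted_tree \<Rightarrow> 'u set \<Rightarrow> 'v rooted_tree \<Rightarrow> 'v set \<Rightarrow> ('u \<Rightarrow> 'v) \<Rightarrow> bool" where
  "tree_iso_on T A T' B f \<longleftrightarrow>
     bij_betw f A B \<and> f (root T) = root T' \<and>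
     (\<forall>u\<in>A. \<forall>v\<in>A. parent T u = Some v \<longleftrightarrow> parent T' (f u) = Some (f v)) \<and>
     (\<forall>p\<in>A. \<forall>u\<in>A. \<forall>v\<in>A. parent T u = Some p \<longrightarrow> parent T v = Some p \<longrightarrow>
        (sibling_less T u v \<longleftrightarrow> sibling_less T' (f u) (f v)))"

definition tree_isomorphic :: "'u rooted_tree \<Rightarrow> 'v rooted_tree \<Rightarrow> bool" where
  "tree_isomorphic T T' \<longleftrightarrow> (\<exists>f. tree_iso_on T (verts T) T' (verts T') f)"

definition root_ball :: "'v rooted_tree \<Rightarrow> nat \<Rightarrow> 'v set" where
  "root_ball T r = {v \<in> verts T. \<exists>k\<le>r. (adjacent T ^^ k) (root T) v}"

text \<open>Connected locally finite graphs are countable, so representatives with vertices in \<open>nat\<close>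
  suffice to describe all isomorphism classes.\<close>

definition tree_class :: "'v rooted_tree \<Rightarrow> nat rooted_tree set" where
  "tree_class T = {T'. ordered_family_tree T' \<and> tree_isomorphic T T'}"

definition tree_classes :: "nat rooted_tree set set" where
  "tree_classes = tree_class ` {T :: nat rooted_tree. ordered_family_tree T}"

definition local_nbhd :: "nat rooted_tree \<Rightarrow> nat \<Rightarrow> nat rooted_tree set set" where
  "local_nbhd T r = {C \<in> tree_classes. \<exists>T'\<in>C. \<exists>f.
     tree_iso_on T (root_ball T r) T' (root_ball T' r) f}"

definition local_topology :: "nat rooted_tree set topology" where
  "local_topology =
     topology_generated_by {local_nbhd T r | T r. ordered_family_tree T}"

definition tree_borel :: "nat rooted_tree set measure" where
  "tree_borel = sigma tree_classes {U. openin local_topology U}"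


section \<open>The backward map\<close>

text \<open>\<open>ancestor T k v\<close> is the partial iterate \<open>F^k(v)\<close>.\<close>

primrec ancestor :: "'v rooted_tree \<Rightarrow> nat \<Rightarrow> 'v \<Rightarrow> 'v option" where
  "ancestor T 0 v = Some v"
| "ancestor T (Suc k) v = Option.bind (ancestor T k v) (parent T)"

definition rls_less :: "'v rooted_tree \<Rightarrow> 'v \<Rightarrow> 'v \<Rightarrow> bool" where
  "rls_less T u v \<longleftrightarrow>
     (\<exists>k>0. ancestor T k u = Some v) \<or>
     (\<exists>m>0. \<exists>n>0. \<exists>w p q.
        ancestor T m u = Some w \<and> ancestor T n v = Some w \<and>
        (\<forall>m'>0. \<forall>n'>0. \<forall>w'. ancestor T m' u = Some w' \<longrightarrow> ancestor T n' v = Some w' \<longrightarrow>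
           m \<le> m' \<and> n \<le> n') \<and>
        ancestor T (m - 1) u = Some p \<and> ancestor T (n - 1) v = Some q \<and>
        sibling_less T p q)"

definition is_rls_pred :: "'v rooted_tree \<Rightarrow> 'v \<Rightarrow> 'v \<Rightarrow> bool" where
  "is_rls_pred T u v \<longleftrightarrow> v \<in> verts T \<and> rls_less T v u \<and>
     (\<forall>w\<in>verts T. rls_less T w u \<longrightarrow> w = v \<or> rls_less T w v)"

definition is_rls_succ :: "'v rooted_tree \<Rightarrow> 'v \<Rightarrow> 'v \<Rightarrow> bool" where
  "is_rls_succ T u v \<longleftrightarrow> v \<in> verts T \<and> rls_less T u v \<and>
     (\<forall>w\<in>verts T. rls_less T u w \<longrightarrow> w = v \<or> rls_less T v w)"

definition rls_pred :: "'v rooted_tree \<Rightarrow> 'v \<Rightarrow> 'v" where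
  "rls_pred T u = (if \<exists>v. is_rls_pred T u v then THE v. is_rls_pred T u v else u)"

definition rls_succ :: "'v rooted_tree \<Rightarrow> 'v \<Rightarrow> 'v" where
  "rls_succ T u = (if \<exists>v. is_rls_succ T u v then THE v. is_rls_succ T u v else u)"

definition succession_line :: "'v rooted_tree \<Rightarrow> int \<Rightarrow> 'v" where
  "succession_line T n =
     (if 0 \<le> n then (rls_succ T ^^ nat n) (root T) else (rls_pred T ^^ nat (- n)) (root T))"

definition backward_sequence :: "'v rooted_tree \<Rightarrow> int \<Rightarrow> int" where
  "backward_sequence T n = int (card (children T (succession_line T (n + 1)))) - 1"

text \<open>The formula makes sense for every rooted ordered Family Tree and does not depend on the
  representative. It is used without restriction to trees with at most one bi-infinite
  path, because the Eternal Kesten Trees considered have exactly one almost surely.\<close>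

definition Phi_R :: "nat rooted_tree set \<Rightarrow> int \<Rightarrow> int" where
  "Phi_R C = backward_sequence (SOME T. T \<in> C)"


section \<open>The ordered Eternal Kesten Tree\<close>

text \<open>Meaningful when \<open>\<pi>\<close> has mean \<open>1\<close>.\<close>

definition size_biased :: "nat pmf \<Rightarrow> nat pmf" where
  "size_biased \<pi> = embed_pmf (\<lambda>k. real k * pmf \<pi> k)"

text \<open>The reproduction of a vertex is recorded by a list: its length is the number \<open>k\<close> of children,
  which are numbered by \<open>{..<k}\<close>, and the list enumerates these numbers in increasing sibling
  order, uniformly among all \<open>k!\<close> arrangements.\<close>

definition ordered_offspring :: "nat pmf \<Rightarrow> nat list pmf" where
  "ordered_offspring \<mu> = bind_pmf \<mu> (\<lambda>k. pmf_of_set (permutations_of_set {..<k}))"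

text \<open>Potential vertices are pairs \<open>(n, l)\<close>: \<open>(n, [])\<close> is the vertex \<open>o_n\<close> of the bi-infinite
  path, and child number \<open>i\<close> of \<open>(n, l)\<close> is \<open>(n, l @ [i])\<close>, except that child number \<open>0\<close>
  of \<open>(n, [])\<close> is \<open>(n - 1, [])\<close>.\<close>

definition kesten_offspring :: "nat pmf \<Rightarrow> int \<times> nat list \<Rightarrow> nat list pmf" where
  "kesten_offspring \<pi> v =
     ordered_offspring (if snd v = [] then size_biased \<pi> else \<pi>)"

text \<open>The restriction to the supports removes a null set, outside which the construction below
  always gives an ordered Family Tree.\<close>

definition kesten_space :: "nat pmf \<Rightarrow> (int \<times> nat list \<Rightarrow> nat list) measure" where
  "kesten_space \<pi> =
     restrict_space (PiM UNIV (\<lambda>v. measure_pmf (kesten_offspring \<pi> v)))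
       {\<omega>. \<forall>v. \<omega> v \<in> set_pmf (kesten_offspring \<pi> v)}"

inductive_set kesten_verts :: "(int \<times> nat list \<Rightarrow> nat list) \<Rightarrow> (int \<times> nat list) set"
  for \<omega> where
  path: "(n, []) \<in> kesten_verts \<omega>"
| child: "(n, l) \<in> kesten_verts \<omega> \<Longrightarrow> i \<in> set (\<omega> (n, l)) \<Longrightarrow> l \<noteq> [] \<or> i \<noteq> 0 \<Longrightarrow>
    (n, l @ [i]) \<in> kesten_verts \<omega>"

fun kesten_parent :: "int \<times> nat list \<Rightarrow> int \<times> nat list" where
  "kesten_parent (n, l) = (if l = [] then (n + 1, []) else (n, butlast l))"

fun kesten_number :: "int \<times> nat list \<Rightarrow> nat" where
  "kesten_number (n, l) = (if l = [] then 0 else last l)"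

definition kesten_tree ::
    "(int \<times> nat list \<Rightarrow> nat list) \<Rightarrow> (int \<times> nat list) rooted_tree" where
  "kesten_tree \<omega> =
     \<lparr>verts = kesten_verts \<omega>,
      parent = (\<lambda>v. Some (kesten_parent v)),
      sibling_less = (\<lambda>u v. \<exists>i j. i < j \<and> j < length (\<omega> (kesten_parent u)) \<and>
        \<omega> (kesten_parent u) ! i = kesten_number u \<and> \<omega> (kesten_parent u) ! j = kesten_number v),
      root = (0, [])\<rparr>"

definition EKT :: "nat pmf \<Rightarrow> nat rooted_tree set measure" where
  "EKT \<pi> = distr (kesten_space \<pi>) tree_borel (\<lambda>\<omega>. tree_class (kesten_tree \<omega>))"

end

theory Submission
  imports Defs
begin

text \<open>Visit the tree against the RLS order, starting from a path vertex \<open>o_r\<close>: pop a vertex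
  from a stack and push its children. Size-biasing cancels the uniform choice of the path
  vertex among its siblings, so the degrees \<open>d_1, ..., d_L\<close> read until the visit of \<open>o_{-n}\<close> have
  probability \<open>\<pi>(d_1) ... \<pi>(d_L)\<close>, provided that they admit such a visit. Read forward, that is the
  condition that the walk with steps \<open>d - 1\<close> has its record number \<open>n + r\<close> at time \<open>L\<close>, and the
  path vertices are the records: the position of the path in the stack is the running maximum
  minus the walk. By recurrence these probabilities add up to one, hence the segment of the tree
  line between \<open>o_{-n}\<close> and \<open>o_r\<close> has the law of the walk between its records number \<open>0\<close> and
  \<open>n + r\<close>, with the root \<open>o_0\<close> at record number \<open>n\<close>. So the view of the walk from its \<open>n\<close>-th record
  agrees in law with the tree line on every window \<open>[-r, r)\<close> with \<open>r \<le> n\<close>.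

  Recurrence: \<open>V_n(i)\<close>, the maximum of the partial sums of length at most \<open>n\<close> from \<open>i\<close> on,
  satisfies \<open>V_{n+1}(i) = max 0 (X_i + V_n(i+1))\<close>. Steps are at least \<open>-1\<close> and centred, so its
  mean grows at step \<open>n\<close> by at least the probability of never returning, while a truncation
  and a second moment bound show that the mean is \<open>o(n)\<close>.\<close>

section \<open>The RLS order\<close>

text \<open>Two features of the definitions shape the first half. \<open>Phi_R\<close> picks an
  arbitrary representative of an isomorphism class, and the succession line refers to maxima and
  minima over an infinite tree. Independence of the choice and measurability for the local topology
  both come from describing one step of the line inside a finite ball around the root. The
  convention that the line stands still where it ends is not such a condition, so it is expressed
  through negations of local ones. In the second half the difficulty is that the path moves randomly
  in the stack: the place of \<open>o_{n-1}\<close> among its siblings is not a function of the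
  degrees. Read backward it is: the state before a visit is determined by the state after it and by
  the degree. This makes summing out the arrangements possible one visit at a time, and it yields
  the record process of the walk. Recurrence is proved for the walk alone. On each window it gives
  one inequality between the two laws, and complements give the other one.\<close>

lemma ancestor_add:
  "ancestor T (a + b) u = Option.bind (ancestor T a u) (ancestor T b)"
proof (induction b)
  case 0 then show ?case by (cases "ancestor T a u") auto
next
  case (Suc b) then show ?case by (cases "ancestor T a u") auto
qed

lemma ancestor_Suc_front:
  "ancestor T (Suc k) u = Option.bind (parent T u) (ancestor T k)"
  using ancestor_add[of T 1 k u] by simp

lemma ancestor_le_Some:
  assumes "ancestor T n u = Some w" "m \<le> n"
  obtains v where "ancestor T m u = Some v" "ancestor T (n - m) v = Some w"
proof -
  from assms ancestor_add[of T m "n - m" u]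
  have "Option.bind (ancestor T m u) (ancestor T (n - m)) = Some w" by simp
  then show ?thesis using that by (auto simp: bind_eq_Some_conv)
qed

lemma ancestor_trans:
  "ancestor T a u = Some v \<Longrightarrow> ancestor T b v = Some w \<Longrightarrow> ancestor T (a + b) u = Some w"
  by (simp add: ancestor_add)

locale family_tree =
  fixes T :: "'v rooted_tree"
  assumes oft: "ordered_family_tree T"
begin

abbreviation "V \<equiv> verts T"
abbreviation "sless \<equiv> sibling_less T"

lemma dt: "directed_tree T"
  using oft by (simp add: ordered_family_tree_def)

lemma parent_in: "v \<in> V \<Longrightarrow> parent T v = Some w \<Longrightarrow> w \<in> V"
  using dt unfolding directed_tree_def by blast

lemma root_in: "root T \<in> V"
  using oft by (simp add: ordered_family_tree_def)

lemma ancestor_in: "v \<in> V \<Longrightarrow> ancestor T k v = Some w \<Longrightarrow> w \<in> V"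
  by (induction k arbitrary: w) (auto simp: bind_eq_Some_conv intro: parent_in)

lemma children_in: "c \<in> children T v \<Longrightarrow> c \<in> V"
  by (simp add: children_def)

lemma children_parent: "c \<in> children T v \<Longrightarrow> parent T c = Some v"
  by (simp add: children_def)

lemma sless_irrefl: "v \<in> V \<Longrightarrow> a \<in> children T v \<Longrightarrow> \<not> sless a a"
  using oft by (auto simp: ordered_family_tree_def)

lemma sless_trans:
  "v \<in> V \<Longrightarrow> a \<in> children T v \<Longrightarrow> b \<in> children T v \<Longrightarrow> c \<in> children T v \<Longrightarrow>
   sless a b \<Longrightarrow> sless b c \<Longrightarrow> sless a c"
  using oft unfolding ordered_family_tree_def by blast

lemma sless_total:
  "v \<in> V \<Longrightarrow> a \<in> children T v \<Longrightarrow> b \<in> children T v \<Longrightarrow> a \<noteq> b \<Longrightarrow> sless a b \<or> sless b a"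
  using oft unfolding ordered_family_tree_def by blast

lemma finite_children:
  assumes "v \<in> V" shows "finite (children T v)"
proof -
  have "children T v \<subseteq> {w. adjacent T v w}"
    using assms by (auto simp: children_def adjacent_def)
  with assms oft show ?thesis
    by (auto simp: ordered_family_tree_def intro: finite_subset)
qed

text \<open>The iterates up to the smallest return time are distinct and form a closed path. Lengths
  one and two are excluded by the clauses on loops and opposite edges, longer ones by the clause on
  cycles.\<close>

lemma not_own_ancestor:
  assumes v: "v \<in> V" and k: "ancestor T k v = Some v"
  shows "k = 0"
proof (rule ccontr)
  assume "k \<noteq> 0"
  define n where "n = (LEAST n. n > 0 \<and> ancestor T n v = Some v)"
  have n: "n > 0 \<and> ancestor T n v = Some v"
    unfolding n_def by (rule LeastI[of _ k]) (use \<open>k \<noteq> 0\<close> k in auto)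
  have nmin: "n \<le> m" if "m > 0" "ancestor T m v = Some v" for m
    unfolding n_def by (rule Least_le) (use that in auto)
  define f where "f i = the (ancestor T i v)" for i
  have f: "ancestor T i v = Some (f i)" if "i \<le> n" for i
    using n that by (metis ancestor_le_Some f_def option.sel)
  have fV: "f i \<in> V" if "i \<le> n" for i using f[OF that] ancestor_in v by blast
  have par: "parent T (f i) = Some (f (Suc i))" if "i < n" for i
    using f[of i] f[of "Suc i"] that by simp
  have f0: "f 0 = v" "f n = v" using f[of 0] n f[of n] by auto
  have inj: "inj_on f {..<n}"
  proof (rule linorder_inj_onI)
    fix i j assume ij: "i < j" "i \<in> {..<n}" "j \<in> {..<n}"
    show "f i \<noteq> f j"
    proof
      assume eq: "f i = f j"
      obtain w where "ancestor T j v = Some w" "ancestor T (n - j) w = Some v"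
        using n ij by (metis ancestor_le_Some lessThan_iff less_imp_le)
      then have "ancestor T (n - j) (f i) = Some v" using f[of j] ij eq by simp
      then have "ancestor T (i + (n - j)) v = Some v"
        using ancestor_trans[OF f[of i]] ij by (meson lessThan_iff less_imp_le)
      from nmin[OF _ this] ij show False by auto
    qed
  qed auto
  consider "n = 1" | "n = 2" | "n \<ge> 3" using n by linarith
  then show False
  proof cases
    case 1
    then show False using par[of 0] f0 v dt unfolding directed_tree_def by auto
  next
    case 2
    then have "parent T (f 0) = Some (f 1)" "parent T (f 1) = Some (f 0)"
      using par[of 0] par[of 1] f0 by (auto simp: numeral_2_eq_2)
    moreover have "f 0 \<in> V" "f 1 \<in> V" using fV 2 by auto
    ultimately show False using dt unfolding directed_tree_def by blast
  next
    case 3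
    define vs where "vs = map f [0..<n]"
    have "distinct vs" using inj by (simp add: vs_def distinct_map lessThan_atLeast0)
    moreover have "adjacent T (vs ! i) (vs ! (Suc i mod length vs))" if "i < length vs" for i
    proof -
      have i: "i < n" using that by (simp add: vs_def)
      have "vs ! (Suc i mod length vs) = f (Suc i)"
      proof (cases "Suc i = n")
        case True then show ?thesis using f0 n by (simp add: vs_def)
      next
        case False then show ?thesis using i by (simp add: vs_def)
      qed
      then show ?thesis using i par[OF i] fV[of i] fV[of "Suc i"]
        by (simp add: vs_def adjacent_def)
    qed
    moreover have "3 \<le> length vs" using 3 by (simp add: vs_def)
    ultimately show False using dt unfolding directed_tree_def by blast
  qed
qed

lemma ancestor_inj:
  assumes v: "v \<in> V" and a: "ancestor T a v = Some w" and b: "ancestor T b v = Some w"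
  shows "a = b"
proof -
  have *: "i = j" if ij: "i \<le> j" "ancestor T i v = Some w" "ancestor T j v = Some w" for i j
  proof -
    obtain x where "ancestor T i v = Some x" "ancestor T (j - i) x = Some w"
      using ij by (metis ancestor_le_Some)
    then have "ancestor T (j - i) w = Some w" using ij by simp
    moreover have "w \<in> V" using ij v ancestor_in by blast
    ultimately have "j - i = 0" using not_own_ancestor by blast
    then show ?thesis using ij by simp
  qed
  show ?thesis using *[of a b] *[of b a] a b by (cases "a \<le> b") auto
qed

text \<open>Induction along an undirected path from \<open>u\<close>: a step down keeps the meeting
  point and so does a step up, unless \<open>v\<close> is itself the meeting point; then its parent
  takes over.\<close>

lemma common_ancestor:
  assumes "u \<in> V" "v \<in> V"
  shows "\<exists>a b w. ancestor T a u = Some w \<and> ancestor T b v = Some w"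
proof -
  have "(adjacent T)\<^sup>*\<^sup>* u v" using dt assms unfolding directed_tree_def by blast
  then show ?thesis
  proof (induction rule: rtranclp_induct)
    case base then show ?case by (metis ancestor.simps(1))
  next
    case (step v v')
    then obtain a b w where w: "ancestor T a u = Some w" "ancestor T b v = Some w" by blast
    from step(2) consider "parent T v' = Some v" | "parent T v = Some v'"
      by (auto simp: adjacent_def)
    then show ?case
    proof cases
      case 1
      then have "ancestor T (Suc b) v' = Some w" using w by (simp add: ancestor_Suc_front del: ancestor.simps)
      then show ?thesis using w by blast
    next
      case 2
      show ?thesis
      proof (cases b)
        case 0
        then have "ancestor T (Suc a) u = Some v'" using w 2 by simp
        then show ?thesis by (metis ancestor.simps(1))
      next
        case (Suc c)
        then have "ancestor T c v' = Some w" using w 2 by (simp add: ancestor_Suc_front del: ancestor.simps)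
        then show ?thesis using w by blast
      qed
    qed
  qed
qed

section \<open>Linearity of ancestor lines and the axioms of a strict total order\<close>

definition up :: "'v \<Rightarrow> 'v \<Rightarrow> bool" where
  "up u v \<longleftrightarrow> (\<exists>k. ancestor T k u = Some v)"

lemma up_refl [simp]: "up u u"
  unfolding up_def by (rule exI[of _ 0]) simp

lemma up_trans: "up u v \<Longrightarrow> up v w \<Longrightarrow> up u w"
  unfolding up_def by (elim exE, rule exI, erule (1) ancestor_trans)

lemma up_parent: "parent T u = Some v \<Longrightarrow> up u v"
  unfolding up_def by (rule exI[of _ 1]) simp

lemma up_antisym:
  assumes "up u v" "up v u" "u \<in> V" shows "u = v"
proof -
  from assms obtain a b where ab: "ancestor T a u = Some v" "ancestor T b v = Some u"
    by (auto simp: up_def)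
  then have "a + b = 0" using not_own_ancestor[OF assms(3) ancestor_trans[OF ab]] by simp
  then show ?thesis using ab by simp
qed

lemma up_cases:
  assumes "up u v" obtains "u = v" | p where "parent T u = Some p" "up p v"
proof -
  from assms obtain k where k: "ancestor T k u = Some v" by (auto simp: up_def)
  show thesis
  proof (cases k)
    case 0 then show ?thesis using k that by auto
  next
    case (Suc l)
    then show ?thesis using k that
      by (auto simp: ancestor_Suc_front bind_eq_Some_conv up_def simp del: ancestor.simps)
  qed
qed

lemma up_child:
  assumes "up q w" "q \<noteq> w" "q \<in> children T x" shows "up x w"
  using assms(1)
proof (cases rule: up_cases)
  case (2 p)
  then show ?thesis using children_parent[OF assms(3)] by simp
qed (use assms in simp)

lemma up_strict_child:
  assumes "up w u" "w \<noteq> u" "w \<in> V" obtains d where "d \<in> children T u" "up w d"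
proof -
  obtain k where k: "ancestor T k w = Some u" using assms(1) by (auto simp: up_def)
  then obtain l d where d: "ancestor T l w = Some d" "parent T d = Some u"
    using assms(2) by (cases k) (auto simp: bind_eq_Some_conv)
  then have "d \<in> children T u" "up w d"
    using ancestor_in assms(3) by (auto simp: children_def up_def)
  then show ?thesis by (rule that)
qed

lemma up_linear:
  assumes "up u v" "up u w" shows "up v w \<or> up w v"
proof -
  from assms obtain a b where ab: "ancestor T a u = Some v" "ancestor T b u = Some w"
    by (auto simp: up_def)
  show ?thesis
  proof (cases "a \<le> b")
    case True
    then have "ancestor T (b - a) v = Some w"
      using ab by (metis ancestor_le_Some option.inject)
    then show ?thesis by (auto simp: up_def)
  next
    case False
    then have "ancestor T (a - b) w = Some v"
      using ab by (metis ancestor_le_Some option.inject nle_le)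
    then show ?thesis by (auto simp: up_def)
  qed
qed

lemma up_sibling_eq:
  assumes "u \<in> V" "up u p" "up u q" "p \<in> children T x" "q \<in> children T x"
  shows "p = q"
proof -
  from assms obtain a b where ab: "ancestor T a u = Some p" "ancestor T b u = Some q"
    by (auto simp: up_def)
  then have "ancestor T (Suc a) u = Some x" "ancestor T (Suc b) u = Some x"
    using assms by (auto simp: children_def)
  then have "a = b" using ancestor_inj assms by blast
  then show ?thesis using ab by simp
qed

definition branch :: "'v \<Rightarrow> 'v \<Rightarrow> 'v \<Rightarrow> 'v \<Rightarrow> bool" where
  "branch u p v q \<longleftrightarrow> up u p \<and> up v q \<and>
     (\<exists>x\<in>V. p \<in> children T x \<and> q \<in> children T x) \<and> sless p q"

text \<open>\<open>branch\<close> encodes the minimality of \<open>m\<close> and \<open>n\<close> by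
  two different siblings: an earlier meeting point would lie below \<open>p\<close> or
  \<open>q\<close>, hence put both vertices under the same sibling, while \<open>sless p q\<close>
  forces \<open>p\<close> and \<open>q\<close> to differ.\<close>

lemma rls_less_iff:
  assumes u: "u \<in> V" and v: "v \<in> V"
  shows "rls_less T u v \<longleftrightarrow> up u v \<and> u \<noteq> v \<or> (\<exists>p q. branch u p v q)"
proof
  assume "rls_less T u v"
  then consider k where "k > 0" "ancestor T k u = Some v"
    | m n w p q where "m > 0" "n > 0" "ancestor T m u = Some w" "ancestor T n v = Some w"
        "ancestor T (m - 1) u = Some p" "ancestor T (n - 1) v = Some q" "sless p q"
    unfolding rls_less_def by (elim disjE exE conjE) (rule that, assumption+)+
  then show "up u v \<and> u \<noteq> v \<or> (\<exists>p q. branch u p v q)"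
  proof cases
    case 1
    then have "u \<noteq> v" using not_own_ancestor u by blast
    then show ?thesis using 1 by (auto simp: up_def)
  next
    case 2
    have "p \<in> V" "q \<in> V" "w \<in> V" using 2 ancestor_in u v by blast+
    moreover have "parent T p = Some w" "parent T q = Some w"
      using 2 by (cases m; cases n; auto)+
    ultimately have "branch u p v q" using 2 unfolding branch_def children_def up_def by blast
    then show ?thesis by blast
  qed
next
  assume "up u v \<and> u \<noteq> v \<or> (\<exists>p q. branch u p v q)"
  then show "rls_less T u v"
  proof
    assume "up u v \<and> u \<noteq> v"
    then obtain k where "ancestor T k u = Some v" "k > 0"
      by (metis ancestor.simps(1) gr0I option.inject up_def)
    then show ?thesis unfolding rls_less_def by blast
  next
    assume "\<exists>p q. branch u p v q"
    then obtain p q x a b where pq: "ancestor T a u = Some p" "ancestor T b v = Some q" "x \<in> V"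
      "p \<in> children T x" "q \<in> children T x" "sless p q"
      by (auto simp: branch_def up_def)
    have pne: "p \<noteq> q" using pq sless_irrefl by blast
    have mn: "ancestor T (Suc a) u = Some x" "ancestor T (Suc b) v = Some x"
      using pq by (auto simp: children_def)
    have min: "Suc a \<le> m \<and> Suc b \<le> n"
      if h: "ancestor T m u = Some w'" "ancestor T n v = Some w'" for m n w'
    proof (rule ccontr)
      assume "\<not> ?thesis"
      then have c: "m \<le> a \<or> n \<le> b" by auto
      have up1: "up w' p \<or> up w' q"
        using c pq h ancestor_le_Some up_def by (metis option.inject)
      have uw: "up u w'" "up v w'" using h by (auto simp: up_def)
      have uv: "up u p" "up v q" using pq by (auto simp: up_def)
      show False
      proof (cases "up w' p")
        case True
        then have "up v p" using uw up_trans by blast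
        then have "p = q" using up_sibling_eq[OF v _ uv(2)] pq by blast
        then show False using pne by blast
      next
        case False
        then have "up w' q" using up1 by blast
        then have "up u q" using uw up_trans by blast
        then have "p = q" using up_sibling_eq[OF u uv(1)] pq by blast
        then show False using pne by blast
      qed
    qed
    show ?thesis unfolding rls_less_def
      by (rule disjI2, rule exI[of _ "Suc a"], rule conjI, simp, rule exI[of _ "Suc b"],
          rule conjI, simp, rule exI[of _ x], rule exI[of _ p], rule exI[of _ q])
         (use mn pq min in \<open>auto simp del: ancestor.simps\<close>)
  qed
qed

lemma rls_less_irrefl: "u \<in> V \<Longrightarrow> \<not> rls_less T u u"
  unfolding rls_less_iff branch_def using up_sibling_eq sless_irrefl by blast

lemma branch_up_left: "branch u p v q \<Longrightarrow> up u' u \<Longrightarrow> branch u' p v q"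
  unfolding branch_def using up_trans by blast

lemma branch_up_right: "branch u p v q \<Longrightarrow> up v' v \<Longrightarrow> branch u p v' q"
  unfolding branch_def using up_trans by blast

text \<open>With two branchings, \<open>q\<close> and \<open>p'\<close> are both ancestors of
  \<open>v\<close>, hence comparable: the higher branching decides, and at equal level the sibling
  order is transitive. If instead \<open>w\<close> is an ancestor of \<open>v\<close>, it is
  compared with \<open>q\<close>: either it stays under \<open>q\<close>, or it is an ancestor of
  \<open>u\<close> too.\<close>

lemma rls_less_trans:
  assumes V: "u \<in> V" "v \<in> V" "w \<in> V" and uv: "rls_less T u v" and vw: "rls_less T v w"
  shows "rls_less T u w"
proof -
  from uv V consider (1) "up u v" "u \<noteq> v" | (2) p q where "branch u p v q"
    by (auto simp: rls_less_iff)
  then show ?thesis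
  proof cases
    case 1
    from vw V consider "up v w" "v \<noteq> w" | p q where "branch v p w q"
      by (auto simp: rls_less_iff)
    then show ?thesis
    proof cases
      case c1: 1
      then have "up u w" "u \<noteq> w" using 1 up_trans up_antisym V by blast+
      then show ?thesis using V rls_less_iff by blast
    next
      case 2
      then show ?thesis using branch_up_left[OF _ 1(1)] V rls_less_iff by blast
    qed
  next
    case 2
    then obtain x where pq: "up u p" "up v q" "x \<in> V" "p \<in> children T x" "q \<in> children T x" "sless p q"
      by (auto simp: branch_def)
    have upx: "up p x" "up q x" using pq up_parent children_parent by blast+
    from vw V consider (a) "up v w" "v \<noteq> w" | (b) p' q' where "branch v p' w q'"
      by (auto simp: rls_less_iff)
    then show ?thesis
    proof cases
      case a
      show ?thesis
      proof (cases "up w q")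
        case True
        then have "branch u p w q" using pq by (auto simp: branch_def)
        then show ?thesis using V rls_less_iff by blast
      next
        case False
        then have qw: "up q w" using up_linear[OF a(1) pq(2)] by blast
        have "q \<noteq> w" using False by auto
        then have "up x w" using up_child qw pq by blast
        then have "up u w" using pq upx up_trans by blast
        moreover have "u \<noteq> w"
        proof
          assume "u = w"
          then have "up w p" "up p w" "up x p" using pq \<open>up x w\<close> upx up_trans by blast+
          then have "w = p" "x = w" using up_antisym V pq up_trans upx \<open>up x w\<close> by blast+
          then have "parent T w = Some w" using pq children_parent by blast
          then show False using not_own_ancestor[OF V(3), of 1] by simp
        qed
        ultimately show ?thesis using V rls_less_iff by blast
      qed
    next
      case b
      then obtain y where pq': "up v p'" "up w q'" "y \<in> V" "p' \<in> children T y" "q' \<in> children T y"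
        "sless p' q'"
        by (auto simp: branch_def)
      have upy: "up p' y" "up q' y" using pq' up_parent children_parent by blast+
      from up_linear[OF pq(2) pq'(1)] consider "q = p'" | "q \<noteq> p'" "up q p'" | "q \<noteq> p'" "up p' q" by blast
      then show ?thesis
      proof cases
        case 1
        then have "y = x" using pq pq' children_parent by (metis option.inject)
        then have "branch u p w q'" using pq pq' 1 sless_trans[of x p q q'] unfolding branch_def by blast
        then show ?thesis using V rls_less_iff by blast
      next
        case 2
        then have "up x p'" using pq up_child by blast
        then have "up u p'" using pq upx up_trans by blast
        then have "branch u p' w q'" using pq' unfolding branch_def by blast
        then show ?thesis using V rls_less_iff by blast
      next
        case 3
        then have "up y q" using pq' up_child by blast
        then have "up w q" using pq' upy up_trans by blast
        then have "branch u p w q" using pq unfolding branch_def by blast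
        then show ?thesis using V rls_less_iff by blast
      qed
    qed
  qed
qed

text \<open>At the lowest ancestor of \<open>u\<close> shared with \<open>v\<close> the two lines
  arrive through different children, unless one of the two vertices is that ancestor.\<close>

lemma rls_less_total:
  assumes V: "u \<in> V" "v \<in> V" and ne: "u \<noteq> v"
  shows "rls_less T u v \<or> rls_less T v u"
proof -
  define P where "P a \<longleftrightarrow> (\<exists>b w. ancestor T a u = Some w \<and> ancestor T b v = Some w)" for a
  have "\<exists>a. P a" using common_ancestor[OF V] unfolding P_def by blast
  then obtain a where a: "P a" "\<And>a'. a' < a \<Longrightarrow> \<not> P a'"
    by (metis exists_least_iff)
  then obtain b w where w: "ancestor T a u = Some w" "ancestor T b v = Some w"
    unfolding P_def by blast
  show ?thesis
  proof (cases a)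
    case 0
    then have "up v u" using w by (auto simp: up_def)
    then show ?thesis using V ne rls_less_iff by blast
  next
    case (Suc a')
    note a' = this
    show ?thesis
    proof (cases b)
      case 0
      then have "up u v" using w by (auto simp: up_def)
      then show ?thesis using V ne rls_less_iff by blast
    next
      case (Suc b')
      obtain p where p: "ancestor T a' u = Some p" "parent T p = Some w"
        using w a' by (auto simp: bind_eq_Some_conv)
      obtain q where q: "ancestor T b' v = Some q" "parent T q = Some w"
        using w Suc by (auto simp: bind_eq_Some_conv)
      have "p \<noteq> q" using a(2)[of a'] a' p q unfolding P_def by auto
      have "p \<in> V" "q \<in> V" "w \<in> V" using p q w V ancestor_in by blast+
      then have ch: "p \<in> children T w" "q \<in> children T w" using p q by (auto simp: children_def)
      have upp: "up u p" "up v q" using p q by (auto simp: up_def)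
      from sless_total[OF \<open>w \<in> V\<close> ch \<open>p \<noteq> q\<close>]
      have "branch u p v q \<or> branch v q u p"
        using ch upp \<open>w \<in> V\<close> unfolding branch_def by blast
      then show ?thesis using V rls_less_iff by blast
    qed
  qed
qed

lemma rls_less_asym: "u \<in> V \<Longrightarrow> v \<in> V \<Longrightarrow> rls_less T u v \<Longrightarrow> \<not> rls_less T v u"
  using rls_less_trans rls_less_irrefl by blast

lemma is_rls_pred_unique:
  assumes "u \<in> V" "is_rls_pred T u v" "is_rls_pred T u w" shows "v = w"
  using assms rls_less_asym unfolding is_rls_pred_def by blast

lemma is_rls_succ_unique:
  assumes "u \<in> V" "is_rls_succ T u v" "is_rls_succ T u w" shows "v = w"
  using assms rls_less_asym unfolding is_rls_succ_def by blast

lemma is_rls_succ_iff_pred: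
  assumes "u \<in> V" "v \<in> V"
  shows "is_rls_succ T v u \<longleftrightarrow> is_rls_pred T u v"
  using assms rls_less_asym rls_less_total unfolding is_rls_succ_def is_rls_pred_def by metis

end

text \<open>\<open>covers T v u\<close> describes the immediate predecessor \<open>v\<close> of \<open>u\<close> in the RLS order by finitely
  many parent, child and sibling relations, so that it only depends on a ball around the root.\<close>

inductive least_chain :: "'v rooted_tree \<Rightarrow> 'v \<Rightarrow> 'v \<Rightarrow> bool" for T s where
  least_chain_refl: "least_chain T s s"
| least_chain_step: "least_chain T s x \<Longrightarrow> c \<in> children T x \<Longrightarrow>
    (\<And>c'. c' \<in> children T x \<Longrightarrow> c' = c \<or> sibling_less T c c') \<Longrightarrow> least_chain T s c"

definition next_smaller :: "'v rooted_tree \<Rightarrow> 'v \<Rightarrow> 'v \<Rightarrow> bool" where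
  "next_smaller T s v \<longleftrightarrow> (\<exists>x\<in>verts T. s \<in> children T x \<and> v \<in> children T x \<and> sibling_less T v s \<and>
     (\<forall>c\<in>children T x. sibling_less T c s \<longrightarrow> c = v \<or> sibling_less T c v))"

text \<open>Descendants precede their ancestors, so the predecessor of a leaf is found by going up
  through least children until a smaller sibling exists. The chain from \<open>s\<close> down to
  \<open>u\<close> is this ascent.\<close>

definition chain_smaller :: "'v rooted_tree \<Rightarrow> 'v \<Rightarrow> 'v \<Rightarrow> bool" where
  "chain_smaller T u v \<longleftrightarrow> (\<exists>s. least_chain T s u \<and> next_smaller T s v)"

definition covers :: "'v rooted_tree \<Rightarrow> 'v \<Rightarrow> 'v \<Rightarrow> bool" where
  "covers T v u \<longleftrightarrow>
     v \<in> children T u \<and> (\<forall>c\<in>children T u. c = v \<or> sibling_less T c v) \<or>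
     children T u = {} \<and> chain_smaller T u v"

context family_tree
begin

lemma least_chain_up: "least_chain T s u \<Longrightarrow> up u s"
proof (induction rule: least_chain.induct)
  case (least_chain_step x c)
  then show ?case using up_parent children_parent up_trans by blast
qed simp

text \<open>Below its top, every vertex of the chain is the least child of its parent, so nothing
  branches off on its smaller side. This excludes intermediate branchings in the leaf case of
  \<open>covers_is_rls_pred\<close>.\<close>

lemma least_chain_between:
  assumes "least_chain T s u" "u \<in> V" "up u q" "up q s" "q \<noteq> s" "p \<in> children T x" "q \<in> children T x" "x \<in> V"
  shows "\<not> sless p q"
  using assms
proof (induction rule: least_chain.induct)
  case least_chain_refl
  then have "q = s" using up_antisym by blast
  then show ?case using least_chain_refl by blast
next
  case (least_chain_step y c)
  show ?case
  proof (cases "q = c")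
    case True
    then have "x = y" using least_chain_step children_parent by (metis option.inject)
    then have "p = c \<or> sless c p" using least_chain_step by blast
    then show ?thesis using True least_chain_step.prems sless_irrefl sless_trans \<open>x = y\<close> by metis
  next
    case False
    then have "up y q" using least_chain_step.prems(2) least_chain_step.hyps(2) up_child by blast
    moreover have "y \<in> V" using least_chain_step parent_in children_parent by blast
    ultimately show ?thesis using least_chain_step.IH least_chain_step.prems by metis
  qed
qed

lemma covers_in: "u \<in> V \<Longrightarrow> covers T v u \<Longrightarrow> v \<in> V"
  unfolding covers_def chain_smaller_def next_smaller_def using children_in by blast

text \<open>A vertex is the maximum of its own subtree, so the greatest child comes last before
  \<open>u\<close>. For a leaf, a competitor branches off at \<open>s\<close>, above
  \<open>s\<close> or strictly below \<open>s\<close>: at \<open>s\<close> it is compared with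
  \<open>v\<close> by the sibling order, above \<open>s\<close> it also precedes \<open>v\<close>,
  and below \<open>s\<close> there is no smaller side.\<close>

lemma covers_is_rls_pred:
  assumes u: "u \<in> V" and c: "covers T v u"
  shows "is_rls_pred T u v"
proof -
  have v: "v \<in> V" using assms covers_in by blast
  from c consider (1) "v \<in> children T u" "\<And>c. c \<in> children T u \<Longrightarrow> c = v \<or> sless c v"
    | (2) s x where "children T u = {}" "least_chain T s u" "x \<in> V" "s \<in> children T x"
       "v \<in> children T x" "sless v s" "\<And>c. c \<in> children T x \<Longrightarrow> sless c s \<Longrightarrow> c = v \<or> sless c v"
    unfolding covers_def chain_smaller_def next_smaller_def by blast
  then show ?thesis
  proof cases
    case 1
    have "up v u" using 1 children_parent up_parent by blast
    moreover have "v \<noteq> u" using 1 children_parent not_own_ancestor[of u 1] u by auto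
    ultimately have vu: "rls_less T v u" using rls_less_iff u v by blast
    have "w = v \<or> rls_less T w v" if w: "w \<in> V" "rls_less T w u" for w
    proof -
      from w u consider (a) "up w u" "w \<noteq> u" | (b) p q where "branch w p u q" by (auto simp: rls_less_iff)
      then show ?thesis
      proof cases
        case a
        obtain d where d: "d \<in> children T u" and wd: "up w d"
          using up_strict_child a w(1) by blast
        then have dv: "d = v \<or> sless d v" using 1 by blast
        from dv show ?thesis
        proof
          assume "d = v" then show ?thesis using wd rls_less_iff w v by blast
        next
          assume "sless d v"
          then have "branch w d v v" using wd 1 d u unfolding branch_def by auto
          then show ?thesis using rls_less_iff w v by blast
        qed
      next
        case b
        then show ?thesis using branch_up_right \<open>up v u\<close> rls_less_iff w v by blast
      qed
    qed
    then show ?thesis using vu v unfolding is_rls_pred_def by blast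
  next
    case 2
    have us: "up u s" using 2 least_chain_up by blast
    then have "branch v v u s" using 2 unfolding branch_def by auto
    then have vu: "rls_less T v u" using rls_less_iff u v by blast
    have "w = v \<or> rls_less T w v" if w: "w \<in> V" "rls_less T w u" for w
    proof -
      have "\<not> (up w u \<and> w \<noteq> u)" using up_strict_child 2(1) w(1) by blast
      then obtain p q where b: "branch w p u q" using w u rls_less_iff by blast
      then obtain y where pq: "up w p" "up u q" "y \<in> V" "p \<in> children T y" "q \<in> children T y" "sless p q"
        unfolding branch_def by blast
      consider "q = s" | "q \<noteq> s" "up q s" | "q \<noteq> s" "up s q" using up_linear[OF us pq(2)] by blast
      then show ?thesis
      proof cases
        case 1
        then have "y = x" using 2 pq children_parent by (metis option.inject)
        then have "p = v \<or> sless p v" using 1 pq 2 by blast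
        then show ?thesis
        proof
          assume "p = v" then show ?thesis using pq rls_less_iff w v by blast
        next
          assume "sless p v"
          then have "branch w p v v" using pq 2 \<open>y = x\<close> unfolding branch_def by auto
          then show ?thesis using rls_less_iff w v by blast
        qed
      next
        case c2: 2
        then have "\<not> sless p q"
          using least_chain_between[OF 2(2) u pq(2) _ _ pq(4,5,3)] by blast
        then show ?thesis using pq by blast
      next
        case 3
        then have "up x q" using 2(4) up_child by blast
        then have "up v q" using 2 children_parent up_parent up_trans by blast
        then have "branch w p v q" using pq unfolding branch_def by blast
        then show ?thesis using rls_less_iff w v by blast
      qed
    qed
    then show ?thesis using vu v unfolding is_rls_pred_def by blast
  qed
qed

lemma finite_has_greatest:
  assumes "finite A" "A \<noteq> {}" "A \<subseteq> children T x" "x \<in> V"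
  shows "\<exists>m\<in>A. \<forall>a\<in>A. a = m \<or> sless a m"
  using assms
proof (induction rule: finite_ne_induct)
  case (singleton a) then show ?case by auto
next
  case (insert a A)
  then obtain m where m: "m \<in> A" "\<forall>a\<in>A. a = m \<or> sless a m" by auto
  have am: "a \<in> children T x" "m \<in> children T x" using insert.prems m by auto
  consider "a = m" | "sless a m" | "sless m a"
    using sless_total[OF insert.prems(2) am] by metis
  then show ?case
  proof cases
    case 3
    have "sless b a" if "b \<in> A" for b
    proof (cases "b = m")
      case False
      then have "sless b m" using m that by blast
      moreover have "b \<in> children T x" using that insert.prems by auto
      ultimately show ?thesis using sless_trans[OF insert.prems(2) _ am(2,1)] 3 by blast
    qed (use 3 in simp)
    then show ?thesis by auto
  qed (use m in auto)
qed

text \<open>Predecessors are unique, so by the converse it suffices to exhibit some covering vertex.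
  For a leaf, the given predecessor shows that \<open>u\<close> or one of its ancestors has a
  smaller sibling; the lowest such vertex is the top of the chain.\<close>

lemma is_rls_pred_covers:
  assumes u: "u \<in> V" and p: "is_rls_pred T u v"
  shows "covers T v u"
proof -
  have "\<exists>v'. covers T v' u"
  proof (cases "children T u = {}")
    case False
    then obtain m where "m \<in> children T u" "\<forall>a\<in>children T u. a = m \<or> sless a m"
      using finite_has_greatest[OF finite_children] u by blast
    then show ?thesis unfolding covers_def by blast
  next
    case True
    have v: "v \<in> V" and vu: "rls_less T v u" using p by (auto simp: is_rls_pred_def)
    have "\<not> (up v u \<and> v \<noteq> u)" using up_strict_child True v by blast
    then obtain a b where "branch v a u b" using vu rls_less_iff u v by blast
    then obtain x k where ab: "ancestor T k u = Some b" "x \<in> V" "a \<in> children T x" "b \<in> children T x" "sless a b"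
      unfolding branch_def up_def by blast
    define P where "P k \<longleftrightarrow> (\<exists>b x a. ancestor T k u = Some b \<and> x \<in> V \<and> a \<in> children T x \<and> b \<in> children T x \<and> sless a b)" for k
    have "P k" using ab unfolding P_def by blast
    then obtain k where k: "P k" "\<And>l. l < k \<Longrightarrow> \<not> P l" by (metis exists_least_iff)
    then obtain s x a where s: "ancestor T k u = Some s" "x \<in> V" "a \<in> children T x" "s \<in> children T x" "sless a s"
      unfolding P_def by blast
    have ch: "least_chain T s y" if "ancestor T l u = Some y" "l \<le> k" for l y
      using that(2,1)
    proof (induction l arbitrary: y rule: inc_induct)
      case base
      then show ?case using s by (simp add: least_chain_refl)
    next
      case (step n)
      obtain z where z: "ancestor T (Suc n) u = Some z"
        using s(1) step(2) by (metis ancestor_le_Some Suc_leI)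
      then have yz: "parent T y = Some z" using step by simp
      have V: "y \<in> V" "z \<in> V" using step z ancestor_in u by blast+
      then have yc: "y \<in> children T z" using yz by (simp add: children_def)
      have "c' = y \<or> sless y c'" if "c' \<in> children T z" for c'
        using k(2)[OF step(2)] step.prems V yc that sless_total[of z c' y] unfolding P_def by blast
      then show ?case using least_chain_step step.IH[OF z] yc by metis
    qed
    have lc: "least_chain T s u" using ch[of 0 u] by simp
    define A where "A = {c \<in> children T x. sless c s}"
    have "finite A" "A \<noteq> {}" "A \<subseteq> children T x" using finite_children s unfolding A_def by auto
    then obtain m where "m \<in> A" "\<forall>c\<in>A. c = m \<or> sless c m" using finite_has_greatest s by blast
    then have "next_smaller T s m" using s unfolding next_smaller_def A_def by blast
    then show ?thesis using lc True unfolding covers_def chain_smaller_def by blast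
  qed
  then obtain v' where v': "covers T v' u" by blast
  then have "v' = v" using covers_is_rls_pred u p is_rls_pred_unique by blast
  then show ?thesis using v' by blast
qed

lemma is_rls_pred_iff: "u \<in> V \<Longrightarrow> is_rls_pred T u v \<longleftrightarrow> covers T v u"
  using covers_is_rls_pred is_rls_pred_covers by blast

lemma is_rls_succ_iff:
  assumes "u \<in> V" shows "is_rls_succ T u v \<longleftrightarrow> v \<in> V \<and> covers T u v"
  using assms is_rls_succ_iff_pred[of v u] is_rls_pred_iff[of v u]
  unfolding is_rls_succ_def by blast

end

section \<open>Locality of the succession line\<close>

lemma tree_iso_on_sym:
  assumes "tree_iso_on T A T' B f" "root T \<in> A"
  shows "tree_iso_on T' B T A (inv_into A f)"
proof -
  let ?g = "inv_into A f"
  have bij: "bij_betw f A B" and r: "f (root T) = root T'"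
    and P: "\<And>u v. u \<in> A \<Longrightarrow> v \<in> A \<Longrightarrow> parent T u = Some v \<longleftrightarrow> parent T' (f u) = Some (f v)"
    and S: "\<And>p u v. p \<in> A \<Longrightarrow> u \<in> A \<Longrightarrow> v \<in> A \<Longrightarrow> parent T u = Some p \<Longrightarrow> parent T v = Some p \<Longrightarrow>
        (sibling_less T u v \<longleftrightarrow> sibling_less T' (f u) (f v))"
    using assms(1) unfolding tree_iso_on_def by blast+
  have g: "?g x \<in> A" "f (?g x) = x" if "x \<in> B" for x
    using that bij by (auto simp: bij_betw_def inv_into_into f_inv_into_f)
  have "?g (root T') = root T"
    using bij assms(2) r by (metis bij_betw_inv_into_left)
  moreover have P': "parent T' u = Some v \<longleftrightarrow> parent T (?g u) = Some (?g v)" if "u \<in> B" "v \<in> B" for u v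
    using P[of "?g u" "?g v"] g that by simp
  moreover have "sibling_less T' u v \<longleftrightarrow> sibling_less T (?g u) (?g v)"
    if "p \<in> B" "u \<in> B" "v \<in> B" "parent T' u = Some p" "parent T' v = Some p" for p u v
    using S[of "?g p" "?g u" "?g v"] P' g that by simp
  ultimately show ?thesis
    using bij_betw_inv_into[OF bij] unfolding tree_iso_on_def by blast
qed

lemma tree_iso_on_trans:
  assumes "tree_iso_on T A T' B f" "tree_iso_on T' B T'' C g"
  shows "tree_iso_on T A T'' C (g \<circ> f)"
proof -
  have bij: "bij_betw f A B" "bij_betw g B C"
    using assms by (auto simp: tree_iso_on_def)
  then have fB: "f x \<in> B" if "x \<in> A" for x using that by (auto simp: bij_betw_def)
  show ?thesis
    unfolding tree_iso_on_def
  proof (intro conjI ballI impI)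
    show "bij_betw (g \<circ> f) A C" using bij bij_betw_trans by blast
    show "(g \<circ> f) (root T) = root T''" using assms by (simp add: tree_iso_on_def)
    show "parent T u = Some v \<longleftrightarrow> parent T'' ((g \<circ> f) u) = Some ((g \<circ> f) v)"
      if "u \<in> A" "v \<in> A" for u v
      using assms that fB unfolding tree_iso_on_def by simp
    show "sibling_less T u v \<longleftrightarrow> sibling_less T'' ((g \<circ> f) u) ((g \<circ> f) v)"
      if "p \<in> A" "u \<in> A" "v \<in> A" "parent T u = Some p" "parent T v = Some p" for p u v
    proof -
      have "parent T' (f u) = Some (f p)" "parent T' (f v) = Some (f p)"
        "sibling_less T u v \<longleftrightarrow> sibling_less T' (f u) (f v)"
        using assms(1) that unfolding tree_iso_on_def by blast+
      moreover have "sibling_less T' (f u) (f v) \<longleftrightarrow> sibling_less T'' (g (f u)) (g (f v))"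
        using assms(2) fB that calculation(1,2) unfolding tree_iso_on_def by blast
      ultimately show ?thesis by simp
    qed
  qed
qed

lemma tree_iso_on_id: "tree_iso_on T A T A id"
  by (simp add: tree_iso_on_def)

lemma root_ball_verts: "root_ball T r \<subseteq> verts T"
  by (auto simp: root_ball_def)

lemma root_ball_mono: "r \<le> R \<Longrightarrow> root_ball T r \<subseteq> root_ball T R"
  unfolding root_ball_def using le_trans by blast

lemma root_ball_Suc:
  assumes "x \<in> root_ball T r" "adjacent T x y" shows "y \<in> root_ball T (Suc r)"
proof -
  from assms obtain k where "k \<le> r" "(adjacent T ^^ k) (root T) x" by (auto simp: root_ball_def)
  then have "(adjacent T ^^ Suc k) (root T) y" "Suc k \<le> Suc r" using assms by auto
  then show ?thesis using assms unfolding root_ball_def adjacent_def by blast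
qed

lemma adjacent_sym: "adjacent T u v \<longleftrightarrow> adjacent T v u"
  by (auto simp: adjacent_def)

lemma relpowp_prefix:
  assumes "(P ^^ n) x z" "m \<le> n"
  obtains y where "(P ^^ m) x y" "(P ^^ (n - m)) y z"
  using assms relpowp_add[of m "n - m" P] by (auto simp: OO_def)

text \<open>\<open>f\<close> is controlled on the ball only, but every initial piece of a path of
  length at most \<open>R\<close> from the root stays inside that ball.\<close>

lemma tree_iso_on_ball_path:
  assumes iso: "tree_iso_on T (root_ball T R) T' (root_ball T' R) f"
    and root: "root T \<in> verts T"
    and path: "(adjacent T ^^ k) (root T) x" and k: "k \<le> R"
  shows "(adjacent T' ^^ k) (root T') (f x)"
  using path k
proof (induction k arbitrary: x)
  case 0 then show ?case using iso by (auto simp: tree_iso_on_def)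
next
  case (Suc k)
  then obtain y where y: "(adjacent T ^^ k) (root T) y" "adjacent T y x" by auto
  have inV: "y \<in> verts T" "x \<in> verts T" using y by (auto simp: adjacent_def)
  then have b: "y \<in> root_ball T R" "x \<in> root_ball T R"
    using y Suc.prems Suc_leD unfolding root_ball_def by blast+
  then have "f y \<in> root_ball T' R" "f x \<in> root_ball T' R"
    using iso by (auto simp: tree_iso_on_def bij_betw_def)
  moreover have "parent T y = Some x \<longleftrightarrow> parent T' (f y) = Some (f x)"
    "parent T x = Some y \<longleftrightarrow> parent T' (f x) = Some (f y)"
    using iso b by (auto simp: tree_iso_on_def)
  ultimately have "adjacent T' (f y) (f x)"
    using y(2) root_ball_verts[of T' R] unfolding adjacent_def by auto
  then show ?case using Suc.IH[OF y(1)] Suc.prems by auto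
qed

lemma tree_iso_on_ball_in:
  assumes iso: "tree_iso_on T (root_ball T R) T' (root_ball T' R) f"
    and root: "root T \<in> verts T" and x: "x \<in> root_ball T r" and r: "r \<le> R"
  shows "f x \<in> root_ball T' r"
proof -
  from x obtain k where k: "k \<le> r" "(adjacent T ^^ k) (root T) x" by (auto simp: root_ball_def)
  then have "(adjacent T' ^^ k) (root T') (f x)"
    using tree_iso_on_ball_path[OF iso root] r by auto
  moreover have "f x \<in> root_ball T' R"
    using iso subsetD[OF root_ball_mono[OF r] x] unfolding tree_iso_on_def bij_betw_def by blast
  ultimately show ?thesis using k unfolding root_ball_def by blast
qed

text \<open>A child of a vertex at distance \<open>r\<close> may be at distance
  \<open>r + 1\<close>; the strict inequality keeps all children inside the ball on which
  \<open>f\<close> is an isomorphism.\<close>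

lemma tree_iso_on_children:
  assumes iso: "tree_iso_on T (root_ball T R) T' (root_ball T' R) f"
    and root: "root T \<in> verts T" and x: "x \<in> root_ball T r" and r: "r < R"
  shows "children T' (f x) = f ` children T x"
    and "children T x \<subseteq> root_ball T R"
    and "\<And>a b. a \<in> children T x \<Longrightarrow> b \<in> children T x \<Longrightarrow>
      sibling_less T a b \<longleftrightarrow> sibling_less T' (f a) (f b)"
proof -
  have xR: "x \<in> root_ball T R" using x r root_ball_mono[of r R T] by auto
  have xV: "x \<in> verts T" using xR root_ball_verts[of T R] by auto
  have fx: "f x \<in> root_ball T' r" using tree_iso_on_ball_in[OF iso root x] r by simp
  have SR: "root_ball S (Suc r) \<subseteq> root_ball S R" for S :: "'c rooted_tree"
    using r by (intro root_ball_mono) simp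
  show cR: "children T x \<subseteq> root_ball T R"
  proof
    fix c assume "c \<in> children T x"
    then have "adjacent T x c" using xV by (auto simp: children_def adjacent_def)
    then show "c \<in> root_ball T R" using root_ball_Suc[OF x] r root_ball_mono[of "Suc r" R T] by auto
  qed
  show "sibling_less T a b \<longleftrightarrow> sibling_less T' (f a) (f b)"
    if "a \<in> children T x" "b \<in> children T x" for a b
    using that iso xR cR unfolding tree_iso_on_def children_def by blast
  show "children T' (f x) = f ` children T x"
  proof
    show "f ` children T x \<subseteq> children T' (f x)"
    proof
      fix d assume "d \<in> f ` children T x"
      then obtain c where c: "d = f c" "c \<in> children T x" by blast
      have "c \<in> root_ball T R" using c cR by blast
      then have "f c \<in> root_ball T' R" using iso by (auto simp: tree_iso_on_def bij_betw_def)
      moreover have "parent T' (f c) = Some (f x)"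
        using c \<open>c \<in> root_ball T R\<close> xR iso unfolding tree_iso_on_def children_def by blast
      ultimately show "d \<in> children T' (f x)" using c root_ball_verts[of T' R] by (auto simp: children_def)
    qed
    show "children T' (f x) \<subseteq> f ` children T x"
    proof
      fix d assume d: "d \<in> children T' (f x)"
      then have "adjacent T' (f x) d" using fx root_ball_verts[of T' r] by (auto simp: children_def adjacent_def)
      then have "d \<in> root_ball T' R" using root_ball_Suc[OF fx] r root_ball_mono[of "Suc r" R T'] by auto
      moreover have "f ` root_ball T R = root_ball T' R"
        using iso by (simp add: tree_iso_on_def bij_betw_def)
      ultimately obtain c where c: "c \<in> root_ball T R" "d = f c" by blast
      then have "parent T c = Some x"
        using d iso xR unfolding tree_iso_on_def children_def by blast
      then show "d \<in> f ` children T x" using c root_ball_verts[of T R] by (auto simp: children_def)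
    qed
  qed
qed

lemma (in family_tree) in_some_ball:
  assumes "x \<in> V" shows "\<exists>r. x \<in> root_ball T r"
proof -
  have "(adjacent T)\<^sup>*\<^sup>* (root T) x" using dt assms root_in unfolding directed_tree_def by blast
  then obtain k where "(adjacent T ^^ k) (root T) x" using rtranclp_imp_relpowp by metis
  then show ?thesis using assms unfolding root_ball_def by blast
qed

text \<open>A property forced by an isomorphism of a sufficiently large ball. Quantifying over all
  radii from \<open>r\<close> on makes the notion stable under conjunction, with the maximum of the
  two radii.\<close>

definition ball_local :: "'u rooted_tree \<Rightarrow> ('v rooted_tree \<Rightarrow> ('u \<Rightarrow> 'v) \<Rightarrow> bool) \<Rightarrow> bool" where
  "ball_local T P \<longleftrightarrow> (\<exists>r. \<forall>R\<ge>r. \<forall>T' f. ordered_family_tree T' \<longrightarrow>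
      tree_iso_on T (root_ball T R) T' (root_ball T' R) f \<longrightarrow> P T' f)"

lemma ball_local_mono:
  assumes "ball_local T P" "\<And>T' f. P T' f \<Longrightarrow> Q T' f" shows "ball_local T Q"
  using assms unfolding ball_local_def by blast

lemma ball_local_conj:
  assumes "ball_local T P" "ball_local T Q" shows "ball_local T (\<lambda>T' f. P T' f \<and> Q T' f)"
proof -
  from assms obtain r s where
    "\<forall>R\<ge>r. \<forall>T' f. ordered_family_tree T' \<longrightarrow>
      tree_iso_on T (root_ball T R) T' (root_ball T' R) f \<longrightarrow> P T' f"
    "\<forall>R\<ge>s. \<forall>T' f. ordered_family_tree T' \<longrightarrow>
      tree_iso_on T (root_ball T R) T' (root_ball T' R) f \<longrightarrow> Q T' f"
    unfolding ball_local_def by blast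
  then show ?thesis unfolding ball_local_def by (intro exI[of _ "max r s"]) auto
qed

lemma (in family_tree) ball_local_children:
  assumes x: "x \<in> V"
  shows "ball_local T (\<lambda>T' f. f x \<in> verts T' \<and> children T' (f x) = f ` children T x \<and> inj_on f (children T x) \<and>
    (\<forall>a\<in>children T x. \<forall>b\<in>children T x. sibling_less T a b \<longleftrightarrow> sibling_less T' (f a) (f b)))"
proof -
  obtain r where r: "x \<in> root_ball T r" using in_some_ball x by blast
  show ?thesis unfolding ball_local_def
  proof (intro exI[of _ "Suc r"] allI impI)
    fix R T' and f :: "'v \<Rightarrow> 'w" assume R: "Suc r \<le> R" and T': "ordered_family_tree T'"
      and iso: "tree_iso_on T (root_ball T R) T' (root_ball T' R) f"
    note c = tree_iso_on_children[OF iso root_in r Suc_le_lessD[OF R]]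
    have "inj_on f (root_ball T R)" using iso by (simp add: tree_iso_on_def bij_betw_def)
    then have "inj_on f (children T x)" using c(2) inj_on_subset by blast
    moreover have "f x \<in> verts T'"
      using tree_iso_on_ball_in[OF iso root_in r] R root_ball_verts[of T' r] by auto
    ultimately show "f x \<in> verts T' \<and> children T' (f x) = f ` children T x \<and> inj_on f (children T x) \<and>
      (\<forall>a\<in>children T x. \<forall>b\<in>children T x. sibling_less T a b \<longleftrightarrow> sibling_less T' (f a) (f b))"
      using c by blast
  qed
qed

context family_tree
begin

lemma ball_local_least_chain:
  assumes "least_chain T s u" "s \<in> V"
  shows "ball_local T (\<lambda>T' f. least_chain T' (f s) (f u))"
  using assms
proof (induction rule: least_chain.induct)
  case least_chain_refl
  show ?case unfolding ball_local_def by (auto intro: least_chain.intros)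
next
  case (least_chain_step x c)
  have x: "x \<in> V" using least_chain_step.hyps(2) children_parent children_in parent_in by blast
  show ?case
    using ball_local_conj[OF least_chain_step.IH[OF least_chain_step.prems] ball_local_children[OF x]]
  proof (rule ball_local_mono)
    fix T' :: "'b rooted_tree" and f :: "'v \<Rightarrow> 'b"
    assume a: "least_chain T' (f s) (f x) \<and> f x \<in> verts T' \<and> children T' (f x) = f ` children T x \<and>
      inj_on f (children T x) \<and> (\<forall>a\<in>children T x. \<forall>b\<in>children T x. sless a b = sibling_less T' (f a) (f b))"
    show "least_chain T' (f s) (f c)"
    proof (rule least_chain.least_chain_step)
      show "least_chain T' (f s) (f x)" "f c \<in> children T' (f x)" using a least_chain_step.hyps(2) by auto
      fix c' assume "c' \<in> children T' (f x)"
      then obtain d where "c' = f d" "d \<in> children T x" using a by auto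
      then show "c' = f c \<or> sibling_less T' (f c) c'"
        using a least_chain_step.hyps by blast
    qed
  qed
qed

lemma ball_local_next_smaller:
  assumes "next_smaller T s v"
  shows "ball_local T (\<lambda>T' f. next_smaller T' (f s) (f v))"
proof -
  from assms obtain x where x: "x \<in> V" "s \<in> children T x" "v \<in> children T x" "sless v s"
     "\<forall>c\<in>children T x. sless c s \<longrightarrow> c = v \<or> sless c v"
    unfolding next_smaller_def by blast
  show ?thesis
    using ball_local_children[OF x(1)]
  proof (rule ball_local_mono)
    fix T' :: "'b rooted_tree" and f :: "'v \<Rightarrow> 'b"
    assume a: "f x \<in> verts T' \<and> children T' (f x) = f ` children T x \<and>
      inj_on f (children T x) \<and> (\<forall>a\<in>children T x. \<forall>b\<in>children T x. sless a b = sibling_less T' (f a) (f b))"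
    show "next_smaller T' (f s) (f v)"
      unfolding next_smaller_def
    proof (rule bexI[of _ "f x"], intro conjI ballI impI)
      show "f s \<in> children T' (f x)" "f v \<in> children T' (f x)" "sibling_less T' (f v) (f s)" "f x \<in> verts T'"
        using a x by auto
      fix c assume c: "c \<in> children T' (f x)" "sibling_less T' c (f s)"
      then obtain d where d: "c = f d" "d \<in> children T x" using a by auto
      then show "c = f v \<or> sibling_less T' c (f v)" using a c x by blast
    qed
  qed
qed

lemma ball_local_covers:
  assumes u: "u \<in> V" and c: "covers T v u"
  shows "ball_local T (\<lambda>T' f. covers T' (f v) (f u))"
proof -
  from c consider (1) "v \<in> children T u" "\<forall>c\<in>children T u. c = v \<or> sless c v"
    | (2) s where "children T u = {}" "least_chain T s u" "next_smaller T s v"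
    unfolding covers_def chain_smaller_def by blast
  then show ?thesis
  proof cases
    case 1
    show ?thesis using ball_local_children[OF u]
    proof (rule ball_local_mono)
      fix T' :: "'b rooted_tree" and f :: "'v \<Rightarrow> 'b"
      assume a: "f u \<in> verts T' \<and> children T' (f u) = f ` children T u \<and>
        inj_on f (children T u) \<and> (\<forall>a\<in>children T u. \<forall>b\<in>children T u. sless a b = sibling_less T' (f a) (f b))"
      then show "covers T' (f v) (f u)" using 1 unfolding covers_def by auto
    qed
  next
    case 2
    have s: "s \<in> V" using 2 children_in unfolding next_smaller_def by blast
    show ?thesis
      using ball_local_conj[OF ball_local_children[OF u]
        ball_local_conj[OF ball_local_least_chain[OF 2(2) s] ball_local_next_smaller[OF 2(3)]]]
    proof (rule ball_local_mono)
      fix T' :: "'b rooted_tree" and f :: "'v \<Rightarrow> 'b"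
      assume a: "(f u \<in> verts T' \<and> children T' (f u) = f ` children T u \<and>
        inj_on f (children T u) \<and> (\<forall>a\<in>children T u. \<forall>b\<in>children T u. sless a b = sibling_less T' (f a) (f b))) \<and>
        least_chain T' (f s) (f u) \<and> next_smaller T' (f s) (f v)"
      then show "covers T' (f v) (f u)" using 2(1) unfolding covers_def chain_smaller_def by blast
    qed
  qed
qed

end

section \<open>Degrees along the succession line as local conditions\<close>

definition line_step :: "bool \<Rightarrow> 'v rooted_tree \<Rightarrow> 'v \<Rightarrow> 'v \<Rightarrow> bool" where
  "line_step b T u v \<longleftrightarrow> v \<in> verts T \<and> (if b then covers T v u else covers T u v)"

text \<open>Asserts that the line really has a \<open>j\<close>-th vertex in the given direction,
  before the convention of standing still is applied. This positive form is what isomorphisms of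
  large balls carry over, so it defines an open set of tree classes.\<close>

definition reaches_degree :: "bool \<Rightarrow> 'v rooted_tree \<Rightarrow> nat \<Rightarrow> nat \<Rightarrow> bool" where
  "reaches_degree b T j k \<longleftrightarrow> (\<exists>v. (line_step b T ^^ j) (root T) v \<and> card (children T v) = k)"

context family_tree
begin

lemma line_path_in: "(line_step b T ^^ j) (root T) v \<Longrightarrow> v \<in> V"
  by (cases j) (auto simp: line_step_def root_in)

lemma ball_local_line_path:
  assumes "(line_step b T ^^ j) (root T) v"
  shows "ball_local T (\<lambda>T' f. (line_step b T' ^^ j) (root T') (f v))"
  using assms
proof (induction j arbitrary: v)
  case 0
  then show ?case unfolding ball_local_def by (auto simp: tree_iso_on_def)
next
  case (Suc j)
  then obtain u where u: "(line_step b T ^^ j) (root T) u" "line_step b T u v" by auto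
  have V: "u \<in> V" "v \<in> V" using line_path_in[OF u(1)] u(2) by (auto simp: line_step_def)
  have "ball_local T (\<lambda>T' f. f v \<in> verts T' \<and> (if b then covers T' (f v) (f u) else covers T' (f u) (f v)))"
  proof -
    have "ball_local T (\<lambda>T' f. f v \<in> verts T')"
      by (rule ball_local_mono[OF ball_local_children[OF V(2)]]) simp
    moreover have "ball_local T (\<lambda>T' f. if b then covers T' (f v) (f u) else covers T' (f u) (f v))"
      using u(2) V ball_local_covers[of u v] ball_local_covers[of v u]
      by (cases b) (auto simp: line_step_def)
    ultimately show ?thesis by (rule ball_local_conj)
  qed
  from ball_local_conj[OF Suc.IH[OF u(1)] this] show ?case
  proof (rule ball_local_mono)
    fix T' :: "'b rooted_tree" and f :: "'v \<Rightarrow> 'b"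
    assume a: "(line_step b T' ^^ j) (root T') (f u) \<and>
      f v \<in> verts T' \<and> (if b then covers T' (f v) (f u) else covers T' (f u) (f v))"
    then have "line_step b T' (f u) (f v)" unfolding line_step_def by blast
    then show "(line_step b T' ^^ Suc j) (root T') (f v)" using a by auto
  qed
qed

lemma ball_local_reaches_degree:
  assumes "reaches_degree b T j k"
  shows "ball_local T (\<lambda>T' f. reaches_degree b T' j k)"
proof -
  from assms obtain v where v: "(line_step b T ^^ j) (root T) v" "card (children T v) = k"
    by (auto simp: reaches_degree_def)
  from ball_local_conj[OF ball_local_line_path[OF v(1)] ball_local_children[OF line_path_in[OF v(1)]]]
  show ?thesis
    by (rule ball_local_mono) (use v card_image in \<open>force simp: reaches_degree_def\<close>)
qed

lemma line_step_unique:
  assumes "u \<in> V" "line_step b T u v" "line_step b T u w" shows "v = w"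
proof (cases b)
  case True
  then show ?thesis using assms is_rls_pred_unique is_rls_pred_iff unfolding line_step_def by auto
next
  case False
  then show ?thesis using assms is_rls_succ_unique is_rls_succ_iff unfolding line_step_def by auto
qed

lemma line_path_unique:
  "(line_step b T ^^ j) (root T) v \<Longrightarrow> (line_step b T ^^ j) (root T) w \<Longrightarrow> v = w"
proof (induction j arbitrary: v w)
  case (Suc j)
  then obtain x y where "(line_step b T ^^ j) (root T) x" "line_step b T x v"
    "(line_step b T ^^ j) (root T) y" "line_step b T y w" by auto
  then show ?case using Suc.IH[of x y] line_step_unique line_path_in by blast
qed simp

definition line_next :: "bool \<Rightarrow> 'v \<Rightarrow> 'v" where
  "line_next b u = (if \<exists>v. line_step b T u v then THE v. line_step b T u v else u)"

lemma rls_pred_line_next: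
  assumes "u \<in> V" shows "rls_pred T u = line_next True u"
proof -
  have "is_rls_pred T u = line_step True T u"
    using is_rls_pred_iff[OF assms] covers_in[OF assms] by (auto simp: line_step_def fun_eq_iff)
  then show ?thesis unfolding rls_pred_def line_next_def by presburger
qed

lemma rls_succ_line_next:
  assumes "u \<in> V" shows "rls_succ T u = line_next False u"
proof -
  have "is_rls_succ T u = line_step False T u"
    using is_rls_succ_iff[OF assms] by (auto simp: line_step_def fun_eq_iff)
  then show ?thesis unfolding rls_succ_def line_next_def by presburger
qed

lemma line_next_step: "u \<in> V \<Longrightarrow> line_step b T u v \<Longrightarrow> line_next b u = v"
  unfolding line_next_def using line_step_unique by (metis the_equality)

lemma line_next_in: "u \<in> V \<Longrightarrow> line_next b u \<in> V"
proof (cases "\<exists>v. line_step b T u v")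
  case True
  then obtain v where "line_step b T u v" by blast
  then show "u \<in> V \<Longrightarrow> ?thesis" using line_next_step by (auto simp: line_step_def)
qed (simp add: line_next_def)

lemma line_next_pow_in: "(line_next b ^^ n) (root T) \<in> V"
  by (induction n) (auto simp: root_in line_next_in)

lemma succession_line_eq:
  "succession_line T n = (line_next (n < 0) ^^ nat \<bar>n\<bar>) (root T)"
proof -
  have "(rls_succ T ^^ m) (root T) = (line_next False ^^ m) (root T)" for m
    by (induction m) (auto simp: rls_succ_line_next line_next_pow_in)
  moreover have "(rls_pred T ^^ m) (root T) = (line_next True ^^ m) (root T)" for m
    by (induction m) (auto simp: rls_pred_line_next line_next_pow_in)
  ultimately show ?thesis by (simp add: succession_line_def)
qed

lemma line_next_pow_path:
  "\<exists>j\<le>n. (line_step b T ^^ j) (root T) ((line_next b ^^ n) (root T)) \<and>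
     (j = n \<or> (\<nexists>v. line_step b T ((line_next b ^^ n) (root T)) v))"
proof (induction n)
  case 0 then show ?case by simp
next
  case (Suc n)
  then obtain j where j: "j \<le> n" "(line_step b T ^^ j) (root T) ((line_next b ^^ n) (root T))"
    "j = n \<or> (\<nexists>v. line_step b T ((line_next b ^^ n) (root T)) v)" by blast
  show ?case
  proof (cases "\<exists>v. line_step b T ((line_next b ^^ n) (root T)) v")
    case True
    then obtain v where v: "line_step b T ((line_next b ^^ n) (root T)) v" by blast
    then have "(line_next b ^^ Suc n) (root T) = v" using line_next_step line_next_pow_in by simp
    moreover have "j = n" using True j by blast
    ultimately show ?thesis using v j by (intro exI[of _ "Suc n"]) auto
  next
    case False
    then have "(line_next b ^^ Suc n) (root T) = (line_next b ^^ n) (root T)" by (simp add: line_next_def)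
    then show ?thesis using j False by (intro exI[of _ j]) auto
  qed
qed

text \<open>Either the line makes \<open>n\<close> steps, or it stops after \<open>j\<close> of them
  and stands still. Every vertex has some degree, so denying \<open>reaches_degree\<close> at
  \<open>Suc j\<close> for all degrees says that step \<open>Suc j\<close> does not exist.\<close>

lemma card_children_line_next_pow:
  "card (children T ((line_next b ^^ n) (root T))) = k \<longleftrightarrow>
     (\<exists>j\<le>n. reaches_degree b T j k \<and> (j = n \<or> (\<forall>k'. \<not> reaches_degree b T (Suc j) k')))"
  (is "?L \<longleftrightarrow> ?R")
proof -
  let ?u = "(line_next b ^^ n) (root T)"
  obtain j where j: "j \<le> n" "(line_step b T ^^ j) (root T) ?u"
    "j = n \<or> (\<nexists>v. line_step b T ?u v)" using line_next_pow_path by blast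
  \<comment> \<open>Once the line stops at step \<open>j\<close>, uniqueness of steps excludes every
    longer path.\<close>
  have noext: "\<not> (line_step b T ^^ i) (root T) w" if "j < n" "i > j" for i w
  proof
    assume "(line_step b T ^^ i) (root T) w"
    then obtain x where "(line_step b T ^^ Suc j) (root T) x"
      using \<open>i > j\<close> relpowp_prefix[of i _ _ _ "Suc j"] by (metis Suc_leI)
    then obtain y where "(line_step b T ^^ j) (root T) y" "line_step b T y x" by auto
    then show False using j line_path_unique that by blast
  qed
  show ?thesis
  proof
    assume ?L
    then have "reaches_degree b T j k" using j unfolding reaches_degree_def by blast
    moreover have "j = n \<or> (\<forall>k'. \<not> reaches_degree b T (Suc j) k')"
      using noext j unfolding reaches_degree_def by (metis le_neq_implies_less lessI)
    ultimately show ?R using j by blast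
  next
    assume ?R
    then obtain i v where i: "i \<le> n" "(line_step b T ^^ i) (root T) v" "card (children T v) = k"
      "i = n \<or> (\<forall>k'. \<not> reaches_degree b T (Suc i) k')" unfolding reaches_degree_def by blast
    have "i = j"
    proof (rule ccontr)
      assume "i \<noteq> j"
      then consider "i > j" | "i < j" by linarith
      then show False
      proof cases
        case 1
        then show False using noext i by (metis less_le_trans)
      next
        case 2
        then obtain x where "(line_step b T ^^ Suc i) (root T) x"
          using j(2) relpowp_prefix[of j _ _ _ "Suc i"] by (metis Suc_leI)
        then show False using i 2 j(1) unfolding reaches_degree_def by auto
      qed
    qed
    then show ?L using i j line_path_unique by blast
  qed
qed

lemma backward_sequence_iff:
  "backward_sequence T n = int k - 1 \<longleftrightarrow>
     (\<exists>j\<le>nat \<bar>n + 1\<bar>. reaches_degree (n + 1 < 0) T j k \<and>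
        (j = nat \<bar>n + 1\<bar> \<or> (\<forall>k'. \<not> reaches_degree (n + 1 < 0) T (Suc j) k')))"
  unfolding backward_sequence_def succession_line_eq
  by (simp flip: card_children_line_next_pow)

end

section \<open>Invariance under isomorphism and measurability of the backward map\<close>

lemma tree_iso_on_verts_ball:
  assumes iso: "tree_iso_on T (verts T) T' (verts T') f" and T: "root T \<in> verts T"
  shows "tree_iso_on T (root_ball T r) T' (root_ball T' r) f"
proof -
  have bij: "bij_betw f (verts T) (verts T')" using iso by (simp add: tree_iso_on_def)
  have adj: "adjacent T' (f u) (f v) \<longleftrightarrow> adjacent T u v" if "u \<in> verts T" "v \<in> verts T" for u v
    using that iso bij unfolding adjacent_def tree_iso_on_def by (auto simp: bij_betw_def)
  have path: "(adjacent T' ^^ k) (root T') (f x) \<longleftrightarrow> (adjacent T ^^ k) (root T) x" if "x \<in> verts T" for k x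
    using that
  proof (induction k arbitrary: x)
    case 0
    have "f (root T) = root T'" "inj_on f (verts T)" using iso bij by (auto simp: tree_iso_on_def bij_betw_def)
    then show ?case using T 0 by (auto dest: inj_onD)
  next
    case (Suc k)
    show ?case
    proof
      assume "(adjacent T' ^^ Suc k) (root T') (f x)"
      then obtain y' where y': "(adjacent T' ^^ k) (root T') y'" "adjacent T' y' (f x)" by auto
      then obtain y where "y \<in> verts T" "y' = f y"
        using bij by (auto simp: bij_betw_def adjacent_def)
      then show "(adjacent T ^^ Suc k) (root T) x" using y' Suc adj by auto
    next
      assume "(adjacent T ^^ Suc k) (root T) x"
      then obtain y where y: "(adjacent T ^^ k) (root T) y" "adjacent T y x" by auto
      then have "y \<in> verts T" by (simp add: adjacent_def)
      then show "(adjacent T' ^^ Suc k) (root T') (f x)" using y Suc adj by auto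
    qed
  qed
  have img: "f ` root_ball T r = root_ball T' r"
  proof -
    have V: "f ` verts T = verts T'" using bij by (simp add: bij_betw_def)
    have mem: "f x \<in> root_ball T' r \<longleftrightarrow> x \<in> root_ball T r" if "x \<in> verts T" for x
      using path[OF that] that V unfolding root_ball_def by auto
    show ?thesis
    proof (intro equalityI subsetI)
      fix y assume "y \<in> f ` root_ball T r"
      then show "y \<in> root_ball T' r" using mem root_ball_verts[of T r] by auto
    next
      fix y assume y: "y \<in> root_ball T' r"
      then obtain x where "x \<in> verts T" "y = f x" using V root_ball_verts[of T' r] by blast
      then show "y \<in> f ` root_ball T r" using y mem by blast
    qed
  qed
  have "bij_betw f (root_ball T r) (root_ball T' r)"
    using img bij root_ball_verts[of T r] unfolding bij_betw_def by (auto intro: inj_on_subset)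
  then show ?thesis using iso root_ball_verts[of T r] unfolding tree_iso_on_def by blast
qed

lemma ball_local_isomorphic:
  assumes "ball_local T P" "tree_isomorphic T T'" "ordered_family_tree T" "ordered_family_tree T'"
  obtains f where "P T' f"
proof -
  obtain f where f: "tree_iso_on T (verts T) T' (verts T') f"
    using assms(2) by (auto simp: tree_isomorphic_def)
  have "root T \<in> verts T" using assms(3) by (simp add: ordered_family_tree_def)
  with f have "tree_iso_on T (root_ball T r) T' (root_ball T' r) f" for r
    using tree_iso_on_verts_ball by blast
  then have "P T' f" using assms(1,4) unfolding ball_local_def by blast
  then show ?thesis by (rule that)
qed

lemma tree_isomorphic_sym:
  "tree_isomorphic T T' \<Longrightarrow> ordered_family_tree T \<Longrightarrow> tree_isomorphic T' T"
  using family_tree.root_in[OF family_tree.intro] tree_iso_on_sym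
  unfolding tree_isomorphic_def by blast

lemma tree_isomorphic_trans:
  "tree_isomorphic T T' \<Longrightarrow> tree_isomorphic T' T'' \<Longrightarrow> tree_isomorphic T T''"
  unfolding tree_isomorphic_def using tree_iso_on_trans by blast

lemma tree_isomorphic_refl: "tree_isomorphic T T"
  unfolding tree_isomorphic_def using tree_iso_on_id by blast

lemma reaches_degree_iso:
  assumes "tree_isomorphic T T'" "ordered_family_tree T" "ordered_family_tree T'"
  shows "reaches_degree b T j k \<longleftrightarrow> reaches_degree b T' j k"
  using ball_local_isomorphic[OF family_tree.ball_local_reaches_degree[OF family_tree.intro], OF assms(2) _ assms]
    ball_local_isomorphic[OF family_tree.ball_local_reaches_degree[OF family_tree.intro], OF assms(3) _
      tree_isomorphic_sym[OF assms(1,2)] assms(3,2)]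
  by blast

lemma backward_sequence_iso:
  assumes "tree_isomorphic T T'" "ordered_family_tree T" "ordered_family_tree T'"
  shows "backward_sequence T = backward_sequence T'"
proof
  fix n
  \<comment> \<open>The value is a cardinality minus one, hence of the form that
    \<open>backward_sequence_iff\<close> can test.\<close>
  have "backward_sequence T' n = int (nat (backward_sequence T' n + 1)) - 1"
    by (simp add: backward_sequence_def)
  then show "backward_sequence T n = backward_sequence T' n"
    using family_tree.backward_sequence_iff[OF family_tree.intro, OF assms(2)]
      family_tree.backward_sequence_iff[OF family_tree.intro, OF assms(3)]
    unfolding reaches_degree_iso[OF assms] by metis
qed

lemma tree_classes_someI:
  assumes "C \<in> tree_classes"
  shows "(SOME T. T \<in> C) \<in> C"
proof -
  from assms obtain T :: "nat rooted_tree" where "C = tree_class T" "ordered_family_tree T"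
    by (auto simp: tree_classes_def)
  then have "T \<in> C" using tree_isomorphic_refl by (auto simp: tree_class_def)
  then show ?thesis by (rule someI)
qed

lemma tree_classes_members:
  assumes "C \<in> tree_classes" "T \<in> C" "T' \<in> C"
  shows "ordered_family_tree T" "tree_isomorphic T T'"
proof -
  from assms(1) obtain S :: "nat rooted_tree" where "C = tree_class S" "ordered_family_tree S"
    by (auto simp: tree_classes_def)
  then show "ordered_family_tree T" "tree_isomorphic T T'"
    using assms tree_isomorphic_sym[of S T] tree_isomorphic_trans[of T S T'] by (auto simp: tree_class_def)
qed

lemma openin_local_topology_subset: "openin local_topology U \<Longrightarrow> U \<subseteq> tree_classes"
proof -
  assume "openin local_topology U"
  then have "U \<subseteq> topspace local_topology" by (rule openin_subset)
  also have "topspace local_topology \<subseteq> tree_classes"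
    unfolding local_topology_def topology_generated_by_topspace by (auto simp: local_nbhd_def)
  finally show ?thesis .
qed

lemma space_tree_borel: "space tree_borel = tree_classes"
  and sets_tree_borel: "sets tree_borel = sigma_sets tree_classes {U. openin local_topology U}"
  using openin_local_topology_subset
  by (auto simp: tree_borel_def intro!: space_measure_of sets_measure_of)

text \<open>The ball that settles the condition for a representative gives a basic neighbourhood of
  its class. Inside it the condition holds for a tree having that ball, and passes to the chosen
  representative by isomorphism invariance.\<close>

lemma reaches_degree_open:
  "openin local_topology {C \<in> tree_classes. reaches_degree b (SOME T. T \<in> C) j k}" (is "openin _ ?A")
proof (subst openin_subopen, rule ballI)
  fix C assume C: "C \<in> ?A"
  define T where "T = (SOME T. T \<in> C)"
  have T: "T \<in> C" "ordered_family_tree T" "reaches_degree b T j k"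
    using C tree_classes_someI tree_classes_members unfolding T_def by blast+
  then obtain r where r: "\<And>(T' :: nat rooted_tree) f. ordered_family_tree T' \<Longrightarrow>
      tree_iso_on T (root_ball T r) T' (root_ball T' r) f \<Longrightarrow> reaches_degree b T' j k"
    using family_tree.ball_local_reaches_degree[OF family_tree.intro, of T b j k]
    unfolding ball_local_def by blast
  have "openin local_topology (local_nbhd T r)"
    unfolding local_topology_def by (rule topology_generated_by_Basis) (use T in blast)
  moreover have "C \<in> local_nbhd T r"
    using C T tree_iso_on_id unfolding local_nbhd_def by blast
  moreover have "local_nbhd T r \<subseteq> ?A"
  proof
    fix D assume "D \<in> local_nbhd T r"
    then obtain T' f where D: "D \<in> tree_classes" "T' \<in> D"
      "tree_iso_on T (root_ball T r) T' (root_ball T' r) f" by (auto simp: local_nbhd_def)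
    have T': "ordered_family_tree T'" using D tree_classes_members by blast
    let ?S = "SOME T. T \<in> D"
    have "?S \<in> D" using tree_classes_someI D by blast
    then have "tree_isomorphic T' ?S" "ordered_family_tree ?S" using D tree_classes_members by blast+
    then have "reaches_degree b ?S j k" using r[OF T' D(3)] reaches_degree_iso T' by blast
    then show "D \<in> ?A" using D by blast
  qed
  ultimately show "\<exists>U. openin local_topology U \<and> C \<in> U \<and> U \<subseteq> ?A" by blast
qed

text \<open>Each level set is a countable Boolean combination of the open sets above. The end of the
  line enters through complements, so measurability is claimed and not continuity.\<close>

lemma measurable_Phi_R_coordinate:
  "(\<lambda>C. Phi_R C n) \<in> measurable tree_borel (count_space UNIV)"
proof (rule measurableI)
  fix A :: "int set"
  define b N where "b = (n + 1 < 0)" and "N = nat \<bar>n + 1\<bar>"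
  let ?P = "\<lambda>j k C. reaches_degree b (SOME T. T \<in> C) j k"
  have P[measurable]: "Measurable.pred tree_borel (?P j k)" for j k
  proof -
    have "{C \<in> space tree_borel. ?P j k C} \<in> sets tree_borel"
      unfolding space_tree_borel sets_tree_borel using reaches_degree_open by blast
    then show ?thesis by simp
  qed
  have iff: "Phi_R C n = int k - 1 \<longleftrightarrow> (\<exists>j\<le>N. ?P j k C \<and> (j = N \<or> (\<forall>k'. \<not> ?P (Suc j) k' C)))"
    if "C \<in> space tree_borel" for C k
  proof -
    have "ordered_family_tree (SOME T. T \<in> C)"
      using that tree_classes_someI tree_classes_members unfolding space_tree_borel by blast
    then show ?thesis
      using family_tree.backward_sequence_iff[OF family_tree.intro]
      unfolding Phi_R_def b_def N_def by blast
  qed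
  have ex: "\<exists>k. Phi_R C n = int k - 1" for C
    unfolding Phi_R_def backward_sequence_def by blast
  have "(Phi_R C n \<in> A) = (\<exists>k. int k - 1 \<in> A \<and> Phi_R C n = int k - 1)" for C
    using ex[of C] by auto
  then have "(\<lambda>C. Phi_R C n) -` A \<inter> space tree_borel =
     {C \<in> space tree_borel. \<exists>k. int k - 1 \<in> A \<and> Phi_R C n = int k - 1}"
    by blast
  also have "\<dots> = {C \<in> space tree_borel. \<exists>k. int k - 1 \<in> A \<and>
      (\<exists>j\<le>N. ?P j k C \<and> (j = N \<or> (\<forall>k'. \<not> ?P (Suc j) k' C)))}"
    using iff by blast
  also have "\<dots> \<in> sets tree_borel"
    by measurable
  finally show "(\<lambda>C. Phi_R C n) -` A \<inter> space tree_borel \<in> sets tree_borel" .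
qed simp

section \<open>Kesten trees as elements of the space of tree classes\<close>

definition kesten_child :: "int \<times> nat list \<Rightarrow> nat \<Rightarrow> int \<times> nat list" where
  "kesten_child v i = (if snd v = [] \<and> i = 0 then (fst v - 1, []) else (fst v, snd v @ [i]))"

text \<open>The last clause guarantees that \<open>o_{n-1}\<close> is really among the children of
  \<open>o_n\<close>.\<close>

definition valid_offspring :: "(int \<times> nat list \<Rightarrow> nat list) \<Rightarrow> bool" where
  "valid_offspring \<omega> \<longleftrightarrow> (\<forall>v. distinct (\<omega> v) \<and> set (\<omega> v) = {..<length (\<omega> v)}) \<and> (\<forall>n. 0 \<in> set (\<omega> (n, [])))"

lemma kesten_parent_child [simp]: "kesten_parent (kesten_child v i) = v"
  by (cases v) (auto simp: kesten_child_def)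

lemma kesten_number_child [simp]: "kesten_number (kesten_child v i) = i"
  by (cases v) (auto simp: kesten_child_def)

lemma kesten_child_inject [simp]: "kesten_child v i = kesten_child w j \<longleftrightarrow> v = w \<and> i = j"
  by (metis kesten_parent_child kesten_number_child)

text \<open>A generation number, possibly negative: passing to the parent lowers it by one, also
  along the bi-infinite path. It serves to exclude cycles.\<close>

definition kesten_depth :: "int \<times> nat list \<Rightarrow> int" where
  "kesten_depth v = int (length (snd v)) - fst v"

lemma kesten_depth_parent: "kesten_depth (kesten_parent v) = kesten_depth v - 1"
  by (cases v) (auto simp: kesten_depth_def of_nat_diff Suc_le_eq)

lemma kesten_depth_funpow: "kesten_depth ((kesten_parent ^^ k) v) = kesten_depth v - int k"
  by (induction k) (auto simp: kesten_depth_parent)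

declare kesten_parent.simps [simp del] kesten_number.simps [simp del]

lemma valid_offspring_distinct: "valid_offspring \<omega> \<Longrightarrow> distinct (\<omega> v)"
  and valid_offspring_zero: "valid_offspring \<omega> \<Longrightarrow> 0 \<in> set (\<omega> (n, []))"
  unfolding valid_offspring_def by blast+

lemma kesten_verts_cases:
  assumes "valid_offspring \<omega>" "w \<in> kesten_verts \<omega>"
  obtains v i where "w = kesten_child v i" "v \<in> kesten_verts \<omega>" "i \<in> set (\<omega> v)"
proof -
  obtain m k where w: "w = (m, k)" by (cases w)
  with assms(2) have "(m, k) \<in> kesten_verts \<omega>" by simp
  then show ?thesis
  proof (cases rule: kesten_verts.cases)
    case path
    have "w = kesten_child (m + 1, []) 0" using path w by (simp add: kesten_child_def)
    then show ?thesis using that valid_offspring_zero[OF assms(1)] kesten_verts.path by blast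
  next
    case (child l i)
    then have "w = kesten_child (m, l) i" using w by (auto simp: kesten_child_def)
    then show ?thesis using that child by blast
  qed
qed

lemma kesten_verts_parent:
  assumes "valid_offspring \<omega>" "v \<in> kesten_verts \<omega>"
  shows "kesten_parent v \<in> kesten_verts \<omega> \<and> kesten_number v \<in> set (\<omega> (kesten_parent v))"
  using kesten_verts_cases[OF assms] by (metis kesten_parent_child kesten_number_child)

lemma kesten_child_verts_iff:
  assumes "valid_offspring \<omega>"
  shows "kesten_child v i \<in> kesten_verts \<omega> \<longleftrightarrow> v \<in> kesten_verts \<omega> \<and> i \<in> set (\<omega> v)"
proof
  assume "kesten_child v i \<in> kesten_verts \<omega>"
  from kesten_verts_parent[OF assms this] show "v \<in> kesten_verts \<omega> \<and> i \<in> set (\<omega> v)" by simp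
next
  assume "v \<in> kesten_verts \<omega> \<and> i \<in> set (\<omega> v)"
  then show "kesten_child v i \<in> kesten_verts \<omega>"
    by (cases v) (auto simp: kesten_child_def intro: kesten_verts.intros)
qed

lemma kesten_tree_simps [simp]:
  "verts (kesten_tree \<omega>) = kesten_verts \<omega>"
  "parent (kesten_tree \<omega>) v = Some (kesten_parent v)"
  "root (kesten_tree \<omega>) = (0, [])"
  by (simp_all add: kesten_tree_def)

lemma kesten_sibling_less:
  "sibling_less (kesten_tree \<omega>) u v \<longleftrightarrow> (\<exists>i j. i < j \<and> j < length (\<omega> (kesten_parent u)) \<and>
     \<omega> (kesten_parent u) ! i = kesten_number u \<and> \<omega> (kesten_parent u) ! j = kesten_number v)"
  by (simp add: kesten_tree_def)

lemma children_kesten_tree: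
  assumes "valid_offspring \<omega>" "v \<in> kesten_verts \<omega>"
  shows "children (kesten_tree \<omega>) v = kesten_child v ` set (\<omega> v)"
proof (intro equalityI subsetI)
  fix w assume "w \<in> children (kesten_tree \<omega>) v"
  then have w: "w \<in> kesten_verts \<omega>" "kesten_parent w = v" by (auto simp: children_def)
  obtain v' i where "w = kesten_child v' i" "i \<in> set (\<omega> v')"
    using kesten_verts_cases[OF assms(1) w(1)] by blast
  then show "w \<in> kesten_child v ` set (\<omega> v)" using w(2) by auto
next
  fix w assume "w \<in> kesten_child v ` set (\<omega> v)"
  then obtain i where "w = kesten_child v i" "i \<in> set (\<omega> v)" by blast
  then show "w \<in> children (kesten_tree \<omega>) v"
    using kesten_child_verts_iff[OF assms(1)] assms(2) by (simp add: children_def)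
qed

lemma card_children_kesten_tree:
  assumes "valid_offspring \<omega>" "v \<in> kesten_verts \<omega>"
  shows "card (children (kesten_tree \<omega>) v) = length (\<omega> v)"
proof -
  have "inj_on (kesten_child v) (set (\<omega> v))" by (auto simp: inj_on_def)
  then show ?thesis
    using children_kesten_tree[OF assms] distinct_card[OF valid_offspring_distinct[OF assms(1)], of v]
    by (simp add: card_image)
qed

lemma kesten_sibling_less_child:
  assumes "valid_offspring \<omega>" "i < length (\<omega> v)" "j < length (\<omega> v)"
  shows "sibling_less (kesten_tree \<omega>) (kesten_child v (\<omega> v ! i)) (kesten_child v (\<omega> v ! j)) \<longleftrightarrow> i < j"
  using assms(2,3) nth_eq_iff_index_eq[OF valid_offspring_distinct[OF assms(1), of v]]
  by (auto simp: kesten_sibling_less)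

lemma adjacent_kesten_tree:
  assumes "valid_offspring \<omega>" "v \<in> kesten_verts \<omega>"
  shows "adjacent (kesten_tree \<omega>) v w \<longleftrightarrow> w = kesten_parent v \<or> w \<in> kesten_child v ` set (\<omega> v)"
  unfolding children_kesten_tree[OF assms, symmetric]
  using kesten_verts_parent[OF assms] assms(2) by (auto simp: adjacent_def children_def)

lemma kesten_verts_connected:
  assumes \<omega>: "valid_offspring \<omega>" and u: "u \<in> kesten_verts \<omega>" and v: "v \<in> kesten_verts \<omega>"
  shows "(adjacent (kesten_tree \<omega>))\<^sup>*\<^sup>* u v"
proof -
  let ?A = "adjacent (kesten_tree \<omega>)"
  have sym: "?A\<^sup>*\<^sup>* x y \<Longrightarrow> ?A\<^sup>*\<^sup>* y x" for x y
  proof (induction rule: rtranclp_induct)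
    case (step y z)
    then show ?case using adjacent_sym converse_rtranclp_into_rtranclp by metis
  qed simp
  have stem: "?A\<^sup>*\<^sup>* (n, l) (n, [])" if "(n, l) \<in> kesten_verts \<omega>" for n l
    using that
  proof (induction l rule: rev_induct)
    case (snoc i l)
    have par: "kesten_parent (n, l @ [i]) = (n, l)" by (simp add: kesten_parent.simps)
    from kesten_verts_parent[OF \<omega> snoc.prems] have p: "(n, l) \<in> kesten_verts \<omega>" by (simp add: par)
    have "?A (n, l @ [i]) (n, l)" using adjacent_kesten_tree[OF \<omega> snoc.prems] by (simp add: par)
    then show ?case using snoc.IH[OF p] by simp
  qed simp
  have up: "?A\<^sup>*\<^sup>* (n, []) (n + int k, [])" for n k
  proof (induction k)
    case (Suc k)
    have "?A (n + int k, []) (n + int (Suc k), [])"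
      using adjacent_kesten_tree[OF \<omega> kesten_verts.path, of "n + int k"] by (simp add: kesten_parent.simps add.assoc)
    then show ?case using Suc by simp
  qed simp
  have path: "?A\<^sup>*\<^sup>* (m, []) (n, [])" for m n
  proof (cases "m \<le> n")
    case True
    then show ?thesis using up[of m "nat (n - m)"] by simp
  next
    case False
    then show ?thesis using sym[OF up[of n "nat (m - n)"]] by simp
  qed
  show ?thesis using stem path sym u v by (metis rtranclp_trans surj_pair)
qed

text \<open>At a vertex of maximal depth both neighbours on the cycle would have to be its parent,
  against distinctness.\<close>

lemma kesten_tree_acyclic:
  assumes \<omega>: "valid_offspring \<omega>"
    and len: "3 \<le> length vs" and dist: "distinct vs"
    and adj: "\<forall>i<length vs. adjacent (kesten_tree \<omega>) (vs ! i) (vs ! (Suc i mod length vs))"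
  shows False
proof -
  let ?m = "length vs"
  have fin: "finite ((\<lambda>i. kesten_depth (vs ! i)) ` {..<?m})" "(\<lambda>i. kesten_depth (vs ! i)) ` {..<?m} \<noteq> {}"
    using len by (auto simp: lessThan_empty_iff)
  from Max_in[OF fin] obtain i where i: "i < ?m"
    "kesten_depth (vs ! i) = Max ((\<lambda>i. kesten_depth (vs ! i)) ` {..<?m})" by auto
  then have mx: "kesten_depth (vs ! j) \<le> kesten_depth (vs ! i)" if "j < ?m" for j
    using that fin(1) by (auto intro: Max_ge)
  have par: "vs ! j = kesten_parent (vs ! i)"
    if "j < ?m" "adjacent (kesten_tree \<omega>) (vs ! i) (vs ! j)" for j
  proof -
    from that(2) have "kesten_parent (vs ! i) = vs ! j \<or> kesten_parent (vs ! j) = vs ! i"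
      by (simp add: adjacent_def)
    moreover have "kesten_parent (vs ! j) \<noteq> vs ! i"
      using mx[OF that(1)] kesten_depth_parent[of "vs ! j"] by auto
    ultimately show ?thesis by simp
  qed
  \<comment> \<open>Cyclic predecessor and successor of \<open>i\<close>; they differ because the
    cycle has length at least three.\<close>
  define p where "p = (if i = 0 then ?m - 1 else i - 1)"
  define n where "n = Suc i mod ?m"
  have pn: "p < ?m" "n < ?m" "Suc p mod ?m = i" "p \<noteq> n"
    using i len unfolding p_def n_def by (auto simp: mod_Suc)
  have "adjacent (kesten_tree \<omega>) (vs ! i) (vs ! n)" using adj i n_def by simp
  moreover have "adjacent (kesten_tree \<omega>) (vs ! i) (vs ! p)" using adj pn adjacent_sym by metis
  ultimately have "vs ! n = vs ! p" using par pn by metis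
  then show False using pn dist by (simp add: nth_eq_iff_index_eq)
qed

lemma ordered_family_tree_kesten_tree:
  assumes \<omega>: "valid_offspring \<omega>"
  shows "ordered_family_tree (kesten_tree \<omega>)"
  unfolding ordered_family_tree_def directed_tree_def
proof (intro conjI ballI allI impI notI)
  let ?T = "kesten_tree \<omega>"
  show "w \<in> verts ?T" if "v \<in> verts ?T" "parent ?T v = Some w" for v w
    using that kesten_verts_parent[OF \<omega>, of v] by auto
  show "(adjacent ?T)\<^sup>*\<^sup>* u v" if "u \<in> verts ?T" "v \<in> verts ?T" for u v
    using that kesten_verts_connected[OF \<omega>] by simp
  have ne: "kesten_parent v \<noteq> v" for v using kesten_depth_parent[of v] by auto
  show False if "parent ?T v = Some v" for v using that ne by simp
  show False if "parent ?T u = Some v \<and> parent ?T v = Some u" for u v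
    using that kesten_depth_parent[of v] kesten_depth_parent[of u] by auto
  show False if "\<exists>vs. 3 \<le> length vs \<and> distinct vs \<and>
          (\<forall>i<length vs. adjacent ?T (vs ! i) (vs ! (Suc i mod length vs)))"
    using that kesten_tree_acyclic[OF \<omega>] by blast
  show "finite {w. adjacent ?T v w}" if "v \<in> verts ?T" for v
  proof -
    have "{w. adjacent ?T v w} = insert (kesten_parent v) (kesten_child v ` set (\<omega> v))"
      using adjacent_kesten_tree[OF \<omega>] that by auto
    then show ?thesis by simp
  qed
  show "root ?T \<in> verts ?T" by (simp add: kesten_verts.path)
  have ch: "\<exists>i<length (\<omega> v). a = kesten_child v (\<omega> v ! i)" if "v \<in> verts ?T" "a \<in> children ?T v" for v a
    using that children_kesten_tree[OF \<omega>] by (auto simp: in_set_conv_nth)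
  show False if "v \<in> verts ?T" "a \<in> children ?T v" "sibling_less ?T a a" for v a
    using that ch kesten_sibling_less_child[OF \<omega>] by blast
  show "sibling_less ?T a c"
    if "v \<in> verts ?T" "a \<in> children ?T v" "b \<in> children ?T v" "c \<in> children ?T v"
      "sibling_less ?T a b" "sibling_less ?T b c" for v a b c
    using that ch[of v a] ch[of v b] ch[of v c] by (auto simp: kesten_sibling_less_child[OF \<omega>])
  show "sibling_less ?T a b \<or> sibling_less ?T b a"
    if "v \<in> verts ?T" "a \<in> children ?T v" "b \<in> children ?T v" "a \<noteq> b" for v a b
  proof -
    from ch[of v a] ch[of v b] that obtain i j where ij: "i < length (\<omega> v)" "j < length (\<omega> v)"
      "a = kesten_child v (\<omega> v ! i)" "b = kesten_child v (\<omega> v ! j)" by blast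
    moreover have "i \<noteq> j" using that(4) ij by auto
    ultimately show ?thesis using kesten_sibling_less_child[OF \<omega>] by auto
  qed
qed

section \<open>Isomorphic copies with vertices in \<open>nat\<close>\<close>

definition relabel :: "('v :: countable) rooted_tree \<Rightarrow> nat rooted_tree" where
  "relabel T = \<lparr>verts = to_nat ` verts T, parent = (\<lambda>x. map_option to_nat (parent T (from_nat x))),
     sibling_less = (\<lambda>x y. sibling_less T (from_nat x) (from_nat y)), root = to_nat (root T)\<rparr>"

lemma relabel_simps [simp]:
  "verts (relabel T) = to_nat ` verts T"
  "parent (relabel T) x = map_option to_nat (parent T (from_nat x))"
  "sibling_less (relabel T) x y = sibling_less T (from_nat x) (from_nat y)"
  "root (relabel T) = to_nat (root T)"
  by (simp_all add: relabel_def)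

lemma children_relabel: "children (relabel T) (to_nat v) = to_nat ` children T v"
  by (auto simp: children_def)

lemma adjacent_relabel: "adjacent (relabel T) (to_nat u) (to_nat v) \<longleftrightarrow> adjacent T u v"
  by (auto simp: adjacent_def)

lemma adjacent_relabelE:
  fixes T :: "('a :: countable) rooted_tree"
  assumes "adjacent (relabel T) x y" obtains u v where "x = to_nat u" "y = to_nat v" "adjacent T u v"
proof -
  from assms obtain u v :: 'a where "x = to_nat u" "y = to_nat v" by (auto simp: adjacent_def)
  then show ?thesis using that assms adjacent_relabel by blast
qed

lemma ordered_family_tree_relabel:
  fixes T :: "('v :: countable) rooted_tree"
  assumes T: "ordered_family_tree T"
  shows "ordered_family_tree (relabel T)"
proof -
  interpret family_tree T by (rule family_tree.intro) (rule T)
  have conn: "(adjacent (relabel T))\<^sup>*\<^sup>* (to_nat u) (to_nat v)" if "(adjacent T)\<^sup>*\<^sup>* u v" for u v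
    using that
  proof (induction rule: rtranclp_induct)
    case (step v w)
    then show ?case using adjacent_relabel rtranclp.rtrancl_into_rtrancl by metis
  qed simp
  have noself: "parent T v \<noteq> Some v" if "v \<in> V" for v
    using dt that unfolding directed_tree_def by blast
  have noopp: "\<not> (parent T u = Some v \<and> parent T v = Some u)" if "u \<in> V" "v \<in> V" for u v
    using dt that unfolding directed_tree_def by blast
  have nocyc: False if vs: "3 \<le> length vs" "distinct vs"
    "\<forall>i<length vs. adjacent (relabel T) (vs ! i) (vs ! (Suc i mod length vs))" for vs
  proof -
    define ws where "ws = map (from_nat :: nat \<Rightarrow> 'v) vs"
    have inV: "x \<in> to_nat ` V" if "x \<in> set vs" for x
    proof -
      obtain i where "i < length vs" "x = vs ! i"
        using \<open>x \<in> set vs\<close> by (auto simp: in_set_conv_nth)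
      then have "adjacent (relabel T) x (vs ! (Suc i mod length vs))" using vs(3) by simp
      then have "x \<in> verts (relabel T)" by (simp only: adjacent_def)
      then show ?thesis by simp
    qed
    \<comment> \<open>All vertices of the cycle are codes of vertices of \<open>T\<close>, and on
      codes \<open>from_nat\<close> is inverted by \<open>to_nat\<close>.\<close>
    have "inj_on (from_nat :: nat \<Rightarrow> 'v) (set vs)"
      by (rule inj_on_inverseI[of _ to_nat]) (use inV in force)
    then have "distinct ws" using vs(2) by (simp add: ws_def distinct_map)
    moreover have "adjacent T (ws ! i) (ws ! (Suc i mod length ws))" if "i < length ws" for i
    proof -
      have "0 < length vs" using vs(1) by linarith
      then have i: "i < length vs" "Suc i mod length vs < length vs"
        using that mod_less_divisor by (auto simp: ws_def)
      then obtain u v where "vs ! i = to_nat u" "vs ! (Suc i mod length vs) = to_nat v" "adjacent T u v"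
        using vs(3) adjacent_relabelE by metis
      then show ?thesis using i by (simp add: ws_def)
    qed
    moreover have "3 \<le> length ws" using vs(1) by (simp add: ws_def)
    ultimately show False using dt unfolding directed_tree_def by blast
  qed
  have fin: "finite {w. adjacent (relabel T) (to_nat v) w}" if "v \<in> V" for v
  proof -
    have "{w. adjacent (relabel T) (to_nat v) w} = to_nat ` {w. adjacent T v w}"
    proof (intro equalityI subsetI)
      fix w assume "w \<in> {w. adjacent (relabel T) (to_nat v) w}"
      then obtain x y where "to_nat v = to_nat x" "w = to_nat y" "adjacent T x y"
        using adjacent_relabelE by blast
      then show "w \<in> to_nat ` {w. adjacent T v w}" by simp
    qed (auto simp: adjacent_relabel)
    moreover have "finite {w. adjacent T v w}" using T that by (auto simp: ordered_family_tree_def)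
    ultimately show ?thesis by simp
  qed
  show ?thesis
    unfolding ordered_family_tree_def directed_tree_def
  proof (intro conjI ballI allI impI notI)
    show "w \<in> verts (relabel T)" if "v \<in> verts (relabel T)" "parent (relabel T) v = Some w" for v w
      using that parent_in by auto
    show "(adjacent (relabel T))\<^sup>*\<^sup>* u v" if uv: "u \<in> verts (relabel T)" "v \<in> verts (relabel T)" for u v
    proof -
      obtain x y where xy: "u = to_nat x" "x \<in> V" "v = to_nat y" "y \<in> V" using uv by auto
      then have "(adjacent T)\<^sup>*\<^sup>* x y" using dt unfolding directed_tree_def by blast
      then show ?thesis using conn xy by simp
    qed
    show False if "v \<in> verts (relabel T)" "parent (relabel T) v = Some v" for v
      using that noself by auto
    show False if "u \<in> verts (relabel T)" "v \<in> verts (relabel T)"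
      "parent (relabel T) u = Some v \<and> parent (relabel T) v = Some u" for u v
      using that noopp by auto
    show False if "\<exists>vs. 3 \<le> length vs \<and> distinct vs \<and>
          (\<forall>i<length vs. adjacent (relabel T) (vs ! i) (vs ! (Suc i mod length vs)))"
      using that nocyc by blast
    show "finite {w. adjacent (relabel T) v w}" if "v \<in> verts (relabel T)" for v
      using that fin by auto
    show "root (relabel T) \<in> verts (relabel T)" using root_in by simp
    show False if abc: "v \<in> verts (relabel T)" "a \<in> children (relabel T) v" "sibling_less (relabel T) a a" for v a
    proof -
      from abc obtain y x where "v = to_nat y" "y \<in> V" "a = to_nat x" "x \<in> children T y"
        by (auto simp: children_relabel)
      then show ?thesis using abc sless_irrefl[of y x] by simp
    qed
    show "sibling_less (relabel T) a c"
      if abc: "v \<in> verts (relabel T)" "a \<in> children (relabel T) v" "b \<in> children (relabel T) v"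
        "c \<in> children (relabel T) v" "sibling_less (relabel T) a b" "sibling_less (relabel T) b c" for v a b c
    proof -
      from abc obtain y x1 x2 x3 where y: "v = to_nat y" "y \<in> V" "a = to_nat x1" "x1 \<in> children T y"
        "b = to_nat x2" "x2 \<in> children T y" "c = to_nat x3" "x3 \<in> children T y"
        by (auto simp: children_relabel)
      then show ?thesis using abc sless_trans[of y x1 x2 x3] by simp
    qed
    show "sibling_less (relabel T) a b \<or> sibling_less (relabel T) b a"
      if abc: "v \<in> verts (relabel T)" "a \<in> children (relabel T) v" "b \<in> children (relabel T) v" "a \<noteq> b" for v a b
    proof -
      from abc obtain y x1 x2 where y: "v = to_nat y" "y \<in> V" "a = to_nat x1" "x1 \<in> children T y"
        "b = to_nat x2" "x2 \<in> children T y"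
        by (auto simp: children_relabel)
      then show ?thesis using abc sless_total[of y x1 x2] by auto
    qed
  qed
qed

lemma tree_isomorphic_relabel: "tree_isomorphic T (relabel T)"
  unfolding tree_isomorphic_def tree_iso_on_def
  by (intro exI[of _ to_nat]) (auto simp: bij_betw_def)

text \<open>\<open>tree_classes\<close> collects the classes of trees on \<open>nat\<close>, so
  membership is obtained through the encoded copy, which has the same class.\<close>

lemma tree_class_in_tree_classes:
  fixes T :: "('v :: countable) rooted_tree"
  assumes "ordered_family_tree T" shows "tree_class T \<in> tree_classes"
proof -
  have "tree_isomorphic T S \<longleftrightarrow> tree_isomorphic (relabel T) S" for S :: "nat rooted_tree"
    using tree_isomorphic_trans[OF tree_isomorphic_relabel, of T S]
      tree_isomorphic_trans[OF tree_isomorphic_sym[OF tree_isomorphic_relabel assms], of S] by blast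
  then have "tree_class T = tree_class (relabel T)"
    by (simp add: tree_class_def)
  then show ?thesis
    unfolding tree_classes_def using ordered_family_tree_relabel[OF assms] by blast
qed

lemma Phi_R_tree_class:
  fixes T :: "('v :: countable) rooted_tree"
  assumes T: "ordered_family_tree T"
  shows "Phi_R (tree_class T) = backward_sequence T"
proof -
  have "(SOME S. S \<in> tree_class T) \<in> tree_class T"
    using tree_classes_someI tree_class_in_tree_classes[OF T] by blast
  then show ?thesis
    using backward_sequence_iso[OF _ T] unfolding Phi_R_def tree_class_def mem_Collect_eq by metis
qed

section \<open>Measurability of the passage from offspring families to tree classes\<close>

lemma finite_root_ball:
  assumes "\<And>v. v \<in> verts T \<Longrightarrow> finite {w. adjacent T v w}" "root T \<in> verts T"
  shows "finite (root_ball T r)"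
proof -
  have "finite {v. (adjacent T ^^ k) (root T) v} \<and> {v. (adjacent T ^^ k) (root T) v} \<subseteq> verts T" for k
  proof (induction k)
    case (Suc k)
    have "{v. (adjacent T ^^ Suc k) (root T) v} =
        (\<Union>u\<in>{v. (adjacent T ^^ k) (root T) v}. {w. adjacent T u w})" by auto
    moreover have "{w. adjacent T u w} \<subseteq> verts T" for u by (auto simp: adjacent_def)
    ultimately show ?case using Suc assms(1) by auto
  qed (use assms in auto)
  then have "finite (\<Union>k\<in>{..r}. {v. (adjacent T ^^ k) (root T) v})" by blast
  then show ?thesis by (rule finite_subset[rotated]) (auto simp: root_ball_def)
qed

text \<open>The offspring lists at the vertices of the ball determine the edges and the sibling
  order inside it. Both trees use the same vertex names, so the identity is the isomorphism.\<close>

lemma kesten_tree_ball_cong: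
  assumes \<omega>: "valid_offspring \<omega>" and \<omega>': "valid_offspring \<omega>'"
    and eq: "\<And>v. v \<in> root_ball (kesten_tree \<omega>) r \<Longrightarrow> \<omega>' v = \<omega> v"
  shows "tree_iso_on (kesten_tree \<omega>) (root_ball (kesten_tree \<omega>) r)
    (kesten_tree \<omega>') (root_ball (kesten_tree \<omega>') r) id"
proof -
  let ?T = "kesten_tree \<omega>" and ?T' = "kesten_tree \<omega>'"
  have inV: "x \<in> verts S" if "(adjacent S ^^ k) (root S) x" "root S \<in> verts S"
    for x k and S :: "(int \<times> nat list) rooted_tree"
    using that by (cases k) (auto simp: adjacent_def)
  have rt: "root ?T \<in> verts ?T" "root ?T' \<in> verts ?T'" by (auto intro: kesten_verts.path)
  have path: "(adjacent ?T ^^ k) (0, []) x \<longleftrightarrow> (adjacent ?T' ^^ k) (0, []) x" if "k \<le> r" for k x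
    using that
  proof (induction k arbitrary: x)
    case (Suc k)
    have "adjacent ?T y x \<longleftrightarrow> adjacent ?T' y x" if y: "(adjacent ?T ^^ k) (0, []) y" for y
    proof -
      have y': "(adjacent ?T' ^^ k) (0, []) y" using Suc y by simp
      have V: "y \<in> kesten_verts \<omega>" "y \<in> kesten_verts \<omega>'"
        using inV[of k ?T y] inV[of k ?T' y] rt y y' by auto
      moreover have "y \<in> root_ball ?T r"
        using V y Suc.prems unfolding root_ball_def by (auto intro!: exI[of _ k])
      ultimately show ?thesis using eq adjacent_kesten_tree \<omega> \<omega>' by simp
    qed
    then show ?case using Suc by (auto simp: relcompp.simps)
  qed simp
  have ball: "root_ball ?T r = root_ball ?T' r"
  proof -
    have "x \<in> kesten_verts \<omega>" if "(adjacent ?T ^^ k) (0, []) x" for x k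
      using inV[of k ?T x] that rt by simp
    moreover have "x \<in> kesten_verts \<omega>'" if "(adjacent ?T' ^^ k) (0, []) x" for x k
      using inV[of k ?T' x] that rt by simp
    ultimately have "x \<in> kesten_verts \<omega> \<and> (\<exists>k\<le>r. (adjacent ?T ^^ k) (0, []) x) \<longleftrightarrow>
        x \<in> kesten_verts \<omega>' \<and> (\<exists>k\<le>r. (adjacent ?T' ^^ k) (0, []) x)" for x
      using path by metis
    then show ?thesis unfolding root_ball_def by simp
  qed
  have "sibling_less ?T u v \<longleftrightarrow> sibling_less ?T' u v"
    if "kesten_parent u \<in> root_ball ?T r" for u v
    using eq[OF that] by (simp add: kesten_sibling_less)
  then show ?thesis unfolding tree_iso_on_def ball[symmetric] by auto
qed

definition kesten_support :: "nat pmf \<Rightarrow> (int \<times> nat list \<Rightarrow> nat list) set" where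
  "kesten_support \<pi> = {\<omega>. \<forall>v. \<omega> v \<in> set_pmf (kesten_offspring \<pi> v)}"

text \<open>Openness in the product of discrete spaces, relative to the support: around each point
  finitely many coordinates decide membership.\<close>

definition finitely_determined :: "nat pmf \<Rightarrow> (int \<times> nat list \<Rightarrow> nat list) set \<Rightarrow> bool" where
  "finitely_determined \<pi> A \<longleftrightarrow> A \<subseteq> kesten_support \<pi> \<and>
     (\<forall>\<omega>\<in>A. \<exists>F. finite F \<and> (\<forall>\<omega>'\<in>kesten_support \<pi>. (\<forall>v\<in>F. \<omega>' v = \<omega> v) \<longrightarrow> \<omega>' \<in> A))"

lemma space_kesten_space: "space (kesten_space \<pi>) = kesten_support \<pi>"
  by (simp add: kesten_space_def kesten_support_def space_restrict_space space_PiM)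

lemma kesten_space_cylinder:
  assumes "finite F"
  shows "{\<omega> \<in> kesten_support \<pi>. \<forall>v\<in>F. \<omega> v = c v} \<in> sets (kesten_space \<pi>)"
proof -
  let ?M = "PiM UNIV (\<lambda>v. measure_pmf (kesten_offspring \<pi> v))"
  have "{\<omega> \<in> space ?M. \<forall>v\<in>F. \<omega> v = c v} \<in> sets ?M"
  proof -
    have "{\<omega> \<in> space ?M. \<omega> v = c v} \<in> sets ?M" for v
    proof -
      have "{\<omega> \<in> space ?M. \<omega> v = c v} = (\<lambda>\<omega>. \<omega> v) -` {c v} \<inter> space ?M" by auto
      also have "\<dots> \<in> sets ?M"
        by (rule measurable_sets[OF measurable_component_singleton]) simp_all
      finally show ?thesis .
    qed
    then show ?thesis using assms by (intro sets.sets_Collect_finite_All) auto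
  qed
  then have "kesten_support \<pi> \<inter> {\<omega> \<in> space ?M. \<forall>v\<in>F. \<omega> v = c v} \<in> sets (kesten_space \<pi>)"
    unfolding kesten_space_def kesten_support_def sets_restrict_space by blast
  moreover have "kesten_support \<pi> \<inter> {\<omega> \<in> space ?M. \<forall>v\<in>F. \<omega> v = c v} =
      {\<omega> \<in> kesten_support \<pi>. \<forall>v\<in>F. \<omega> v = c v}" by (auto simp: space_PiM)
  ultimately show ?thesis by simp
qed

text \<open>A cylinder is coded by a finite list of pairs of a vertex and an offspring list, so
  there are countably many cylinders. The set is the union of those that it contains; this is how
  arbitrary unions of open sets are brought into a sigma-algebra.\<close>

lemma finitely_determined_sets:
  assumes "finitely_determined \<pi> A"
  shows "A \<in> sets (kesten_space \<pi>)"
proof -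
  define cyl where "cyl l = {\<omega> \<in> kesten_support \<pi>. \<forall>p\<in>set l. \<omega> (fst p) = snd p}"
    for l :: "((int \<times> nat list) \<times> nat list) list"
  have "cyl l \<in> sets (kesten_space \<pi>)" for l
  proof (cases "\<exists>\<omega>. \<omega> \<in> cyl l")
    case True
    then obtain \<omega>0 where w0: "\<omega>0 \<in> cyl l" by blast
    have "cyl l = {\<omega> \<in> kesten_support \<pi>. \<forall>v\<in>fst ` set l. \<omega> v = \<omega>0 v}"
      using w0 unfolding cyl_def by auto
    then show ?thesis using kesten_space_cylinder[of "fst ` set l"] by simp
  next
    case False
    then have "cyl l = {}" by blast
    then show ?thesis by simp
  qed
  then have "(\<Union>l\<in>{l. cyl l \<subseteq> A}. cyl l) \<in> sets (kesten_space \<pi>)"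
    by (intro sets.countable_UN') auto
  moreover have "A = (\<Union>l\<in>{l. cyl l \<subseteq> A}. cyl l)"
  proof (intro equalityI subsetI)
    fix \<omega> assume w: "\<omega> \<in> A"
    with assms[unfolded finitely_determined_def, THEN conjunct2] have
      "\<exists>F. finite F \<and> (\<forall>\<omega>'\<in>kesten_support \<pi>. (\<forall>v\<in>F. \<omega>' v = \<omega> v) \<longrightarrow> \<omega>' \<in> A)"
      by (rule bspec)
    then obtain F where F: "finite F" "\<forall>\<omega>'\<in>kesten_support \<pi>. (\<forall>v\<in>F. \<omega>' v = \<omega> v) \<longrightarrow> \<omega>' \<in> A"
      by (elim exE conjE)
    obtain xs where xs: "set xs = F" using F finite_list by blast
    have "cyl (map (\<lambda>v. (v, \<omega> v)) xs) \<subseteq> A"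
    proof
      fix \<omega>' assume "\<omega>' \<in> cyl (map (\<lambda>v. (v, \<omega> v)) xs)"
      then have "\<omega>' \<in> kesten_support \<pi>" "\<forall>v\<in>F. \<omega>' v = \<omega> v" unfolding cyl_def xs[symmetric] by auto
      then show "\<omega>' \<in> A" using F(2) by simp
    qed
    moreover have "\<omega> \<in> cyl (map (\<lambda>v. (v, \<omega> v)) xs)"
    proof -
      have "\<omega> \<in> kesten_support \<pi>" using w assms unfolding finitely_determined_def by blast
      then show ?thesis by (simp add: cyl_def)
    qed
    ultimately show "\<omega> \<in> (\<Union>l\<in>{l. cyl l \<subseteq> A}. cyl l)" by blast
  qed auto
  ultimately show ?thesis by simp
qed

text \<open>The deciding coordinates are the finitely many vertices of the ball around the root:
  lists changed outside it leave the ball as it is, and composing isomorphisms of balls keeps the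
  class in the neighbourhood.\<close>

lemma finitely_determined_local_nbhd:
  assumes valid: "\<And>\<omega>. \<omega> \<in> kesten_support \<pi> \<Longrightarrow> valid_offspring \<omega>"
    and T: "ordered_family_tree T"
  shows "finitely_determined \<pi> {\<omega> \<in> kesten_support \<pi>. tree_class (kesten_tree \<omega>) \<in> local_nbhd T r}"
  unfolding finitely_determined_def
proof (intro conjI ballI)
  fix \<omega> assume w: "\<omega> \<in> {\<omega> \<in> kesten_support \<pi>. tree_class (kesten_tree \<omega>) \<in> local_nbhd T r}"
  let ?B = "\<lambda>\<omega>. root_ball (kesten_tree \<omega>) r"
  have v: "valid_offspring \<omega>" using w valid by blast
  note o = ordered_family_tree_kesten_tree[OF v]
  from w obtain T' :: "nat rooted_tree" and f where T': "ordered_family_tree T'" "tree_isomorphic (kesten_tree \<omega>) T'"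
    and f: "tree_iso_on T (root_ball T r) T' (root_ball T' r) f"
    by (auto simp: local_nbhd_def tree_class_def)
  from tree_isomorphic_sym[OF T'(2) o] obtain g where
    g: "tree_iso_on T' (verts T') (kesten_tree \<omega>) (verts (kesten_tree \<omega>)) g"
    unfolding tree_isomorphic_def by blast
  have g': "tree_iso_on T' (root_ball T' r) (kesten_tree \<omega>) (?B \<omega>) g"
    using tree_iso_on_verts_ball[OF g] family_tree.root_in[OF family_tree.intro, OF T'(1)] by blast
  have "finite (?B \<omega>)"
    using o by (intro finite_root_ball) (auto simp: ordered_family_tree_def)
  moreover have "tree_class (kesten_tree \<omega>') \<in> local_nbhd T r"
    if w': "\<omega>' \<in> kesten_support \<pi>" and eq: "\<forall>v\<in>?B \<omega>. \<omega>' v = \<omega> v" for \<omega>'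
  proof -
    have v': "valid_offspring \<omega>'" using w' valid by blast
    note o' = ordered_family_tree_kesten_tree[OF v']
    let ?T'' = "relabel (kesten_tree \<omega>')"
    from tree_isomorphic_relabel[of "kesten_tree \<omega>'"] obtain h where
      h: "tree_iso_on (kesten_tree \<omega>') (verts (kesten_tree \<omega>')) ?T'' (verts ?T'') h"
      unfolding tree_isomorphic_def by blast
    have h': "tree_iso_on (kesten_tree \<omega>') (?B \<omega>') ?T'' (root_ball ?T'' r) h"
      using tree_iso_on_verts_ball[OF h] family_tree.root_in[OF family_tree.intro, OF o'] by blast
    have "tree_iso_on T (root_ball T r) ?T'' (root_ball ?T'' r) (h \<circ> (id \<circ> (g \<circ> f)))"
      using tree_iso_on_trans[OF tree_iso_on_trans[OF tree_iso_on_trans[OF f g']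
          kesten_tree_ball_cong[OF v v']] h'] eq by blast
    moreover have "?T'' \<in> tree_class (kesten_tree \<omega>')"
      using ordered_family_tree_relabel[OF o'] tree_isomorphic_relabel by (auto simp: tree_class_def)
    ultimately show ?thesis
      using tree_class_in_tree_classes[OF o'] unfolding local_nbhd_def by blast
  qed
  ultimately show "\<exists>F. finite F \<and> (\<forall>\<omega>'\<in>kesten_support \<pi>. (\<forall>v\<in>F. \<omega>' v = \<omega> v) \<longrightarrow>
      \<omega>' \<in> {\<omega> \<in> kesten_support \<pi>. tree_class (kesten_tree \<omega>) \<in> local_nbhd T r})"
    by blast
qed auto

text \<open>Open sets arise from the basic ones by finite intersections and arbitrary unions. Finite
  determination is stable under both, whereas measurability is not stable under the latter; it is
  therefore drawn only at the end.\<close>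

lemma measurable_tree_class_kesten_tree:
  assumes valid: "\<And>\<omega>. \<omega> \<in> kesten_support \<pi> \<Longrightarrow> valid_offspring \<omega>"
  shows "(\<lambda>\<omega>. tree_class (kesten_tree \<omega>)) \<in> measurable (kesten_space \<pi>) tree_borel"
  unfolding tree_borel_def
proof (rule measurable_measure_of)
  let ?c = "\<lambda>\<omega>. tree_class (kesten_tree \<omega>)"
  show "{U. openin local_topology U} \<subseteq> Pow tree_classes"
    using openin_local_topology_subset by blast
  show "?c \<in> space (kesten_space \<pi>) \<rightarrow> tree_classes"
    using valid tree_class_in_tree_classes ordered_family_tree_kesten_tree
    by (auto simp: space_kesten_space)
  fix U assume "U \<in> {U. openin local_topology U}"
  then have "generate_topology_on {local_nbhd T r | T r. ordered_family_tree T} U"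
    by (simp add: local_topology_def openin_topology_generated_by_iff)
  then have "finitely_determined \<pi> {\<omega> \<in> kesten_support \<pi>. ?c \<omega> \<in> U}"
  proof (induction rule: generate_topology_on.induct)
    case Empty
    show ?case by (auto simp: finitely_determined_def)
  next
    case (Int A B)
    show ?case unfolding finitely_determined_def
    proof (intro conjI ballI)
      fix \<omega> assume w: "\<omega> \<in> {\<omega> \<in> kesten_support \<pi>. ?c \<omega> \<in> A \<inter> B}"
      then have "\<omega> \<in> {\<omega> \<in> kesten_support \<pi>. ?c \<omega> \<in> A}" "\<omega> \<in> {\<omega> \<in> kesten_support \<pi>. ?c \<omega> \<in> B}"
        by auto
      then have "\<exists>F. finite F \<and> (\<forall>\<omega>'\<in>kesten_support \<pi>. (\<forall>v\<in>F. \<omega>' v = \<omega> v) \<longrightarrow>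
          \<omega>' \<in> {\<omega> \<in> kesten_support \<pi>. ?c \<omega> \<in> A})"
        "\<exists>F. finite F \<and> (\<forall>\<omega>'\<in>kesten_support \<pi>. (\<forall>v\<in>F. \<omega>' v = \<omega> v) \<longrightarrow>
          \<omega>' \<in> {\<omega> \<in> kesten_support \<pi>. ?c \<omega> \<in> B})"
        using Int.IH[unfolded finitely_determined_def, THEN conjunct2] by simp_all
      then obtain F G where "finite F" "finite G"
        "\<forall>\<omega>'\<in>kesten_support \<pi>. (\<forall>v\<in>F. \<omega>' v = \<omega> v) \<longrightarrow> \<omega>' \<in> {\<omega> \<in> kesten_support \<pi>. ?c \<omega> \<in> A}"
        "\<forall>\<omega>'\<in>kesten_support \<pi>. (\<forall>v\<in>G. \<omega>' v = \<omega> v) \<longrightarrow> \<omega>' \<in> {\<omega> \<in> kesten_support \<pi>. ?c \<omega> \<in> B}"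
        by (elim exE conjE)
      then show "\<exists>F. finite F \<and> (\<forall>\<omega>'\<in>kesten_support \<pi>. (\<forall>v\<in>F. \<omega>' v = \<omega> v) \<longrightarrow>
          \<omega>' \<in> {\<omega> \<in> kesten_support \<pi>. ?c \<omega> \<in> A \<inter> B})"
        by (intro exI[of _ "F \<union> G"]) auto
    qed auto
  next
    case (UN K)
    show ?case unfolding finitely_determined_def
    proof (intro conjI ballI)
      fix \<omega> assume w: "\<omega> \<in> {\<omega> \<in> kesten_support \<pi>. ?c \<omega> \<in> \<Union>K}"
      then obtain A where A: "A \<in> K" "?c \<omega> \<in> A" by blast
      then have "\<omega> \<in> {\<omega> \<in> kesten_support \<pi>. ?c \<omega> \<in> A}" using w by auto
      with UN.IH[OF A(1), unfolded finitely_determined_def, THEN conjunct2]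
      have "\<exists>F. finite F \<and> (\<forall>\<omega>'\<in>kesten_support \<pi>. (\<forall>v\<in>F. \<omega>' v = \<omega> v) \<longrightarrow>
          \<omega>' \<in> {\<omega> \<in> kesten_support \<pi>. ?c \<omega> \<in> A})"
        by (rule bspec)
      then obtain F where F: "finite F" "\<forall>\<omega>'\<in>kesten_support \<pi>. (\<forall>v\<in>F. \<omega>' v = \<omega> v) \<longrightarrow>
          \<omega>' \<in> {\<omega> \<in> kesten_support \<pi>. ?c \<omega> \<in> A}"
        by (elim exE conjE)
      then show "\<exists>F. finite F \<and> (\<forall>\<omega>'\<in>kesten_support \<pi>. (\<forall>v\<in>F. \<omega>' v = \<omega> v) \<longrightarrow>
          \<omega>' \<in> {\<omega> \<in> kesten_support \<pi>. ?c \<omega> \<in> \<Union>K})"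
        using A(1) by (intro exI[of _ F]) auto
    qed auto
  next
    case (Basis s)
    then show ?case using finitely_determined_local_nbhd[OF valid] by blast
  qed
  from finitely_determined_sets[OF this]
  show "?c -` U \<inter> space (kesten_space \<pi>) \<in> sets (kesten_space \<pi>)"
    by (simp add: space_kesten_space vimage_def Int_def conj_commute)
qed

section \<open>Exploration of a Kesten tree\<close>

text \<open>The tree is visited against the RLS order, with a stack of pending vertices: the top
  vertex is visited and replaced by its children, the largest one on top. The second argument
  prescribes the offspring lists read along the way.\<close>

fun expand :: "(int \<times> nat list) list \<Rightarrow> nat list list \<Rightarrow> (int \<times> nat list) list" where
  "expand st [] = st"
| "expand [] (c # cs) = []"
| "expand (v # st) (c # cs) = expand (rev (map (kesten_child v) c) @ st) cs"

fun visited :: "(int \<times> nat list) list \<Rightarrow> nat list list \<Rightarrow> (int \<times> nat list) list" where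
  "visited st [] = []"
| "visited [] (c # cs) = []"
| "visited (v # st) (c # cs) = v # visited (rev (map (kesten_child v) c) @ st) cs"

fun follows :: "(int \<times> nat list \<Rightarrow> nat list) \<Rightarrow> (int \<times> nat list) list \<Rightarrow> nat list list \<Rightarrow> bool" where
  "follows \<omega> st [] = True"
| "follows \<omega> [] (c # cs) = False"
| "follows \<omega> (v # st) (c # cs) \<longleftrightarrow> \<omega> v = c \<and> follows \<omega> (rev (map (kesten_child v) c) @ st) cs"

lemma expand_append: "expand st (cs @ cs') = expand (expand st cs) cs'"
proof (induction st cs rule: expand.induct)
  case (2 c cs) then show ?case by (cases cs') auto
qed auto

lemma visited_append: "visited st (cs @ cs') = visited st cs @ visited (expand st cs) cs'"
proof (induction st cs rule: expand.induct)
  case (2 c cs) then show ?case by (cases cs') auto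
qed auto

lemma follows_append: "follows \<omega> st (cs @ cs') \<longleftrightarrow> follows \<omega> st cs \<and> follows \<omega> (expand st cs) cs'"
  by (induction st cs rule: expand.induct) auto

lemma length_visited: "follows \<omega> st cs \<Longrightarrow> length (visited st cs) = length cs"
  by (induction st cs rule: expand.induct) auto

text \<open>The visited vertices are computed from the prescribed lists alone and not from
  \<open>\<omega>\<close>, so an exploration event is a cylinder.\<close>

lemma follows_iff:
  "follows \<omega> st cs \<longleftrightarrow> length (visited st cs) = length cs \<and>
     (\<forall>i<length cs. \<omega> (visited st cs ! i) = cs ! i)"
  by (induction st cs rule: expand.induct) (auto simp: less_Suc_eq_0_disj)

text \<open>The lists read are dictated by \<open>\<omega>\<close>, so two successful prescriptions
  agree as far as the shorter one goes.\<close>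

lemma follows_prefix:
  assumes "follows \<omega> st cs" "follows \<omega> st cs'" "length cs \<le> length cs'"
  shows "\<exists>cs2. cs' = cs @ cs2"
  using assms
proof (induction st cs arbitrary: cs' rule: expand.induct)
  case (3 v st c cs)
  then show ?case by (cases cs') auto
qed auto

subsection \<open>Visited vertices are distinct\<close>

text \<open>The second argument lies in the subtree of the first, within the infinite tree of all
  potential vertices.\<close>

definition below :: "int \<times> nat list \<Rightarrow> int \<times> nat list \<Rightarrow> bool" where
  "below v w \<longleftrightarrow> (\<exists>k. (kesten_parent ^^ k) w = v)"

definition separated :: "int \<times> nat list \<Rightarrow> int \<times> nat list \<Rightarrow> bool" where
  "separated u v \<longleftrightarrow> (\<nexists>w. below u w \<and> below v w)"

lemma below_refl: "below v v"
  unfolding below_def by (rule exI[of _ 0]) simp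

lemma separated_irrefl: "\<not> separated v v"
  using below_refl[of v] unfolding separated_def by blast

lemma below_child: "below (kesten_child v i) w \<Longrightarrow> below v w"
  unfolding below_def
proof (elim exE)
  fix k assume "(kesten_parent ^^ k) w = kesten_child v i"
  then have "(kesten_parent ^^ Suc k) w = v" by simp
  then show "\<exists>k. (kesten_parent ^^ k) w = v" by blast
qed

lemma not_below_child: "\<not> below (kesten_child v i) v"
proof
  assume "below (kesten_child v i) v"
  then obtain k where k: "(kesten_parent ^^ k) v = kesten_child v i" by (auto simp: below_def)
  then have "(kesten_parent ^^ Suc k) v = v" by simp
  then show False using kesten_depth_funpow[of "Suc k" v] by simp
qed

lemma separated_children:
  assumes "i \<noteq> j" shows "separated (kesten_child v i) (kesten_child v j)"
  unfolding separated_def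
proof (intro notI, elim exE conjE)
  fix w assume "below (kesten_child v i) w" "below (kesten_child v j) w"
  then obtain a b where ab: "(kesten_parent ^^ a) w = kesten_child v i" "(kesten_parent ^^ b) w = kesten_child v j"
    by (auto simp: below_def)
  have dep: "kesten_depth (kesten_child v i) = kesten_depth (kesten_child v j)"
    using kesten_depth_parent[of "kesten_child v i"] kesten_depth_parent[of "kesten_child v j"] by simp
  have "a = b" using kesten_depth_funpow[of a w] kesten_depth_funpow[of b w] ab dep by simp
  then show False using ab assms by auto
qed

text \<open>Different stack entries have disjoint subtrees, and this survives replacing the top by
  its children. Distinctness turns the probability of an exploration into a product, and later shows
  that a path vertex is not met twice.\<close>

lemma visited_expand_distinct:
  assumes "sorted_wrt separated st" "\<forall>c\<in>set cs. distinct c"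
  shows "distinct (visited st cs @ expand st cs) \<and> (\<forall>w\<in>set (visited st cs @ expand st cs). \<exists>u\<in>set st. below u w)"
  using assms
proof (induction st cs rule: expand.induct)
  case (1 st)
  have "distinct st"
    using 1(1)
  proof (induction st)
    case (Cons a st)
    then show ?case using separated_irrefl[of a] by auto
  qed simp
  then show ?case using below_refl by auto
next
  case (3 v st c cs)
  let ?st = "rev (map (kesten_child v) c) @ st"
  have "distinct c" using 3 by simp
  then have "sorted_wrt separated (map (kesten_child v) (rev c))"
    using nth_eq_iff_index_eq[of "rev c"]
    by (auto simp: sorted_wrt_iff_nth_less intro!: separated_children)
  moreover have "\<forall>x\<in>set (map (kesten_child v) (rev c)). \<forall>y\<in>set st. separated x y"
    using 3(2) below_child unfolding sorted_wrt.simps separated_def set_map by blast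
  ultimately have "sorted_wrt separated ?st"
    using 3(2) by (simp add: sorted_wrt_append rev_map)
  from 3(1)[OF this] 3(3) have IH: "distinct (visited ?st cs @ expand ?st cs)"
    "\<forall>w\<in>set (visited ?st cs @ expand ?st cs). \<exists>u\<in>set ?st. below u w" by auto
  have "\<not> (\<exists>u\<in>set ?st. below u v)"
  proof
    assume "\<exists>u\<in>set ?st. below u v"
    then obtain u where u: "u \<in> set ?st" "below u v" by blast
    have "\<not> below x v" if "x \<in> set st" for x
      using 3(2) that below_refl[of v] unfolding sorted_wrt.simps separated_def by blast
    moreover have "u \<in> set st \<or> (\<exists>i. u = kesten_child v i)" using u(1) by auto
    ultimately show False using u(2) not_below_child by blast
  qed
  then have "v \<notin> set (visited ?st cs @ expand ?st cs)" using IH(2) by blast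
  moreover have "\<forall>w\<in>set (visited ?st cs @ expand ?st cs). \<exists>u\<in>set (v # st). below u w"
    using IH(2) below_child by fastforce
  ultimately show ?case using IH(1) below_refl by auto
qed auto

subsection \<open>The exploration follows the succession line\<close>

text \<open>Each entry is the one to be visited after the whole subtree of the entry above it:
  \<open>chain_smaller\<close> says that it would be the predecessor of that entry if the latter
  were a leaf.\<close>

definition pending :: "(int \<times> nat list \<Rightarrow> nat list) \<Rightarrow> (int \<times> nat list) list \<Rightarrow> bool" where
  "pending \<omega> st \<longleftrightarrow> set st \<subseteq> kesten_verts \<omega> \<and> successively (chain_smaller (kesten_tree \<omega>)) st"

text \<open>Between consecutive new children the chain is trivial; the least child prolongs the
  chain of \<open>v\<close> by one step and so inherits the link to the rest of the stack. The new
  top is the greatest child, or the next entry if \<open>v\<close> is a leaf: these are the two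
  cases of \<open>covers\<close>.\<close>

lemma pending_step:
  assumes \<omega>: "valid_offspring \<omega>" and p: "pending \<omega> (v # st)"
  defines "st' \<equiv> rev (map (kesten_child v) (\<omega> v)) @ st"
  shows "pending \<omega> st'" and "st' \<noteq> [] \<Longrightarrow> covers (kesten_tree \<omega>) (hd st') v"
proof -
  let ?T = "kesten_tree \<omega>" and ?c = "\<omega> v"
  have v: "v \<in> kesten_verts \<omega>" and st: "set st \<subseteq> kesten_verts \<omega>"
    and succ: "successively (chain_smaller ?T) st" and vst: "st \<noteq> [] \<Longrightarrow> chain_smaller ?T v (hd st)"
    using p by (auto simp: pending_def successively_Cons)
  note ch = children_kesten_tree[OF \<omega> v]
  have chE: "\<exists>k<length ?c. w = kesten_child v (?c ! k)" if "w \<in> children ?T v" for w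
    using that ch by (auto simp: in_set_conv_nth)
  have chI: "kesten_child v (?c ! k) \<in> children ?T v" if "k < length ?c" for k
    using that ch by auto
  note less = kesten_sibling_less_child[OF \<omega>, of _ v]
  have kids: "chain_smaller ?T (kesten_child v (?c ! Suc i)) (kesten_child v (?c ! i))" if "Suc i < length ?c" for i
  proof -
    have "next_smaller ?T (kesten_child v (?c ! Suc i)) (kesten_child v (?c ! i))"
      unfolding next_smaller_def
    proof (rule bexI[of _ v], intro conjI ballI impI)
      fix w assume "w \<in> children ?T v" "sibling_less ?T w (kesten_child v (?c ! Suc i))"
      then obtain k where kw: "k < length ?c" "w = kesten_child v (?c ! k)"
        "sibling_less ?T w (kesten_child v (?c ! Suc i))"
        using chE by blast
      then have k: "k < length ?c" "w = kesten_child v (?c ! k)" "k < Suc i"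
        using less[of k "Suc i"] that by auto
      then show "w = kesten_child v (?c ! i) \<or> sibling_less ?T w (kesten_child v (?c ! i))"
        using less[of k i] that by (cases "k = i") auto
    next
      show "kesten_child v (?c ! Suc i) \<in> children ?T v" "kesten_child v (?c ! i) \<in> children ?T v"
        using chI[of "Suc i"] chI[of i] that by simp_all
      show "sibling_less ?T (kesten_child v (?c ! i)) (kesten_child v (?c ! Suc i))"
        using less[of i "Suc i"] that by simp
      show "v \<in> verts ?T" using v by simp
    qed
    with least_chain.least_chain_refl show ?thesis unfolding chain_smaller_def by (intro exI conjI)
  qed
  have "successively (\<lambda>x y. chain_smaller ?T y x) (map (kesten_child v) ?c)"
    unfolding successively_conv_nth using kids by simp
  then have s1: "successively (chain_smaller ?T) (rev (map (kesten_child v) ?c))"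
    unfolding successively_rev .
  have s2: "chain_smaller ?T (kesten_child v (?c ! 0)) (hd st)" if "?c \<noteq> []" "st \<noteq> []"
  proof -
    obtain s where s: "least_chain ?T s v" "next_smaller ?T s (hd st)"
      using vst[OF \<open>st \<noteq> []\<close>] unfolding chain_smaller_def by blast
    have "least_chain ?T s (kesten_child v (?c ! 0))"
    proof (rule least_chain_step[OF s(1)])
      show "kesten_child v (?c ! 0) \<in> children ?T v" using chI that by simp
      fix w assume "w \<in> children ?T v"
      then obtain k where k: "k < length ?c" "w = kesten_child v (?c ! k)" using chE by blast
      then show "w = kesten_child v (?c ! 0) \<or> sibling_less ?T (kesten_child v (?c ! 0)) w"
        using less[of 0 k] \<open>?c \<noteq> []\<close> by (cases "k = 0") auto
    qed
    then show ?thesis using s(2) unfolding chain_smaller_def by blast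
  qed
  have last_kids: "last (rev (map (kesten_child v) ?c)) = kesten_child v (?c ! 0)" if "?c \<noteq> []"
    using that by (simp add: last_rev hd_map hd_conv_nth)
  have "?c = [] \<or> st = [] \<or> chain_smaller ?T (last (rev (map (kesten_child v) ?c))) (hd st)"
    using s2 last_kids by metis
  then have "successively (chain_smaller ?T) st'"
    unfolding st'_def successively_append_iff using s1 succ by simp
  moreover have "set st' \<subseteq> kesten_verts \<omega>"
  proof -
    have "kesten_child v ` set ?c \<subseteq> kesten_verts \<omega>"
      using v kesten_child_verts_iff[OF \<omega>] by blast
    then show ?thesis using st by (simp add: st'_def)
  qed
  ultimately show "pending \<omega> st'" by (simp add: pending_def)
  assume ne: "st' \<noteq> []"
  show "covers ?T (hd st') v"
  proof (cases "?c = []")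
    case True
    then show ?thesis using ne vst ch by (auto simp: st'_def covers_def)
  next
    case False
    let ?m = "length ?c - 1"
    have hd: "hd st' = kesten_child v (?c ! ?m)"
      using False by (simp add: st'_def hd_append hd_rev last_map last_conv_nth)
    have m: "?m < length ?c" using False by simp
    have "w = hd st' \<or> sibling_less ?T w (hd st')" if w: "w \<in> children ?T v" for w
    proof -
      obtain k where k: "k < length ?c" "w = kesten_child v (?c ! k)" using chE[OF w] by blast
      then show ?thesis using less[of k ?m] m hd by (cases "k = ?m") auto
    qed
    then show ?thesis using chI[OF m] hd unfolding covers_def by metis
  qed
qed

text \<open>The top of the remaining stack is included, a vertex reached but not yet visited; the
  root is this vertex when the exploration ends at \<open>o_0\<close>.\<close>

definition itinerary :: "(int \<times> nat list) list \<Rightarrow> nat list list \<Rightarrow> (int \<times> nat list) list" where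
  "itinerary st cs = visited st cs @ take 1 (expand st cs)"

lemma hd_itinerary: "itinerary st cs \<noteq> [] \<Longrightarrow> st \<noteq> [] \<and> hd (itinerary st cs) = hd st"
  unfolding itinerary_def by (cases cs; cases st) auto

lemma successively_itinerary:
  assumes \<omega>: "valid_offspring \<omega>" and "pending \<omega> st" "follows \<omega> st cs"
  shows "successively (\<lambda>u v. covers (kesten_tree \<omega>) v u) (itinerary st cs) \<and> set (itinerary st cs) \<subseteq> kesten_verts \<omega>"
  using assms(2,3)
proof (induction st cs rule: expand.induct)
  case (1 st)
  then show ?case by (cases st) (auto simp: itinerary_def pending_def)
next
  case (3 v st c cs)
  let ?st = "rev (map (kesten_child v) c) @ st"
  have c: "\<omega> v = c" using 3 by simp
  note step = pending_step[OF \<omega> 3(2), unfolded c]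
  have tr: "itinerary (v # st) (c # cs) = v # itinerary ?st cs" by (simp add: itinerary_def)
  have v: "v \<in> kesten_verts \<omega>" using 3(2) by (simp add: pending_def)
  have IH: "successively (\<lambda>u v. covers (kesten_tree \<omega>) v u) (itinerary ?st cs) \<and> set (itinerary ?st cs) \<subseteq> kesten_verts \<omega>"
    using 3(1)[OF step(1)] 3(3) by simp
  have "covers (kesten_tree \<omega>) (hd (itinerary ?st cs)) v" if "itinerary ?st cs \<noteq> []"
    using hd_itinerary[OF that] step(2) by simp
  then show ?case unfolding tr successively_Cons using IH v by auto
qed simp

text \<open>Consecutive entries are related by \<open>covers\<close>, so the itinerary runs along
  the succession line in decreasing direction: places after \<open>K\<close> are iterated
  predecessors of the root, places before \<open>K\<close> iterated successors.\<close>

lemma succession_line_itinerary: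
  assumes \<omega>: "valid_offspring \<omega>" and p: "pending \<omega> st" and f: "follows \<omega> st cs"
    and K: "K < length (itinerary st cs)" "itinerary st cs ! K = (0, [])" and k: "k < length (itinerary st cs)"
  shows "succession_line (kesten_tree \<omega>) (int K - int k) = itinerary st cs ! k"
proof -
  let ?T = "kesten_tree \<omega>" and ?t = "itinerary st cs"
  interpret family_tree ?T
    by (rule family_tree.intro) (rule ordered_family_tree_kesten_tree[OF \<omega>])
  have cov: "covers ?T (?t ! Suc i) (?t ! i)" if "Suc i < length ?t" for i
    using successively_itinerary[OF \<omega> p f] that unfolding successively_conv_nth by blast
  have inV: "?t ! i \<in> kesten_verts \<omega>" if "i < length ?t" for i
    using successively_itinerary[OF \<omega> p f] that nth_mem by blast
  have fwd: "(line_next False ^^ j) (root ?T) = ?t ! (K - j)" if "j \<le> K" for j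
    using that
  proof (induction j)
    case (Suc j)
    have "line_step False ?T (?t ! (K - j)) (?t ! (K - Suc j))"
      using cov[of "K - Suc j"] inV[of "K - Suc j"] Suc.prems K(1)
      by (simp add: line_step_def Suc_diff_Suc)
    then show ?case using Suc line_next_step[of "?t ! (K - j)"] inV[of "K - j"] K by simp
  qed (use K in simp)
  have bwd: "(line_next True ^^ j) (root ?T) = ?t ! (K + j)" if "K + j < length ?t" for j
    using that
  proof (induction j)
    case (Suc j)
    have "line_step True ?T (?t ! (K + j)) (?t ! (K + Suc j))"
      using cov[of "K + j"] inV[of "K + Suc j"] Suc.prems by (simp add: line_step_def)
    then show ?case using Suc line_next_step[of "?t ! (K + j)"] inV[of "K + j"] by simp
  qed (use K in simp)
  show ?thesis
  proof (cases "k \<le> K")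
    case True
    then show ?thesis using fwd[of "K - k"] by (simp add: succession_line_eq of_nat_diff nat_diff_distrib)
  next
    case False
    then have "K + (k - K) = k" "nat \<bar>int K - int k\<bar> = k - K" "int K - int k < 0" by auto
    then show ?thesis using bwd[of "k - K"] k by (simp add: succession_line_eq)
  qed
qed

text \<open>The mark \<open>x_n\<close> is the degree of \<open>u_{n+1}\<close> minus one, so the
  vertex at place \<open>k\<close>, which is \<open>u_{K-k}\<close>, is read at index
  \<open>K - 1 - k\<close>.\<close>

lemma backward_sequence_exploration:
  assumes \<omega>: "valid_offspring \<omega>" and p: "pending \<omega> st" and f: "follows \<omega> st cs"
    and K: "K < length (itinerary st cs)" "itinerary st cs ! K = (0, [])" and k: "k < length cs"
  shows "backward_sequence (kesten_tree \<omega>) (int K - 1 - int k) = int (length (cs ! k)) - 1"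
proof -
  have len: "length (visited st cs) = length cs" using length_visited[OF f] .
  have k': "k < length (itinerary st cs)" "itinerary st cs ! k = visited st cs ! k"
    using len k by (auto simp: itinerary_def nth_append)
  have "visited st cs ! k \<in> kesten_verts \<omega>"
    using successively_itinerary[OF \<omega> p f] nth_mem[OF k'(1)] k'(2) by auto
  moreover have "\<omega> (visited st cs ! k) = cs ! k" using f k by (simp add: follows_iff)
  ultimately show ?thesis
    using succession_line_itinerary[OF \<omega> p f K k'(1)] k'(2) card_children_kesten_tree[OF \<omega>]
    by (simp add: backward_sequence_def algebra_simps)
qed

subsection \<open>The position of the bi-infinite path in the stack\<close>

definition spine_at :: "(int \<times> nat list) list \<Rightarrow> nat \<Rightarrow> int \<Rightarrow> bool" where
  "spine_at st p n \<longleftrightarrow> p < length st \<and> st ! p = (n, []) \<and> (\<forall>i<length st. i \<noteq> p \<longrightarrow> snd (st ! i) \<noteq> [])"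

text \<open>If the stack has the path vertex \<open>o_n\<close> at position \<open>p\<close> after the visit of a vertex with \<open>d\<close>
  children, then \<open>spine_back d (p, n)\<close> is the position and index before that visit. Read forward in
  time, the first component is the running maximum of the walk minus its current value, and the
  second one counts the records.\<close>

definition spine_back :: "nat \<Rightarrow> nat \<times> int \<Rightarrow> nat \<times> int" where
  "spine_back d s = (if fst s < d then (0, snd s + 1) else (fst s + 1 - d, snd s))"

lemma spine_at_step_path:
  assumes sp: "spine_at (v # st) 0 n" and q: "q < length c" "rev c ! q = 0" "distinct c"
  shows "spine_at (rev (map (kesten_child v) c) @ st) q (n - 1)"
  unfolding spine_at_def
proof (intro conjI allI impI)
  have v: "v = (n, [])" using sp by (simp add: spine_at_def)
  have st: "snd (st ! i) \<noteq> []" if "i < length st" for i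
    using sp that unfolding spine_at_def by (metis Suc_less_eq length_Cons nat.distinct(1) nth_Cons_Suc)
  show "q < length (rev (map (kesten_child v) c) @ st)" using q by simp
  show "(rev (map (kesten_child v) c) @ st) ! q = (n - 1, [])"
    using q v by (simp add: nth_append rev_map kesten_child_def)
  fix i assume i: "i < length (rev (map (kesten_child v) c) @ st)" "i \<noteq> q"
  show "snd ((rev (map (kesten_child v) c) @ st) ! i) \<noteq> []"
  proof (cases "i < length c")
    case True
    have "distinct (rev c)" using q by simp
    then have "rev c ! i \<noteq> 0" using q i True nth_eq_iff_index_eq[of "rev c" i q] by simp
    then show ?thesis using True v by (simp add: nth_append rev_map kesten_child_def)
  next
    case False
    then show ?thesis using i st by (simp add: nth_append)
  qed
qed

lemma spine_at_step_other:
  assumes sp: "spine_at (v # st) (Suc p) n"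
  shows "spine_at (rev (map (kesten_child v) c) @ st) (p + length c) n"
  unfolding spine_at_def
proof (intro conjI allI impI)
  have v: "snd v \<noteq> []" using sp unfolding spine_at_def by force
  have p: "p < length st" "st ! p = (n, [])" using sp by (auto simp: spine_at_def)
  have st: "snd (st ! i) \<noteq> []" if "i < length st" "i \<noteq> p" for i
    using sp that unfolding spine_at_def by (metis Suc_less_eq length_Cons nat.inject nth_Cons_Suc)
  show "p + length c < length (rev (map (kesten_child v) c) @ st)" using p by simp
  show "(rev (map (kesten_child v) c) @ st) ! (p + length c) = (n, [])" using p by (simp add: nth_append)
  fix i assume i: "i < length (rev (map (kesten_child v) c) @ st)" "i \<noteq> p + length c"
  show "snd ((rev (map (kesten_child v) c) @ st) ! i) \<noteq> []"
  proof (cases "i < length c")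
    case True
    then show ?thesis using v by (simp add: nth_append rev_map kesten_child_def)
  next
    case False
    then show ?thesis using i st by (simp add: nth_append)
  qed
qed

text \<open>Forward, the place of the path below a path vertex depends on the arrangement of the
  children; backward, their number suffices. Hence the final state is only asserted to exist, while
  the initial one is a fold over the degrees from it.\<close>

lemma spine_at_expand:
  assumes \<omega>: "valid_offspring \<omega>" and "follows \<omega> st cs" "spine_at st p n"
  shows "\<exists>p' n'. spine_at (expand st cs) p' n' \<and> (p, n) = foldr spine_back (map length cs) (p', n')"
  using assms(2,3)
proof (induction st cs arbitrary: p n rule: expand.induct)
  case (3 v st c cs)
  let ?st = "rev (map (kesten_child v) c) @ st"
  have c: "\<omega> v = c" and f: "follows \<omega> ?st cs" using 3 by auto
  have d: "distinct c" using valid_offspring_distinct[OF \<omega>, of v] c by simp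
  show ?case
  proof (cases p)
    case 0
    then have v: "v = (n, [])" using 3(3) by (simp add: spine_at_def)
    then have "0 \<in> set (rev c)" using valid_offspring_zero[OF \<omega>, of n] c by simp
    then obtain q where q: "q < length c" "rev c ! q = 0" unfolding in_set_conv_nth by auto
    from 3(1)[OF f spine_at_step_path[OF 3(3)[unfolded 0] q d]] obtain p' n' where
      s: "spine_at (expand ?st cs) p' n'" "(q, n - 1) = foldr spine_back (map length cs) (p', n')" by blast
    have "(p, n) = foldr spine_back (map length (c # cs)) (p', n')"
      using q 0 by (simp add: spine_back_def flip: s(2))
    then show ?thesis using s(1) by auto
  next
    case (Suc p0)
    from 3(1)[OF f spine_at_step_other[OF 3(3)[unfolded Suc]]] obtain p' n' where
      s: "spine_at (expand ?st cs) p' n'" "(p0 + length c, n) = foldr spine_back (map length cs) (p', n')" by blast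
    have "(p, n) = foldr spine_back (map length (c # cs)) (p', n')"
      using Suc by (simp add: spine_back_def flip: s(2))
    then show ?thesis using s(1) by auto
  qed
qed (auto simp: spine_at_def)

lemma spine_at_unique:
  assumes "spine_at st p n" "i < length st" "st ! i = (m, [])"
  shows "i = p" "m = n"
  using assms unfolding spine_at_def by (metis prod.inject snd_conv)+

section \<open>The law of the exploration\<close>

locale critical_offspring =
  fixes \<pi> :: "nat pmf"
  assumes mean: "(\<integral>\<^sup>+k. ennreal (real k) \<partial>measure_pmf \<pi>) = 1"
begin

text \<open>Mean one says precisely that these masses add up to one, as \<open>embed_pmf\<close>
  requires.\<close>

lemma pmf_size_biased: "pmf (size_biased \<pi>) k = real k * pmf \<pi> k"
  unfolding size_biased_def
proof (rule pmf_embed_pmf)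
  have "(\<integral>\<^sup>+k. ennreal (real k * pmf \<pi> k) \<partial>count_space UNIV) = 1"
    using mean by (simp add: nn_integral_measure_pmf ennreal_mult mult.commute)
  then show "(\<integral>\<^sup>+k. ennreal (real k * pmf \<pi> k) \<partial>count_space UNIV) = 1" .
qed simp

lemma set_ordered_offspring:
  "c \<in> set_pmf (ordered_offspring \<mu>) \<longleftrightarrow> length c \<in> set_pmf \<mu> \<and> c \<in> permutations_of_set {..<length c}"
proof -
  have "set_pmf (pmf_of_set (permutations_of_set {..<k})) = permutations_of_set {..<k::nat}" for k
    by (rule set_pmf_of_set) auto
  moreover have "k = length c" if "c \<in> permutations_of_set {..<k}" for k
    using length_finite_permutations_of_set[OF that] by simp
  ultimately show ?thesis unfolding ordered_offspring_def by auto
qed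

lemma pmf_ordered_offspring:
  assumes "c \<in> permutations_of_set {..<d}"
  shows "pmf (ordered_offspring \<mu>) c = pmf \<mu> d / fact d"
proof -
  have *: "pmf (pmf_of_set (permutations_of_set {..<k})) c = (if k = d then 1 / fact d else 0)" for k
  proof -
    have "c \<in> permutations_of_set {..<k} \<longleftrightarrow> k = d"
      using assms length_finite_permutations_of_set[of c "{..<k}"]
        length_finite_permutations_of_set[of c "{..<d}"] by auto
    then show ?thesis by (subst pmf_of_set) auto
  qed
  have "pmf (ordered_offspring \<mu>) c = (\<integral>k. (if k = d then 1 / fact d else 0) \<partial>measure_pmf \<mu>)"
    unfolding ordered_offspring_def pmf_bind * ..
  also have "\<dots> = (\<Sum>k\<in>{d}. (if k = d then 1 / fact d else 0) * pmf \<mu> k)"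
    by (rule integral_measure_pmf_real) (auto split: if_splits)
  finally show ?thesis by simp
qed

lemma pmf_kesten_offspring:
  assumes "c \<in> permutations_of_set {..<d}"
  shows "pmf (kesten_offspring \<pi> v) c = (if snd v = [] then real d else 1) * pmf \<pi> d / fact d"
  using pmf_ordered_offspring[OF assms] by (simp add: kesten_offspring_def pmf_size_biased)

text \<open>The size-biased law does not charge zero, so the list at a path vertex is nonempty and,
  as an arrangement of an initial segment, contains the number zero.\<close>

lemma kesten_support_valid:
  assumes "\<omega> \<in> kesten_support \<pi>"
  shows "valid_offspring \<omega>"
proof -
  have *: "\<omega> v \<in> permutations_of_set {..<length (\<omega> v)}" for v
  proof -
    have "\<omega> v \<in> set_pmf (kesten_offspring \<pi> v)" using assms unfolding kesten_support_def by blast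
    then show ?thesis unfolding kesten_offspring_def set_ordered_offspring by blast
  qed
  have "0 < length (\<omega> (n, []))" for n
  proof -
    have "length (\<omega> (n, [])) \<in> set_pmf (size_biased \<pi>)"
    proof -
      have "\<omega> (n, []) \<in> set_pmf (kesten_offspring \<pi> (n, []))"
        using assms unfolding kesten_support_def by blast
      then show ?thesis by (simp add: kesten_offspring_def set_ordered_offspring)
    qed
    then show ?thesis by (auto simp: set_pmf_iff pmf_size_biased intro: gr0I)
  qed
  then show ?thesis
    using permutations_of_setD[OF *] unfolding valid_offspring_def by simp
qed

sublocale kesten: product_prob_space "\<lambda>v. measure_pmf (kesten_offspring \<pi> v)" UNIV
  by (intro product_prob_spaceI prob_space_measure_pmf)

abbreviation "KP \<equiv> PiM UNIV (\<lambda>v. measure_pmf (kesten_offspring \<pi> v))"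

lemma AE_kesten_support: "AE \<omega> in KP. \<omega> \<in> kesten_support \<pi>"
  unfolding kesten_support_def mem_Collect_eq
  by (subst AE_all_countable) (auto intro!: kesten.AE_component AE_pmfI)

lemma kesten_support_sets: "kesten_support \<pi> \<in> sets KP"
proof -
  have top: "UNIV \<in> sets KP" using sets.top[of KP] by (simp add: space_PiM)
  have "kesten_support \<pi> = (\<Inter>v. (\<lambda>\<omega>. \<omega> v) -` set_pmf (kesten_offspring \<pi> v) \<inter> space KP)"
    by (auto simp: kesten_support_def space_PiM)
  also have "\<dots> \<in> sets KP"
    by (intro sets.countable_INT'' measurable_sets[OF measurable_component_singleton]) (auto simp: top)
  finally show ?thesis .
qed

lemma kesten_space_eq: "kesten_space \<pi> = restrict_space KP (kesten_support \<pi>)"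
  by (simp add: kesten_space_def kesten_support_def)

lemma emeasure_kesten_space:
  assumes "A \<in> sets KP"
  shows "emeasure (kesten_space \<pi>) (A \<inter> kesten_support \<pi>) = emeasure KP A"
proof -
  have "emeasure (kesten_space \<pi>) (A \<inter> kesten_support \<pi>) = emeasure KP (A \<inter> kesten_support \<pi>)"
    unfolding kesten_space_eq using kesten_support_sets
    by (intro emeasure_restrict_space) (auto simp: space_PiM)
  also have "\<dots> = emeasure KP A"
    using AE_kesten_support assms kesten_support_sets by (intro emeasure_eq_AE) auto
  finally show ?thesis .
qed

lemma prob_space_kesten_space: "prob_space (kesten_space \<pi>)"
proof
  have "emeasure (kesten_space \<pi>) (space (kesten_space \<pi>)) = emeasure KP (space KP)"
    using emeasure_kesten_space[OF sets.top] by (simp add: space_kesten_space space_PiM)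
  then show "emeasure (kesten_space \<pi>) (space (kesten_space \<pi>)) = 1"
    using kesten.emeasure_space_1 by simp
qed

fun list_weight :: "(int \<times> nat list) list \<Rightarrow> nat list list \<Rightarrow> real" where
  "list_weight st [] = 1"
| "list_weight [] (c # cs) = 0"
| "list_weight (v # st) (c # cs) =
     pmf (kesten_offspring \<pi> v) c * list_weight (rev (map (kesten_child v) c) @ st) cs"

lemma list_weight_visited:
  "list_weight st cs = (if length (visited st cs) = length cs
     then \<Prod>i<length cs. pmf (kesten_offspring \<pi> (visited st cs ! i)) (cs ! i) else 0)"
  by (induction st cs rule: expand.induct) (auto simp: prod.lessThan_Suc_shift simp del: prod.lessThan_Suc)

lemma list_weight_nonneg: "0 \<le> list_weight st cs"
  by (induction st cs rule: expand.induct) auto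

text \<open>The visited vertices are distinct, so the event fixes different coordinates of a product
  measure.\<close>

lemma follows_sets: "{\<omega>. follows \<omega> st cs} \<in> sets KP"
  and emeasure_follows:
    "sorted_wrt separated st \<Longrightarrow> \<forall>c\<in>set cs. distinct c \<Longrightarrow>
      emeasure KP {\<omega>. follows \<omega> st cs} = ennreal (list_weight st cs)"
proof -
  let ?vs = "visited st cs"
  have "{\<omega>. follows \<omega> st cs} = (if length ?vs = length cs
      then \<Inter>i\<in>{..<length cs}. (\<lambda>\<omega>. \<omega> (?vs ! i)) -` {cs ! i} \<inter> space KP else {})
      \<inter> space KP"
    by (auto simp: follows_iff space_PiM)
  also have "\<dots> \<in> sets KP"
  proof (cases "length cs = 0")
    case False
    then have "(\<Inter>i\<in>{..<length cs}. (\<lambda>\<omega>. \<omega> (?vs ! i)) -` {cs ! i} \<inter> space KP) \<in> sets KP"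
      by (intro sets.finite_INT measurable_sets[OF measurable_component_singleton]) (auto simp: lessThan_empty_iff)
    then show ?thesis by auto
  qed auto
  finally show "{\<omega>. follows \<omega> st cs} \<in> sets KP" .
  assume sep: "sorted_wrt separated st" and dist: "\<forall>c\<in>set cs. distinct c"
  show "emeasure KP {\<omega>. follows \<omega> st cs} = ennreal (list_weight st cs)"
  proof (cases "length ?vs = length cs")
    case True
    have d: "distinct ?vs" using visited_expand_distinct[OF sep dist] by auto
    then have inj: "inj_on ((!) ?vs) {..<length cs}"
      using True by (auto simp: inj_on_def nth_eq_iff_index_eq)
    \<comment> \<open>Inverts the numbering of the visited vertices, so that the prescription
      becomes a function of the vertex.\<close>
    define g where "g v = cs ! (the_inv_into {..<length cs} ((!) ?vs) v)" for v
    have g: "g (?vs ! i) = cs ! i" if "i < length cs" for i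
      using the_inv_into_f_f[OF inj] that by (simp add: g_def)
    have "{\<omega>. follows \<omega> st cs} = {\<omega> \<in> space KP. \<forall>v\<in>(!) ?vs ` {..<length cs}. \<omega> v \<in> {g v}}"
      using True g by (auto simp: follows_iff space_PiM)
    also have "emeasure KP \<dots> = (\<Prod>v\<in>(!) ?vs ` {..<length cs}. emeasure (measure_pmf (kesten_offspring \<pi> v)) {g v})"
      by (rule kesten.emeasure_PiM_Collect) auto
    also have "\<dots> = (\<Prod>i<length cs. ennreal (pmf (kesten_offspring \<pi> (?vs ! i)) (cs ! i)))"
      using g by (simp add: prod.reindex[OF inj] emeasure_pmf_single)
    also have "\<dots> = ennreal (list_weight st cs)"
      using True by (simp add: prod_ennreal list_weight_visited)
    finally show ?thesis .
  next
    case False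
    then have "{\<omega>. follows \<omega> st cs} = {}" by (auto simp: follows_iff)
    then show ?thesis using False by (simp add: list_weight_visited)
  qed
qed

section \<open>Summation over the sibling arrangements\<close>

abbreviation "perms d \<equiv> permutations_of_set {..<d::nat}"

text \<open>Such an arrangement arises by inserting zero into an arrangement of the other
  \<open>d - 1\<close> numbers. Places in the stack count from the end of the list, which gives the
  insertion index \<open>d - Suc q\<close>.\<close>

lemma card_perms_position:
  assumes "q < d"
  shows "card {c \<in> perms d. rev c ! q = 0} = fact (d - 1)"
proof -
  define i where "i = d - Suc q"
  define ins where "ins xs = take i xs @ 0 # drop i xs" for xs :: "nat list"
  have i: "i < d" using assms by (simp add: i_def)
  have d0: "{..<d} = insert 0 {1..<d}" using assms by auto
  have len: "length xs = d - 1" if "xs \<in> permutations_of_set {1..<d}" for xs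
    using length_finite_permutations_of_set[OF that] by simp
  have "bij_betw ins (permutations_of_set {1..<d}) {c \<in> perms d. rev c ! q = 0}"
  proof (rule bij_betw_byWitness[where f' = "\<lambda>c. take i c @ drop (Suc i) c"])
    show "\<forall>xs\<in>permutations_of_set {1..<d}. take i (ins xs) @ drop (Suc i) (ins xs) = xs"
      using len i by (auto simp: ins_def)
    have c: "length c = d" "c ! i = 0" if "c \<in> {c \<in> perms d. rev c ! q = 0}" for c
      using that length_finite_permutations_of_set[of c "{..<d}"] assms by (auto simp: rev_nth i_def)
    have split: "c = take i c @ 0 # drop (Suc i) c" if "c \<in> {c \<in> perms d. rev c ! q = 0}" for c
      using id_take_nth_drop[of i c] c[OF that] i by simp
    show "\<forall>c\<in>{c \<in> perms d. rev c ! q = 0}. ins (take i c @ drop (Suc i) c) = c"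
    proof
      fix c assume a: "c \<in> {c \<in> perms d. rev c ! q = 0}"
      have "ins (take i c @ drop (Suc i) c) = take i c @ 0 # drop (Suc i) c"
        using c[OF a] i by (simp add: ins_def)
      then show "ins (take i c @ drop (Suc i) c) = c" using split[OF a] by simp
    qed
    show "ins ` permutations_of_set {1..<d} \<subseteq> {c \<in> perms d. rev c ! q = 0}"
    proof (intro image_subsetI CollectI conjI)
      fix xs assume a: "xs \<in> permutations_of_set {1..<d}"
      have x: "set xs = {1..<d}" "distinct xs" using permutations_of_setD[OF a] by auto
      have "mset (ins xs) = add_mset 0 (mset xs)"
        unfolding ins_def by (metis append_take_drop_id mset_append mset.simps(2) union_mset_add_mset_right)
      then have "set (ins xs) = insert 0 (set xs)" "distinct (ins xs) \<longleftrightarrow> distinct (0 # xs)"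
        by (metis set_mset_mset set_mset_add_mset_insert, metis mset.simps(2) mset_eq_imp_distinct_iff)
      then show "ins xs \<in> perms d" using x d0 by (intro permutations_of_setI) auto
      show "rev (ins xs) ! q = 0"
        using len[OF a] i assms by (simp add: rev_nth ins_def i_def nth_append)
    qed
    show "(\<lambda>c. take i c @ drop (Suc i) c) ` {c \<in> perms d. rev c ! q = 0} \<subseteq> permutations_of_set {1..<d}"
    proof (intro image_subsetI permutations_of_setI)
      fix c assume a: "c \<in> {c \<in> perms d. rev c ! q = 0}"
      have x: "set c = {..<d}" "distinct c" using permutations_of_setD[of c "{..<d}"] a by auto
      have x2: "set (take i c @ 0 # drop (Suc i) c) = {..<d}" "distinct (take i c @ 0 # drop (Suc i) c)"
        using x split[OF a] by auto
      then show "distinct (take i c @ drop (Suc i) c)" by auto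
      show "set (take i c @ drop (Suc i) c) = {1..<d}"
        using x2 unfolding d0 by (auto simp: insert_eq_iff)
    qed
  qed
  then have "card {c \<in> perms d. rev c ! q = 0} = card (permutations_of_set {1..<d})"
    by (simp add: bij_betw_same_card)
  then show ?thesis by simp
qed

lemma sum_listset_Cons:
  "(\<Sum>cs\<in>listset (A # As). f cs) = (\<Sum>c\<in>A. \<Sum>cs\<in>listset As. f (c # cs))"
proof -
  have "listset (A # As) = (\<lambda>(c, cs). c # cs) ` (A \<times> listset As)"
    by (auto simp: set_Cons_def)
  moreover have "inj_on (\<lambda>(c, cs). c # cs) (A \<times> listset As)" by (auto simp: inj_on_def)
  ultimately have "(\<Sum>cs\<in>listset (A # As). f cs) = (\<Sum>p\<in>A \<times> listset As. f ((\<lambda>(c, cs). c # cs) p))"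
    by (simp only: sum.reindex comp_def)
  then show ?thesis by (simp add: sum.cartesian_product case_prod_beta)
qed

lemma finite_listset_perms: "finite (listset (map perms ds))"
  by (induction ds) (auto simp: set_Cons_def intro!: finite_image_set2)

lemma listset_perms:
  "cs \<in> listset (map perms ds) \<Longrightarrow> map length cs = ds \<and> (\<forall>c\<in>set cs. distinct c)"
  by (induction ds arbitrary: cs)
    (auto simp: set_Cons_def permutations_of_setD length_finite_permutations_of_set)

text \<open>Given the degrees of the visited vertices, the bi-infinite path is uniformly distributed over
  the stack: the factor \<open>k\<close> of the size-biased law cancels the uniform choice of the
  path vertex among \<open>k\<close> siblings.\<close>

lemma sum_list_weight:
  assumes "spine_at st p n"
  shows "(\<Sum>cs\<in>listset (map perms ds). list_weight st cs * of_bool (expand st cs \<noteq> [] \<and> hd (expand st cs) = (m, [])))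
    = (\<Prod>d\<leftarrow>ds. pmf \<pi> d) * of_bool (foldr spine_back ds (0, m) = (p, n))"
  using assms
proof (induction ds arbitrary: st p n)
  case Nil
  have "st \<noteq> [] \<and> hd st = (m, []) \<longleftrightarrow> p = 0 \<and> n = m"
  proof
    assume a: "st \<noteq> [] \<and> hd st = (m, [])"
    then have "0 < length st" "st ! 0 = (m, [])" by (auto simp: hd_conv_nth)
    from spine_at_unique[OF Nil this] show "p = 0 \<and> n = m" by simp
  next
    assume "p = 0 \<and> n = m"
    then show "st \<noteq> [] \<and> hd st = (m, [])" using Nil by (auto simp: spine_at_def hd_conv_nth)
  qed
  then show ?case by auto
next
  case (Cons d ds)
  then obtain v r where st: "st = v # r" by (cases st) (auto simp: spine_at_def)
  let ?F = "\<lambda>st cs. of_bool (expand st cs \<noteq> [] \<and> hd (expand st cs) = (m, [])) :: real"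
  let ?st = "\<lambda>c. rev (map (kesten_child v) c) @ r"
  let ?\<Pi> = "(\<Prod>d\<leftarrow>ds. pmf \<pi> d)"
  obtain q' n' where qn: "foldr spine_back ds (0, m) = (q', n')" by fastforce
  have "(\<Sum>cs\<in>listset (map perms (d # ds)). list_weight st cs * ?F st cs)
      = (\<Sum>c\<in>perms d. \<Sum>cs\<in>listset (map perms ds). list_weight st (c # cs) * ?F st (c # cs))"
    unfolding list.map sum_listset_Cons ..
  also have "\<dots> = (\<Sum>c\<in>perms d. pmf (kesten_offspring \<pi> v) c *
      (\<Sum>cs\<in>listset (map perms ds). list_weight (?st c) cs * ?F (?st c) cs))"
    by (simp add: st sum_distrib_left mult.assoc)
  also have "\<dots> = (\<Prod>d\<leftarrow>d # ds. pmf \<pi> d) * of_bool (foldr spine_back (d # ds) (0, m) = (p, n))"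
  proof (cases p)
    \<comment> \<open>A path vertex is on top. The state \<open>q'\<close> after the visit asks for
      the number zero at place \<open>q'\<close> of the reversed list; \<open>(d - 1)!\<close>
      arrangements comply, each of mass \<open>d * \<pi>(d) / d!\<close>, which makes
      \<open>\<pi>(d)\<close> in total.\<close>
    case 0
    then have v: "v = (n, [])" using Cons.prems st by (simp add: spine_at_def)
    show ?thesis
    proof (cases "d = 0")
      \<comment> \<open>A path vertex has a child almost surely, and \<open>spine_back 0\<close>
        never leads to place zero: both sides vanish.\<close>
      case True
      then have "pmf (kesten_offspring \<pi> v) c = 0" if "c \<in> perms d" for c
        using pmf_kesten_offspring[OF that] v by simp
      moreover have "foldr spine_back (d # ds) (0, m) \<noteq> (p, n)"
        using True 0 qn by (auto simp: spine_back_def)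
      ultimately show ?thesis by simp
    next
      case False
      have summand: "pmf (kesten_offspring \<pi> v) c * (\<Sum>cs\<in>listset (map perms ds). list_weight (?st c) cs * ?F (?st c) cs)
          = pmf \<pi> d / fact (d - 1) * ?\<Pi> * of_bool (n = n' + 1) * of_bool (q' < d \<and> rev c ! q' = 0)"
        if c: "c \<in> perms d" for c
      proof -
        have set: "set c = {..<d}" "distinct c" "length c = d"
          using permutations_of_setD[OF c] length_finite_permutations_of_set[OF c] by auto
        then have "0 \<in> set (rev c)" using False by auto
        then obtain q where q: "q < length c" "rev c ! q = 0" unfolding in_set_conv_nth by auto
        have "q = q' \<longleftrightarrow> q' < d \<and> rev c ! q' = 0"
          using q set nth_eq_iff_index_eq[of "rev c" q q'] by auto
        moreover have "spine_at (?st c) q (n - 1)"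
          using spine_at_step_path[OF _ q set(2)] Cons.prems st 0 by simp
        ultimately have "(\<Sum>cs\<in>listset (map perms ds). list_weight (?st c) cs * ?F (?st c) cs)
           = ?\<Pi> * of_bool (n = n' + 1) * of_bool (q' < d \<and> rev c ! q' = 0)"
          using Cons.IH qn by (auto simp: of_bool_def)
        moreover have "pmf (kesten_offspring \<pi> v) c = pmf \<pi> d / fact (d - 1)"
          using pmf_kesten_offspring[OF c, of v] v False by (simp add: fact_reduce)
        ultimately show ?thesis by simp
      qed
      have "(\<Sum>c\<in>perms d. of_bool (q' < d \<and> rev c ! q' = 0)) = (fact (d - 1) * of_bool (q' < d) :: real)"
      proof (cases "q' < d")
        case True
        have "(\<Sum>c\<in>perms d. of_bool (q' < d \<and> rev c ! q' = 0)) = real (card {c \<in> perms d. rev c ! q' = 0})"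
          using True by (simp add: sum.If_cases of_bool_def Int_def)
        then show ?thesis using card_perms_position[OF True] True by simp
      qed simp
      then have "(\<Sum>c\<in>perms d. pmf \<pi> d / fact (d - 1) * ?\<Pi> * of_bool (n = n' + 1) * of_bool (q' < d \<and> rev c ! q' = 0))
         = pmf \<pi> d / fact (d - 1) * ?\<Pi> * of_bool (n = n' + 1) * (fact (d - 1) * of_bool (q' < d))"
        unfolding sum_distrib_left[symmetric] by (rule arg_cong)
      moreover have "(\<Sum>c\<in>perms d. pmf (kesten_offspring \<pi> v) c * (\<Sum>cs\<in>listset (map perms ds). list_weight (?st c) cs * ?F (?st c) cs))
         = (\<Sum>c\<in>perms d. pmf \<pi> d / fact (d - 1) * ?\<Pi> * of_bool (n = n' + 1) * of_bool (q' < d \<and> rev c ! q' = 0))"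
        by (rule sum.cong[OF refl]) (rule summand)
      ultimately have "(\<Sum>c\<in>perms d. pmf (kesten_offspring \<pi> v) c * (\<Sum>cs\<in>listset (map perms ds). list_weight (?st c) cs * ?F (?st c) cs))
         = pmf \<pi> d / fact (d - 1) * ?\<Pi> * of_bool (n = n' + 1) * (fact (d - 1) * of_bool (q' < d))"
        by simp
      also have "\<dots> = pmf \<pi> d * ?\<Pi> * of_bool (n = n' + 1 \<and> q' < d)" by (simp add: of_bool_def)
      also have "n = n' + 1 \<and> q' < d \<longleftrightarrow> foldr spine_back (d # ds) (0, m) = (p, n)"
        using qn 0 by (auto simp: spine_back_def)
      finally show ?thesis by simp
    qed
  next
    \<comment> \<open>The vertex on top is off the path: each of the \<open>d!\<close> arrangements
      has mass \<open>\<pi>(d) / d!\<close> and moves the path by the same amount.\<close>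
    case (Suc p0)
    then have v: "snd v \<noteq> []" using Cons.prems st unfolding spine_at_def by force
    have summand: "pmf (kesten_offspring \<pi> v) c * (\<Sum>cs\<in>listset (map perms ds). list_weight (?st c) cs * ?F (?st c) cs)
        = pmf \<pi> d / fact d * ?\<Pi> * of_bool (q' = p0 + d \<and> n' = n)" if c: "c \<in> perms d" for c
    proof -
      have "length c = d" using length_finite_permutations_of_set[OF c] by simp
      then have "spine_at (?st c) (p0 + d) n"
        using spine_at_step_other[of v r p0 n c] Cons.prems st Suc by simp
      then show ?thesis using Cons.IH qn pmf_kesten_offspring[OF c, of v] v by (auto simp: of_bool_def)
    qed
    have "(\<Sum>c\<in>perms d. pmf (kesten_offspring \<pi> v) c * (\<Sum>cs\<in>listset (map perms ds). list_weight (?st c) cs * ?F (?st c) cs))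
       = real (card (perms d)) * (pmf \<pi> d / fact d * ?\<Pi> * of_bool (q' = p0 + d \<and> n' = n))"
      by (simp add: summand)
    also have "\<dots> = pmf \<pi> d * ?\<Pi> * of_bool (q' = p0 + d \<and> n' = n)" by simp
    also have "q' = p0 + d \<and> n' = n \<longleftrightarrow> foldr spine_back (d # ds) (0, m) = (p, n)"
      using qn Suc by (auto simp: spine_back_def)
    finally show ?thesis by simp
  qed
  finally show ?case .
qed

text \<open>Only the degrees are fixed, the arrangements are summed out. Stopping just before the
  visit of \<open>o_m\<close> makes the events for different \<open>ds\<close> disjoint.\<close>

definition explored :: "int \<Rightarrow> int \<Rightarrow> nat list \<Rightarrow> (int \<times> nat list \<Rightarrow> nat list) set" where
  "explored N m ds = {\<omega> \<in> kesten_support \<pi>. \<exists>cs\<in>listset (map perms ds). follows \<omega> [(N, [])] cs \<and>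
     expand [(N, [])] cs \<noteq> [] \<and> hd (expand [(N, [])] cs) = (m, [])}"

lemma explored_eq:
  fixes N m :: int and ds :: "nat list"
  defines "st \<equiv> [(N, [] :: nat list)]"
  shows "explored N m ds = (\<Union>cs\<in>{cs \<in> listset (map perms ds). expand st cs \<noteq> [] \<and> hd (expand st cs) = (m, [])}.
    {\<omega>. follows \<omega> st cs}) \<inter> kesten_support \<pi>"
  by (auto simp: explored_def st_def)

lemma spine_at_singleton: "spine_at [(N, [])] 0 N"
  by (simp add: spine_at_def)

lemma explored_sets: "explored N m ds \<in> sets (kesten_space \<pi>)"
proof -
  have "explored N m ds \<in> sets KP"
    unfolding explored_eq using finite_listset_perms kesten_support_sets
    by (intro sets.Int sets.finite_UN follows_sets) auto
  then have "kesten_support \<pi> \<inter> explored N m ds \<in> sets (kesten_space \<pi>)"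
    unfolding kesten_space_eq sets_restrict_space by blast
  moreover have "kesten_support \<pi> \<inter> explored N m ds = explored N m ds" by (auto simp: explored_def)
  ultimately show ?thesis by simp
qed

lemma emeasure_explored:
  "emeasure (kesten_space \<pi>) (explored N m ds) =
     ennreal ((\<Prod>d\<leftarrow>ds. pmf \<pi> d) * of_bool (foldr spine_back ds (0, m) = (0, N)))"
proof -
  let ?st = "[(N, [] :: nat list)]"
  let ?fin = "\<lambda>cs. expand ?st cs \<noteq> [] \<and> hd (expand ?st cs) = (m, [])"
  let ?C = "{cs \<in> listset (map perms ds). ?fin cs}"
  have fin: "finite ?C" using finite_listset_perms[of ds] by simp
  have disj: "disjoint_family_on (\<lambda>cs. {\<omega>. follows \<omega> ?st cs}) ?C"
    unfolding disjoint_family_on_def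
  proof (intro ballI impI)
    fix cs cs' assume c: "cs \<in> ?C" "cs' \<in> ?C" "cs \<noteq> cs'"
    then have "map length cs = map length cs'" using listset_perms by auto
    then have "length cs = length cs'" by (metis length_map)
    then have False if "follows \<omega> ?st cs" "follows \<omega> ?st cs'" for \<omega>
      using follows_prefix[OF that] c(3) by auto
    then show "{\<omega>. follows \<omega> ?st cs} \<inter> {\<omega>. follows \<omega> ?st cs'} = {}" by auto
  qed
  have "emeasure (kesten_space \<pi>) (explored N m ds) = emeasure KP (\<Union>cs\<in>?C. {\<omega>. follows \<omega> ?st cs})"
    unfolding explored_eq using fin follows_sets
    by (intro emeasure_kesten_space sets.finite_UN) auto
  also have "\<dots> = (\<Sum>cs\<in>?C. emeasure KP {\<omega>. follows \<omega> ?st cs})"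
    using fin follows_sets disj by (intro sum_emeasure[symmetric]) auto
  also have "\<dots> = (\<Sum>cs\<in>?C. ennreal (list_weight ?st cs))"
    using listset_perms by (intro sum.cong refl emeasure_follows) auto
  also have "\<dots> = ennreal (\<Sum>cs\<in>?C. list_weight ?st cs)"
    by (rule sum_ennreal) (rule list_weight_nonneg)
  also have "(\<Sum>cs\<in>?C. list_weight ?st cs) = (\<Sum>cs\<in>listset (map perms ds). list_weight ?st cs * of_bool (?fin cs))"
    using finite_listset_perms[of ds] by (simp add: sum.If_cases of_bool_def Int_def if_distrib cong: if_cong)
  also have "\<dots> = (\<Prod>d\<leftarrow>ds. pmf \<pi> d) * of_bool (foldr spine_back ds (0, m) = (0, N))"
    by (rule sum_list_weight[OF spine_at_singleton])
  finally show ?thesis .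
qed

text \<open>If one exploration properly extended the other, it would have visited \<open>o_m\<close>
  and still have it on the stack.\<close>

lemma explored_inj:
  assumes "\<omega> \<in> explored N m ds" "\<omega> \<in> explored N m ds'"
  shows "ds = ds'"
proof -
  let ?st = "[(N, [] :: nat list)]"
  have *: "cs = cs'"
    if cs: "cs \<in> listset (map perms ds)" "follows \<omega> ?st cs" "expand ?st cs \<noteq> []" "hd (expand ?st cs) = (m, [])"
    and cs': "cs' \<in> listset (map perms ds')" "follows \<omega> ?st cs'" "expand ?st cs' \<noteq> []" "hd (expand ?st cs') = (m, [])"
    and le: "length cs \<le> length cs'" for cs cs' ds ds'
  proof -
    obtain cs2 where cs2: "cs' = cs @ cs2" using follows_prefix[OF cs(2) cs'(2) le] by blast
    have "cs2 = []"
    proof (rule ccontr)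
      assume "cs2 \<noteq> []"
      then have "(m, []) \<in> set (visited (expand ?st cs) cs2)"
        using cs(3,4) by (cases cs2; cases "expand ?st cs") auto
      then have "(m, []) \<in> set (visited ?st cs')" by (simp add: cs2 visited_append)
      moreover have "(m, []) \<in> set (expand ?st cs')" using cs'(3,4) by (metis list.set_sel(1))
      moreover have "distinct (visited ?st cs' @ expand ?st cs')"
        using visited_expand_distinct[of ?st cs'] listset_perms[OF cs'(1)] by simp
      ultimately show False by auto
    qed
    then show ?thesis using cs2 by simp
  qed
  from assms obtain cs cs' where
    cs: "cs \<in> listset (map perms ds)" "follows \<omega> ?st cs" "expand ?st cs \<noteq> []" "hd (expand ?st cs) = (m, [])"
    and cs': "cs' \<in> listset (map perms ds')" "follows \<omega> ?st cs'" "expand ?st cs' \<noteq> []" "hd (expand ?st cs') = (m, [])"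
    unfolding explored_def by blast
  have "cs = cs'"
    using *[OF cs cs'] *[OF cs' cs] by (cases "length cs \<le> length cs'") auto
  then show ?thesis using listset_perms[OF cs(1)] listset_perms[OF cs'(1)] by simp
qed

text \<open>Folding the degrees after the first \<open>K\<close> back from the end gives the state
  after \<open>K\<close> visits, and \<open>(0, 0)\<close> means that \<open>o_0\<close> is then on
  top. The root thus has place \<open>K\<close> in the itinerary.\<close>

lemma backward_sequence_explored:
  assumes \<omega>: "\<omega> \<in> explored N m ds" and K: "K \<le> length ds" "foldr spine_back (drop K ds) (0, m) = (0, 0)"
    and k: "k < length ds"
  shows "backward_sequence (kesten_tree \<omega>) (int K - 1 - int k) = int (ds ! k) - 1"
proof -
  let ?st = "[(N, [] :: nat list)]"
  have valid: "valid_offspring \<omega>" using \<omega> kesten_support_valid by (simp add: explored_def)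
  from \<omega> obtain cs where
    cs: "cs \<in> listset (map perms ds)" "follows \<omega> ?st cs" "expand ?st cs \<noteq> []" "hd (expand ?st cs) = (m, [])"
    unfolding explored_def by blast
  have ds: "map length cs = ds" using listset_perms[OF cs(1)] by simp
  then have len: "length cs = length ds" by (metis length_map)
  define cs1 cs2 where "cs1 = take K cs" and "cs2 = drop K cs"
  have c12: "cs = cs1 @ cs2" by (simp add: cs1_def cs2_def)
  have f1: "follows \<omega> ?st cs1" and f2: "follows \<omega> (expand ?st cs1) cs2"
    using cs(2) by (simp_all add: c12 follows_append)
  obtain p1 n1 where s1: "spine_at (expand ?st cs1) p1 n1"
    using spine_at_expand[OF valid f1 spine_at_singleton] by blast
  obtain p2 n2 where s2: "spine_at (expand ?st cs) p2 n2"
    "(p1, n1) = foldr spine_back (map length cs2) (p2, n2)"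
    using spine_at_expand[OF valid f2 s1] by (auto simp: c12 expand_append)
  have "0 < length (expand ?st cs)" "expand ?st cs ! 0 = (m, [])" using cs(3,4) by (auto simp: hd_conv_nth)
  from spine_at_unique[OF s2(1) this] have "p2 = 0" "n2 = m" by auto
  moreover have "map length cs2 = drop K ds" using ds by (simp add: cs2_def flip: drop_map)
  ultimately have "p1 = 0" "n1 = 0" using s2(2) K(2) by auto
  then have e1: "expand ?st cs1 \<noteq> []" "hd (expand ?st cs1) = (0, [])"
    using s1 by (auto simp: spine_at_def hd_conv_nth)
  have it: "itinerary ?st cs = visited ?st cs1 @ itinerary (expand ?st cs1) cs2"
    by (simp add: itinerary_def c12 visited_append expand_append)
  have "length (visited ?st cs1) = K"
    using length_visited[OF f1] K(1) len by (simp add: cs1_def)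
  moreover have ne: "itinerary (expand ?st cs1) cs2 \<noteq> []"
    using cs(3) by (auto simp: itinerary_def c12 expand_append neq_Nil_conv)
  moreover have "itinerary (expand ?st cs1) cs2 ! 0 = (0, [])"
    using hd_itinerary[OF ne] e1(2) ne by (simp add: hd_conv_nth)
  ultimately have "K < length (itinerary ?st cs)" "itinerary ?st cs ! K = (0, [])"
    by (auto simp: it nth_append)
  moreover have "pending \<omega> ?st" by (simp add: pending_def kesten_verts.path)
  ultimately have "backward_sequence (kesten_tree \<omega>) (int K - 1 - int k) = int (length (cs ! k)) - 1"
    using backward_sequence_exploration[OF valid _ cs(2)] k len by simp
  also have "length (cs ! k) = ds ! k" using ds k len by (metis nth_map)
  finally show ?thesis .
qed

end

section \<open>Recurrence of the walk\<close>

locale skip_free_walk = prob_space M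
  for M :: "'w measure" and X :: "int \<Rightarrow> 'w \<Rightarrow> int" +
  assumes indep: "indep_vars (\<lambda>_. count_space UNIV) X UNIV"
    and ident: "distr M (count_space UNIV) (X n) = distr M (count_space UNIV) (X 0)"
    and skip_free: "\<omega> \<in> space M \<Longrightarrow> -1 \<le> X n \<omega>"
    and integrable_0: "integrable M (\<lambda>\<omega>. real_of_int (X 0 \<omega>))"
    and mean_0: "expectation (\<lambda>\<omega>. real_of_int (X 0 \<omega>)) = 0"

lemma measurable_count_space_binary:
  fixes f :: "'a \<Rightarrow> 'b :: countable" and g :: "'a \<Rightarrow> 'c"
  assumes "f \<in> measurable M (count_space UNIV)" "g \<in> measurable M (count_space UNIV)"
  shows "(\<lambda>x. h (f x) (g x)) \<in> measurable M (count_space UNIV)"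
  by (rule measurable_compose_countable[OF _ assms(1)])
     (rule measurable_compose[OF assms(2)], simp)

lemma measurable_sum_count_space:
  fixes f :: "'i \<Rightarrow> 'a \<Rightarrow> int"
  assumes "finite A" "\<And>a. a \<in> A \<Longrightarrow> f a \<in> measurable M (count_space UNIV)"
  shows "(\<lambda>x. \<Sum>a\<in>A. f a x) \<in> measurable M (count_space UNIV)"
  using assms
proof (induction A)
  case (insert a A)
  then show ?case
    using measurable_count_space_binary[where h = "(+)", of "f a" M "\<lambda>x. \<Sum>a\<in>A. f a x"] by simp
qed simp

text \<open>\<open>future_max x n i\<close> is the maximum over \<open>0 \<le> k \<le> n\<close> of \<open>x_i + ... + x_{i+k-1}\<close>.\<close>

primrec future_max :: "(int \<Rightarrow> int) \<Rightarrow> nat \<Rightarrow> int \<Rightarrow> int" where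
  "future_max x 0 i = 0"
| "future_max x (Suc n) i = max 0 (x i + future_max x n (i + 1))"

lemma future_max_nonneg: "0 \<le> future_max x n i"
  by (cases n) auto

lemma sum_int_atLeastLessThan_head:
  fixes x :: "int \<Rightarrow> int"
  assumes "i < j" shows "(\<Sum>l\<in>{i..<j}. x l) = x i + (\<Sum>l\<in>{i+1..<j}. x l)"
proof -
  have "{i..<j} = insert i {i+1..<j}" using assms by auto
  then show ?thesis by simp
qed

lemma future_max_le:
  assumes "0 \<le> b" "\<And>j. i < j \<Longrightarrow> (\<Sum>l\<in>{i..<j}. x l) \<le> b"
  shows "future_max x n i \<le> b"
  using assms
proof (induction n arbitrary: i b)
  case (Suc n)
  have "x i \<le> b" using Suc.prems(2)[of "i + 1"] by (simp add: sum_int_atLeastLessThan_head)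
  moreover have "(\<Sum>l\<in>{i+1..<j}. x l) \<le> b - x i" if "i + 1 < j" for j
    using Suc.prems(2)[of j] that by (simp add: sum_int_atLeastLessThan_head)
  ultimately have "future_max x n (i + 1) \<le> b - x i" using Suc.IH[of "b - x i" "i + 1"] by simp
  then show ?case using Suc.prems by simp
qed simp

text \<open>Lowering the steps lowers the maximum by at most the total amount removed. This
  separates a walk with bounded steps from the tail of the step law.\<close>

lemma future_max_truncate:
  assumes "\<And>l. x' l \<le> x l"
  shows "future_max x n i \<le> future_max x' n i + (\<Sum>k<n. x (i + int k) - x' (i + int k))"
proof (induction n arbitrary: i)
  case (Suc n)
  have "(\<Sum>k<Suc n. x (i + int k) - x' (i + int k)) =
      x i - x' i + (\<Sum>k<n. x (i + 1 + int k) - x' (i + 1 + int k))"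
    by (simp add: sum.lessThan_Suc_shift algebra_simps del: sum.lessThan_Suc)
  moreover have "0 \<le> (\<Sum>k<n. x (i + 1 + int k) - x' (i + 1 + int k))"
    using assms by (intro sum_nonneg) simp
  ultimately show ?case using Suc[of "i + 1"] assms[of i] by simp
qed simp

lemma measurable_future_max:
  assumes "\<And>l. i \<le> l \<Longrightarrow> (\<lambda>\<omega>. x \<omega> l) \<in> measurable M (count_space UNIV)"
  shows "(\<lambda>\<omega>. future_max (x \<omega>) n i) \<in> measurable M (count_space UNIV)"
  using assms
proof (induction n arbitrary: i)
  case (Suc n)
  then show ?case
    using measurable_count_space_binary[of "\<lambda>\<omega>. x \<omega> i" M "\<lambda>\<omega>. future_max (x \<omega>) n (i + 1)" "\<lambda>a b. max 0 (a + b)"]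
    by simp
qed simp

lemma future_max_cong: "(\<And>l. i \<le> l \<Longrightarrow> x l = y l) \<Longrightarrow> future_max x n i = future_max y n i"
  by (induction n arbitrary: i) auto

context skip_free_walk
begin

lemma rv [measurable]: "X i \<in> measurable M (count_space UNIV)"
  using indep by (simp add: indep_vars_def)

lemma expectation_X: "expectation (\<lambda>\<omega>. g (X i \<omega>) :: real) = expectation (\<lambda>\<omega>. g (X 0 \<omega>))"
proof -
  have "expectation (\<lambda>\<omega>. g (X i \<omega>)) = (\<integral>a. g a \<partial>distr M (count_space UNIV) (X i))" for i
    by (rule integral_distr[symmetric]) auto
  then show ?thesis by (metis ident)
qed

lemma integrable_X: "integrable M (\<lambda>\<omega>. g (X i \<omega>) :: real) \<longleftrightarrow> integrable M (\<lambda>\<omega>. g (X 0 \<omega>))"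
proof -
  have "integrable M (\<lambda>\<omega>. g (X i \<omega>)) \<longleftrightarrow> integrable (distr M (count_space UNIV) (X i)) g" for i
    by (rule integrable_distr_eq[symmetric]) auto
  then show ?thesis by (metis ident)
qed

lemma measurable_future_max_X:
  "(\<lambda>\<omega>. future_max (\<lambda>l. h (X l \<omega>)) n i) \<in> measurable M (count_space UNIV)"
  by (rule measurable_future_max) (rule measurable_compose[OF rv], simp)

text \<open>The maximum from \<open>i + 1\<close> on involves later steps only. The function
  \<open>h\<close> lets the statement serve the truncated walk too.\<close>

lemma indep_X_future_max:
  "indep_var (count_space UNIV) (X i) (count_space UNIV) (\<lambda>\<omega>. future_max (\<lambda>l. h (X l \<omega>)) n (i + 1))"
proof -
  have "indep_var (PiM {i} (\<lambda>_. count_space UNIV)) (\<lambda>\<omega>. restrict (\<lambda>l. X l \<omega>) {i})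
      (PiM {i+1..} (\<lambda>_. count_space UNIV)) (\<lambda>\<omega>. restrict (\<lambda>l. X l \<omega>) {i+1..})"
    by (rule indep_var_restrict[OF indep]) auto
  moreover have "(\<lambda>f. f i) \<in> measurable (PiM {i} (\<lambda>_. count_space UNIV)) (count_space UNIV :: int measure)"
    by (rule measurable_component_singleton) simp
  moreover have "(\<lambda>f. future_max (\<lambda>l. h (f l)) n (i + 1)) \<in>
      measurable (PiM {i+1..} (\<lambda>_. count_space UNIV)) (count_space UNIV)"
  proof (rule measurable_future_max)
    fix l assume "i + 1 \<le> l"
    then have "(\<lambda>f. f l) \<in> measurable (PiM {i+1..} (\<lambda>_. count_space UNIV)) (count_space UNIV :: int measure)"
      by (intro measurable_component_singleton) simp
    then show "(\<lambda>f. h (f l)) \<in> measurable (PiM {i+1..} (\<lambda>_. count_space UNIV)) (count_space UNIV)"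
      by (rule measurable_compose) simp
  qed
  ultimately have "indep_var (count_space UNIV) ((\<lambda>f. f i) \<circ> (\<lambda>\<omega>. restrict (\<lambda>l. X l \<omega>) {i}))
     (count_space UNIV) ((\<lambda>f. future_max (\<lambda>l. h (f l)) n (i + 1)) \<circ> (\<lambda>\<omega>. restrict (\<lambda>l. X l \<omega>) {i+1..}))"
    by (rule indep_var_compose)
  moreover have "future_max (\<lambda>l. h (restrict (\<lambda>l. X l \<omega>) {i+1..} l)) n (i + 1) =
      future_max (\<lambda>l. h (X l \<omega>)) n (i + 1)" for \<omega>
    by (rule future_max_cong) simp
  ultimately show ?thesis by (simp add: comp_def)
qed

text \<open>Shift invariance of the maximum goes by induction on \<open>n\<close>: the recursion
  presents its law as the image of a product of one-dimensional laws.\<close>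

lemma distr_pair_X_future_max:
  "distr M (count_space UNIV \<Otimes>\<^sub>M count_space UNIV) (\<lambda>\<omega>. (X i \<omega>, future_max (\<lambda>l. X l \<omega>) n (i + 1))) =
   distr M (count_space UNIV \<Otimes>\<^sub>M count_space UNIV) (\<lambda>\<omega>. (X 0 \<omega>, future_max (\<lambda>l. X l \<omega>) n 1))"
proof -
  have pair: "distr M (count_space UNIV \<Otimes>\<^sub>M count_space UNIV) (\<lambda>\<omega>. (X i \<omega>, future_max (\<lambda>l. X l \<omega>) n (i + 1))) =
     distr M (count_space UNIV) (X i) \<Otimes>\<^sub>M distr M (count_space UNIV) (\<lambda>\<omega>. future_max (\<lambda>l. X l \<omega>) n (i + 1))"
    for n i
    using indep_X_future_max[of i "\<lambda>a. a" n] by (simp add: indep_var_distribution_eq)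
  have "distr M (count_space UNIV) (\<lambda>\<omega>. future_max (\<lambda>l. X l \<omega>) n i) =
      distr M (count_space UNIV) (\<lambda>\<omega>. future_max (\<lambda>l. X l \<omega>) n 0)" for n i
  proof (induction n arbitrary: i)
    case (Suc n)
    let ?g = "\<lambda>(a, b). max 0 (a + b :: int)"
    have m: "?g \<in> measurable (count_space UNIV \<Otimes>\<^sub>M count_space UNIV) (count_space UNIV)"
      by (simp add: pair_measure_countable)
    have step: "distr M (count_space UNIV) (\<lambda>\<omega>. future_max (\<lambda>l. X l \<omega>) (Suc n) i) =
       distr (distr M (count_space UNIV) (X i) \<Otimes>\<^sub>M
         distr M (count_space UNIV) (\<lambda>\<omega>. future_max (\<lambda>l. X l \<omega>) n (i + 1))) (count_space UNIV) ?g" for i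
      unfolding pair[symmetric]
      by (subst distr_distr[OF m])
         (auto intro!: measurable_Pair measurable_future_max_X[of "\<lambda>a. a"] simp: comp_def)
    show ?case unfolding step using Suc[of "i + 1"] Suc[of 1] ident[of i] by simp
  qed simp
  from this[of n "i + 1"] this[of n 1] show ?thesis
    using pair[of i n] pair[of 0 n] ident[of i] by simp
qed

text \<open>As steps are at least \<open>-1\<close>, this is the probability that the walk is
  negative at all times from \<open>1\<close> to \<open>n + 1\<close>; equivalently, that the
  cut-off at zero in stage \<open>Suc n\<close> of \<open>future_max\<close> is active.\<close>

definition descent_prob :: "nat \<Rightarrow> real" where
  "descent_prob n = prob {\<omega> \<in> space M. X 0 \<omega> = -1 \<and> future_max (\<lambda>l. X l \<omega>) n 1 = 0}"

lemma descent_prob: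
  "prob {\<omega> \<in> space M. X i \<omega> = -1 \<and> future_max (\<lambda>l. X l \<omega>) n (i + 1) = 0} = descent_prob n"
proof -
  let ?N = "count_space UNIV \<Otimes>\<^sub>M count_space UNIV :: (int \<times> int) measure"
  let ?f = "\<lambda>i \<omega>. (X i \<omega>, future_max (\<lambda>l. X l \<omega>) n (i + 1))"
  have f: "?f i \<in> measurable M ?N" for i
    by (intro measurable_Pair rv measurable_future_max_X[of "\<lambda>a. a"])
  have "prob {\<omega> \<in> space M. X i \<omega> = -1 \<and> future_max (\<lambda>l. X l \<omega>) n (i + 1) = 0} =
      measure (distr M ?N (?f i)) {(-1, 0)}" for i
  proof -
    have "{-1} \<times> {0} \<in> sets ?N" by (rule pair_measureI) simp_all
    then have "{(-1, 0)} \<in> sets ?N" by simp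
    from measure_distr[OF f this, of i] show ?thesis by (auto intro!: arg_cong[where f=prob])
  qed
  from this[of i] this[of 0] show ?thesis
    using distr_pair_X_future_max[of i n] by (simp add: descent_prob_def)
qed

lemma integrable_future_max: "integrable M (\<lambda>\<omega>. real_of_int (future_max (\<lambda>l. X l \<omega>) n i))"
proof (induction n arbitrary: i)
  case (Suc n)
  have "integrable M (\<lambda>\<omega>. max 0 (real_of_int (X i \<omega>) + real_of_int (future_max (\<lambda>l. X l \<omega>) n (i + 1))))"
    using Suc integrable_0 integrable_X[of real_of_int i] by (intro integrable_max Bochner_Integration.integrable_add) auto
  then show ?case by (simp add: of_int_max)
qed simp

text \<open>The step is at least \<open>-1\<close> and the maximum nonnegative, so their sum is
  negative only when it equals \<open>-1\<close>; there the cut-off adds exactly one. The step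
  itself has mean zero.\<close>

lemma expectation_future_max_Suc:
  "expectation (\<lambda>\<omega>. real_of_int (future_max (\<lambda>l. X l \<omega>) (Suc n) i)) =
   expectation (\<lambda>\<omega>. real_of_int (future_max (\<lambda>l. X l \<omega>) n (i + 1))) + descent_prob n"
proof -
  let ?V = "\<lambda>\<omega>. future_max (\<lambda>l. X l \<omega>) n (i + 1)"
  let ?A = "{\<omega> \<in> space M. X i \<omega> = -1 \<and> ?V \<omega> = 0}"
  have A: "?A \<in> events"
    using measurable_future_max_X[of "\<lambda>a. a" n "i + 1"] by measurable
  have "expectation (\<lambda>\<omega>. real_of_int (future_max (\<lambda>l. X l \<omega>) (Suc n) i)) =
     expectation (\<lambda>\<omega>. real_of_int (X i \<omega>) + (real_of_int (?V \<omega>) + indicat_real ?A \<omega>))"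
  proof (rule Bochner_Integration.integral_cong[OF refl])
    fix \<omega> assume w: "\<omega> \<in> space M"
    then have "max 0 (X i \<omega> + ?V \<omega>) = X i \<omega> + ?V \<omega> + (if X i \<omega> = -1 \<and> ?V \<omega> = 0 then 1 else 0)"
      using skip_free[OF w, of i] future_max_nonneg[of "\<lambda>l. X l \<omega>" n "i + 1"] by auto
    then show "real_of_int (future_max (\<lambda>l. X l \<omega>) (Suc n) i) =
       real_of_int (X i \<omega>) + (real_of_int (?V \<omega>) + indicat_real ?A \<omega>)"
      using w by (auto simp: indicator_def)
  qed
  also have "\<dots> = expectation (\<lambda>\<omega>. real_of_int (X i \<omega>)) + (expectation (\<lambda>\<omega>. real_of_int (?V \<omega>)) + prob ?A)"
    using A integrable_future_max integrable_0 integrable_X[of real_of_int i]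
    by (subst Bochner_Integration.integral_add)
       (auto simp: emeasure_eq_measure)
  also have "expectation (\<lambda>\<omega>. real_of_int (X i \<omega>)) = 0"
    using expectation_X[of real_of_int i] mean_0 by simp
  finally show ?thesis by (simp add: descent_prob)
qed

lemma expectation_future_max:
  "expectation (\<lambda>\<omega>. real_of_int (future_max (\<lambda>l. X l \<omega>) n i)) = (\<Sum>k<n. descent_prob k)"
  by (induction n arbitrary: i) (auto simp: expectation_future_max_Suc simp del: future_max.simps(2))

text \<open>The square of the positive part is at most the square of the sum. By independence the
  cross term has mean at most zero, since truncation from above makes the mean step nonpositive; so
  each step adds at most \<open>K^2\<close>. The bound \<open>1 \<le> K\<close> accounts for the
  value \<open>-1\<close>.\<close>

lemma truncated_second_moment:
  assumes K: "1 \<le> K"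
  defines "V \<equiv> \<lambda>n i \<omega>. real_of_int (future_max (\<lambda>l. min (X l \<omega>) K) n i)"
  shows "integrable M (\<lambda>\<omega>. (V n i \<omega>)\<^sup>2) \<and> integrable M (V n i) \<and>
    expectation (\<lambda>\<omega>. (V n i \<omega>)\<^sup>2) \<le> real n * (real_of_int K)\<^sup>2"
proof (induction n arbitrary: i)
  case 0
  show ?case by (simp add: V_def)
next
  case (Suc n)
  let ?Y = "\<lambda>\<omega>. real_of_int (min (X i \<omega>) K)"
  have Ym: "?Y \<in> borel_measurable M" by (rule measurable_compose[OF rv]) simp
  have Vm: "V n i \<in> borel_measurable M" for n i
    unfolding V_def by (rule measurable_compose[OF measurable_future_max_X[of "\<lambda>a. min a K"]]) simp
  have Yb: "\<bar>?Y \<omega>\<bar> \<le> real_of_int K" if "\<omega> \<in> space M" for \<omega>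
    using skip_free[OF that, of i] K by auto
  have Yi: "integrable M ?Y"
    by (rule integrable_const_bound[where B="real_of_int K"]) (use Yb Ym in auto)
  have Y2b: "(?Y \<omega>)\<^sup>2 \<le> (real_of_int K)\<^sup>2" if "\<omega> \<in> space M" for \<omega>
    using Yb[OF that] by (rule abs_le_square_iff[THEN iffD1, OF order_trans]) simp
  have Y2i: "integrable M (\<lambda>\<omega>. (?Y \<omega>)\<^sup>2)"
    by (rule integrable_const_bound[where B="(real_of_int K)\<^sup>2"]) (use Y2b Ym in auto)
  have ind: "indep_var borel ?Y borel (V n (i + 1))"
  proof -
    have "indep_var borel ((\<lambda>a. real_of_int (min a K)) \<circ> X i) borel
       (real_of_int \<circ> (\<lambda>\<omega>. future_max (\<lambda>l. min (X l \<omega>) K) n (i + 1)))"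
      by (rule indep_var_compose[OF indep_X_future_max[of i "\<lambda>a. min a K"]]) auto
    then show ?thesis by (simp add: comp_def V_def)
  qed
  note IH = Suc[of "i + 1"]
  have YVi: "integrable M (\<lambda>\<omega>. ?Y \<omega> * V n (i + 1) \<omega>)"
    using IH Yi by (intro indep_var_integrable[OF ind]) auto
  have EYV: "expectation (\<lambda>\<omega>. ?Y \<omega> * V n (i + 1) \<omega>) \<le> 0"
  proof -
    have "expectation ?Y \<le> expectation (\<lambda>\<omega>. real_of_int (X i \<omega>))"
      using Yi integrable_0 integrable_X[of real_of_int i] by (intro integral_mono) auto
    also have "\<dots> = 0" using expectation_X[of real_of_int i] mean_0 by simp
    finally have "expectation ?Y \<le> 0" .
    moreover have "0 \<le> expectation (V n (i + 1))"
      by (intro integral_nonneg_AE) (auto simp: V_def future_max_nonneg)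
    moreover have "expectation (\<lambda>\<omega>. ?Y \<omega> * V n (i + 1) \<omega>) = expectation ?Y * expectation (V n (i + 1))"
      using IH Yi by (intro indep_var_lebesgue_integral[OF ind]) auto
    ultimately show ?thesis by (simp add: mult_nonpos_nonneg)
  qed
  let ?Q = "\<lambda>\<omega>. (?Y \<omega>)\<^sup>2 + (2 * (?Y \<omega> * V n (i + 1) \<omega>) + (V n (i + 1) \<omega>)\<^sup>2)"
  have Qi: "integrable M ?Q"
    using Y2i YVi IH by (intro Bochner_Integration.integrable_add integrable_mult_right) auto
  have VQ: "(V (Suc n) i \<omega>)\<^sup>2 \<le> ?Q \<omega>" for \<omega>
  proof -
    have "V (Suc n) i \<omega> = max 0 (?Y \<omega> + V n (i + 1) \<omega>)" by (simp add: V_def of_int_max)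
    then have "(V (Suc n) i \<omega>)\<^sup>2 \<le> (?Y \<omega> + V n (i + 1) \<omega>)\<^sup>2" by (auto simp: max_def)
    then show ?thesis by (simp add: power2_sum algebra_simps)
  qed
  have V2i: "integrable M (\<lambda>\<omega>. (V (Suc n) i \<omega>)\<^sup>2)"
    by (rule Bochner_Integration.integrable_bound[OF Qi]) (use VQ Vm in \<open>auto intro!: AE_I2 order_trans[OF VQ]\<close>)
  have Vi: "integrable M (V (Suc n) i)"
  proof -
    have "integrable M (\<lambda>\<omega>. max 0 (?Y \<omega> + V n (i + 1) \<omega>))"
      using Yi IH by (intro integrable_max Bochner_Integration.integrable_add) auto
    then show ?thesis by (simp add: V_def of_int_max)
  qed
  have "expectation (\<lambda>\<omega>. (V (Suc n) i \<omega>)\<^sup>2) \<le> expectation ?Q"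
    using V2i Qi VQ by (intro integral_mono) auto
  also have "\<dots> = expectation (\<lambda>\<omega>. (?Y \<omega>)\<^sup>2) + (2 * expectation (\<lambda>\<omega>. ?Y \<omega> * V n (i + 1) \<omega>) +
      expectation (\<lambda>\<omega>. (V n (i + 1) \<omega>)\<^sup>2))"
    using Y2i YVi IH by (subst Bochner_Integration.integral_add | simp)+
  also have "\<dots> \<le> (real_of_int K)\<^sup>2 + (0 + real n * (real_of_int K)\<^sup>2)"
  proof (intro add_mono)
    have "expectation (\<lambda>\<omega>. (?Y \<omega>)\<^sup>2) \<le> expectation (\<lambda>\<omega>. (real_of_int K)\<^sup>2)"
      using Y2i Y2b by (intro integral_mono) auto
    then show "expectation (\<lambda>\<omega>. (?Y \<omega>)\<^sup>2) \<le> (real_of_int K)\<^sup>2" by (simp add: prob_space)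
  qed (use EYV IH in auto)
  also have "\<dots> = real (Suc n) * (real_of_int K)\<^sup>2" by (simp add: algebra_simps)
  finally show ?case using V2i Vi by blast
qed

definition tail_mean :: "int \<Rightarrow> real" where
  "tail_mean K = expectation (\<lambda>\<omega>. real_of_int (X 0 \<omega> - min (X 0 \<omega>) K))"

lemma tail_mean_tendsto: "(\<lambda>K. tail_mean (int K)) \<longlonglongrightarrow> 0"
proof -
  have "(\<lambda>K. expectation (\<lambda>\<omega>. real_of_int (X 0 \<omega> - min (X 0 \<omega>) (int K)))) \<longlonglongrightarrow> expectation (\<lambda>\<omega>. 0)"
  proof (rule integral_dominated_convergence[where w="\<lambda>\<omega>. \<bar>real_of_int (X 0 \<omega>)\<bar>"])
    show "(\<lambda>\<omega>. real_of_int (X 0 \<omega> - min (X 0 \<omega>) (int K))) \<in> borel_measurable M" for K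
      by (rule measurable_compose[OF rv]) simp
    show "integrable M (\<lambda>\<omega>. \<bar>real_of_int (X 0 \<omega>)\<bar>)" using integrable_0 by simp
    show "AE \<omega> in M. (\<lambda>K. real_of_int (X 0 \<omega> - min (X 0 \<omega>) (int K))) \<longlonglongrightarrow> 0"
    proof (rule AE_I2)
      fix \<omega>
      have "eventually (\<lambda>K. real_of_int (X 0 \<omega> - min (X 0 \<omega>) (int K)) = 0) sequentially"
        using eventually_ge_at_top[of "nat (X 0 \<omega>)"] by eventually_elim auto
      then show "(\<lambda>K. real_of_int (X 0 \<omega> - min (X 0 \<omega>) (int K))) \<longlonglongrightarrow> 0"
        by (rule tendsto_eventually)
    qed
    show "AE \<omega> in M. norm (real_of_int (X 0 \<omega> - min (X 0 \<omega>) (int K))) \<le> \<bar>real_of_int (X 0 \<omega>)\<bar>" for K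
      by (rule AE_I2) (auto simp: min_def)
  qed simp
  then show ?thesis by (simp add: tail_mean_def)
qed

lemma expectation_future_max_le:
  assumes K: "1 \<le> K" and e: "0 < e"
  shows "(\<Sum>k<n. descent_prob k) \<le> real n * (real_of_int K)\<^sup>2 / (2 * e) + e / 2 + real n * tail_mean K"
proof -
  let ?V = "\<lambda>\<omega>. real_of_int (future_max (\<lambda>l. min (X l \<omega>) K) n 0)"
  let ?R = "\<lambda>k \<omega>. real_of_int (X (int k) \<omega> - min (X (int k) \<omega>) K)"
  note V = truncated_second_moment[OF K, of n 0]
  have R0: "integrable M (\<lambda>\<omega>. real_of_int (X 0 \<omega> - min (X 0 \<omega>) K))"
  proof -
    have "integrable M (\<lambda>\<omega>. real_of_int (X 0 \<omega>) - min (real_of_int (X 0 \<omega>)) (real_of_int K))"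
      using integrable_0 by (intro Bochner_Integration.integrable_diff integrable_min) auto
    then show ?thesis by (simp add: of_int_min)
  qed
  have R: "integrable M (?R k)" "expectation (?R k) = tail_mean K" for k
    using R0 integrable_X[of "\<lambda>a. real_of_int (a - min a K)" "int k"]
      expectation_X[of "\<lambda>a. real_of_int (a - min a K)" "int k"] by (auto simp: tail_mean_def)
  have "(\<Sum>k<n. descent_prob k) = expectation (\<lambda>\<omega>. real_of_int (future_max (\<lambda>l. X l \<omega>) n 0))"
    by (simp add: expectation_future_max)
  also have "\<dots> \<le> expectation (\<lambda>\<omega>. ((?V \<omega>)\<^sup>2 / (2 * e) + e / 2) + (\<Sum>k<n. ?R k \<omega>))"
  proof (rule integral_mono)
    show "integrable M (\<lambda>\<omega>. ((?V \<omega>)\<^sup>2 / (2 * e) + e / 2) + (\<Sum>k<n. ?R k \<omega>))"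
      using V R by (intro Bochner_Integration.integrable_add Bochner_Integration.integrable_sum integrable_divide) auto
    fix \<omega> assume w: "\<omega> \<in> space M"
    have "future_max (\<lambda>l. X l \<omega>) n 0 \<le> future_max (\<lambda>l. min (X l \<omega>) K) n 0 +
        (\<Sum>k<n. X (0 + int k) \<omega> - min (X (0 + int k) \<omega>) K)"
      by (rule future_max_truncate) simp
    then have "real_of_int (future_max (\<lambda>l. X l \<omega>) n 0) \<le>
        real_of_int (future_max (\<lambda>l. min (X l \<omega>) K) n 0 + (\<Sum>k<n. X (int k) \<omega> - min (X (int k) \<omega>) K))"
      by (simp only: of_int_le_iff add_0)
    then have "real_of_int (future_max (\<lambda>l. X l \<omega>) n 0) \<le> ?V \<omega> + (\<Sum>k<n. ?R k \<omega>)"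
      by (simp only: of_int_add of_int_sum)
    \<comment> \<open>Completing the square bounds the mean by the second moment at the price of a
      free parameter \<open>e\<close>, later taken of order \<open>n\<close>.\<close>
    moreover have "?V \<omega> \<le> (?V \<omega>)\<^sup>2 / (2 * e) + e / 2"
    proof -
      have "0 \<le> (?V \<omega> - e)\<^sup>2 / (2 * e)" using e by simp
      also have "\<dots> = (?V \<omega>)\<^sup>2 / (2 * e) + e / 2 - ?V \<omega>"
        using e by (simp add: power2_diff field_simps power2_eq_square)
      finally show ?thesis by simp
    qed
    ultimately show "real_of_int (future_max (\<lambda>l. X l \<omega>) n 0) \<le> ((?V \<omega>)\<^sup>2 / (2 * e) + e / 2) + (\<Sum>k<n. ?R k \<omega>)"
      by simp
  qed (rule integrable_future_max)
  also have "\<dots> = expectation (\<lambda>\<omega>. (?V \<omega>)\<^sup>2) / (2 * e) + e / 2 + (\<Sum>k<n. expectation (?R k))"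
    using V R by (subst Bochner_Integration.integral_add Bochner_Integration.integral_sum | simp add: prob_space)+
  also have "\<dots> \<le> real n * (real_of_int K)\<^sup>2 / (2 * e) + e / 2 + real n * tail_mean K"
    using V e R by (auto intro!: divide_right_mono)
  finally show ?thesis .
qed

text \<open>\<open>descent_prob\<close> dominates the probability \<open>b\<close> of no return; its sum up to \<open>n\<close> is the
  mean of the running maximum, which is \<open>o(n)\<close>.\<close>

lemma descent_prob_lower_bound:
  assumes b: "\<And>n. b \<le> descent_prob n"
  shows "b \<le> 0"
proof (rule field_le_epsilon)
  fix \<epsilon> :: real assume \<epsilon>: "0 < \<epsilon>"
  have "eventually (\<lambda>K. tail_mean (int K) < \<epsilon> / 3) sequentially"
    using order_tendstoD(2)[OF tail_mean_tendsto, of "\<epsilon> / 3"] \<epsilon> by simp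
  then have "eventually (\<lambda>K. tail_mean (int K) < \<epsilon> / 3 \<and> 1 \<le> K) sequentially"
    using eventually_ge_at_top[of 1] by eventually_elim auto
  then obtain K :: nat where K: "tail_mean (int K) < \<epsilon> / 3" "1 \<le> K"
    using eventually_happens by fastforce
  \<comment> \<open>Large enough for the second moment term to be at most
    \<open>n * \<epsilon> / 3\<close> when \<open>e = n * \<epsilon> / 3\<close>. The other two
    terms are \<open>n * \<epsilon> / 6\<close> and at most
    \<open>n * \<epsilon> / 3\<close>.\<close>
  obtain n :: nat where n: "(real K)\<^sup>2 / \<epsilon>\<^sup>2 * 9 < real n" using reals_Archimedean2 by blast
  then have n0: "0 < real n" using \<epsilon> by (smt (verit) divide_nonneg_nonneg zero_le_power2)
  define e where "e = real n * \<epsilon> / 3"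
  have e: "0 < e" using n0 \<epsilon> by (simp add: e_def)
  have "real n * b = (\<Sum>k<n. b)" by simp
  also have "\<dots> \<le> (\<Sum>k<n. descent_prob k)" using b by (intro sum_mono) simp
  also have "\<dots> \<le> real n * (real K)\<^sup>2 / (2 * e) + e / 2 + real n * tail_mean (int K)"
    using expectation_future_max_le[of "int K" e n] K e by simp
  also have "real n * (real K)\<^sup>2 / (2 * e) \<le> real n * \<epsilon> / 3"
  proof -
    have "(real K)\<^sup>2 * 9 < real n * \<epsilon>\<^sup>2" using n \<epsilon> by (simp add: field_simps)
    moreover have "real n * (real K)\<^sup>2 / (2 * e) = (real K)\<^sup>2 * 3 / (2 * \<epsilon>)"
      using n0 \<epsilon> by (simp add: e_def field_simps)
    moreover have "(real K)\<^sup>2 * 3 / (2 * \<epsilon>) \<le> real n * \<epsilon> / 3 \<longleftrightarrow> (real K)\<^sup>2 * 9 \<le> 2 * (real n * \<epsilon>\<^sup>2)"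
      using \<epsilon> by (simp add: field_simps power2_eq_square)
    moreover have "0 \<le> real n * \<epsilon>\<^sup>2" by simp
    ultimately show ?thesis by linarith
  qed
  also have "real n * \<epsilon> / 3 + e / 2 + real n * tail_mean (int K) \<le> real n * \<epsilon>"
  proof -
    have "real n * tail_mean (int K) \<le> real n * (\<epsilon> / 3)" using K n0 by (intro mult_left_mono) auto
    moreover have "0 < real n * \<epsilon>" using n0 \<epsilon> by simp
    ultimately show ?thesis unfolding e_def by linarith
  qed
  finally have "real n * b \<le> real n * \<epsilon>" by simp
  then show "b \<le> 0 + \<epsilon>" using n0 by simp
qed

text \<open>A walk that never returns from \<open>i\<close> takes a step \<open>-1\<close> first and
  has nonpositive sums afterwards, up to every horizon; its probability is therefore below all
  \<open>descent_prob n\<close>.\<close>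

lemma AE_returns: "AE \<omega> in M. \<forall>i. \<exists>j>i. 0 \<le> (\<Sum>l\<in>{i..<j}. X l \<omega>)"
proof (subst AE_all_countable, rule allI)
  fix i
  let ?N = "{\<omega> \<in> space M. \<not> (\<exists>j>i. 0 \<le> (\<Sum>l\<in>{i..<j}. X l \<omega>))}"
  have P: "{\<omega> \<in> space M. 0 \<le> (\<Sum>l\<in>{i..<j}. X l \<omega>)} \<in> events" for j
  proof -
    have "{\<omega> \<in> space M. 0 \<le> (\<Sum>l\<in>{i..<j}. X l \<omega>)} = (\<lambda>\<omega>. \<Sum>l\<in>{i..<j}. X l \<omega>) -` {0..} \<inter> space M"
      by auto
    then show ?thesis using measurable_sets[OF measurable_sum_count_space[of "{i..<j}" X M, OF _ rv], of "{0..}"] by simp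
  qed
  have N: "?N \<in> events"
  proof -
    have "?N = space M - (\<Union>j\<in>{i<..}. {\<omega> \<in> space M. 0 \<le> (\<Sum>l\<in>{i..<j}. X l \<omega>)})" by auto
    also have "\<dots> \<in> events" using P by (intro sets.compl_sets sets.countable_UN') auto
    finally show ?thesis .
  qed
  have "prob ?N \<le> descent_prob n" for n
  proof -
    have "?N \<subseteq> {\<omega> \<in> space M. X i \<omega> = -1 \<and> future_max (\<lambda>l. X l \<omega>) n (i + 1) = 0}"
    proof
      fix \<omega> assume w: "\<omega> \<in> ?N"
      then have neg: "(\<Sum>l\<in>{i..<j}. X l \<omega>) < 0" if "i < j" for j using that by force
      have "X i \<omega> < 0" using neg[of "i + 1"] by (simp add: sum_int_atLeastLessThan_head)
      then have Xi: "X i \<omega> = -1" using skip_free[of \<omega> i] w by auto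
      have "future_max (\<lambda>l. X l \<omega>) n (i + 1) \<le> 0"
      proof (rule future_max_le)
        fix j assume "i + 1 < j"
        then show "(\<Sum>l\<in>{i+1..<j}. X l \<omega>) \<le> 0"
          using neg[of j] Xi sum_int_atLeastLessThan_head[of i j "\<lambda>l. X l \<omega>"] by simp
      qed simp
      then show "\<omega> \<in> {\<omega> \<in> space M. X i \<omega> = -1 \<and> future_max (\<lambda>l. X l \<omega>) n (i + 1) = 0}"
        using w Xi future_max_nonneg[of "\<lambda>l. X l \<omega>" n "i + 1"] by auto
    qed
    moreover have "{\<omega> \<in> space M. X i \<omega> = -1 \<and> future_max (\<lambda>l. X l \<omega>) n (i + 1) = 0} \<in> events"
      using measurable_future_max_X[of "\<lambda>a. a" n "i + 1"] by measurable
    ultimately show ?thesis unfolding descent_prob[of i, symmetric] by (intro finite_measure_mono)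
  qed
  then have "prob ?N \<le> 0" by (rule descent_prob_lower_bound)
  then have "prob ?N = 0" using measure_nonneg[of M ?N] by linarith
  then show "AE \<omega> in M. \<exists>j>i. 0 \<le> (\<Sum>l\<in>{i..<j}. X l \<omega>)"
    using N by (intro AE_I[of _ _ ?N]) (auto simp: emeasure_eq_measure)
qed

end

section \<open>Weak convergence on sequence space\<close>

definition window_determined :: "nat \<Rightarrow> (int \<Rightarrow> int) set \<Rightarrow> bool" where
  "window_determined r A \<longleftrightarrow> (\<forall>x y. (\<forall>i. - int r \<le> i \<longrightarrow> i < int r \<longrightarrow> x i = y i) \<longrightarrow> x \<in> A \<longrightarrow> y \<in> A)"

text \<open>With a second countable factor, the Borel sets of the product topology are those of the
  product sigma-algebra, on which coordinates are handled.\<close>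

instance int :: second_countable_topology
proof
  show "\<exists>B::int set set. countable B \<and> open = generate_topology B"
    by (intro exI[of _ "range lessThan \<union> range greaterThan"]) (auto simp: open_int_def)
qed

lemma sets_borel_int_fun: "sets (borel :: (int \<Rightarrow> int) measure) = sets (PiM UNIV (\<lambda>_. count_space UNIV))"
proof -
  have "sets (borel :: (int \<Rightarrow> int) measure) = sets (PiM UNIV (\<lambda>_. borel))"
    by (rule sets_PiM_equal_borel[symmetric])
  also have "\<dots> = sets (PiM UNIV (\<lambda>_. count_space UNIV))"
    by (rule sets_PiM_cong) (simp_all add: sets_borel_eq_count_space)
  finally show ?thesis .
qed

lemma measurable_coordinate: "(\<lambda>x. x i) \<in> measurable (borel :: (int \<Rightarrow> int) measure) (count_space UNIV)"
proof -
  have "(\<lambda>x. x i) \<in> measurable (PiM UNIV (\<lambda>_. count_space UNIV) :: (int \<Rightarrow> int) measure) (count_space UNIV)"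
    by (rule measurable_component_singleton) simp
  then show ?thesis using measurable_cong_sets[OF sets_borel_int_fun refl] by blast
qed

lemma measurable_borel_int_funI:
  assumes "\<And>i. (\<lambda>\<omega>. f \<omega> i) \<in> measurable M (count_space UNIV)"
  shows "f \<in> measurable M (borel :: (int \<Rightarrow> int) measure)"
proof -
  have "(\<lambda>\<omega>. \<lambda>i\<in>UNIV. f \<omega> i) \<in> measurable M (PiM UNIV (\<lambda>_. count_space UNIV))"
    by (rule measurable_restrict) (rule assms)
  then show ?thesis using measurable_cong_sets[OF refl sets_borel_int_fun, of M] by (simp add: restrict_def)
qed

text \<open>A window takes countably many values, so the set is a countable union of
  cylinders.\<close>

lemma window_determined_sets:
  assumes "window_determined r A" shows "A \<in> sets borel"
proof -
  define w where "w x = map x [- int r..int r - 1]" for x :: "int \<Rightarrow> int"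
  have w: "w x = w y \<longleftrightarrow> (\<forall>i. - int r \<le> i \<longrightarrow> i < int r \<longrightarrow> x i = y i)" for x y
    by (auto simp: w_def)
  have "A = (\<Union>l\<in>w ` A. {x. w x = l})"
  proof (intro equalityI subsetI)
    fix x assume "x \<in> (\<Union>l\<in>w ` A. {x. w x = l})"
    then obtain y where "y \<in> A" "w y = w x" by auto
    then show "x \<in> A" using assms unfolding window_determined_def w by metis
  qed auto
  moreover have "{x. w x = w y} \<in> sets borel" for y
  proof -
    have "{x \<in> space borel. \<forall>i\<in>{- int r..<int r}. x i = y i} \<in> sets borel"
    proof (rule sets.sets_Collect_finite_All)
      fix i
      have "(\<lambda>x. x i) -` {y i} \<inter> space borel \<in> sets (borel :: (int \<Rightarrow> int) measure)"
        by (rule measurable_sets[OF measurable_coordinate]) simp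
      then show "{x \<in> space borel. x i = y i} \<in> sets (borel :: (int \<Rightarrow> int) measure)"
        by (simp add: vimage_def)
    qed simp
    moreover have "{x \<in> space borel. \<forall>i\<in>{- int r..<int r}. x i = y i} = {x. w x = w y}"
      by (auto simp: w)
    ultimately show ?thesis by (simp only:)
  qed
  ultimately show ?thesis
    using sets.countable_UN'[of "w ` A" "\<lambda>l. {x. w x = l}" borel] by auto
qed

lemma open_contains_window:
  fixes U :: "(int \<Rightarrow> int) set"
  assumes "open U" "x \<in> U"
  shows "\<exists>r. \<forall>y. (\<forall>i. - int r \<le> i \<longrightarrow> i < int r \<longrightarrow> y i = x i) \<longrightarrow> y \<in> U"
proof -
  have "openin (product_topology (\<lambda>_. euclidean) UNIV) U" using assms(1) by (simp add: open_fun_def)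
  from product_topology_open_contains_basis[OF this assms(2)] obtain B where
    B: "x \<in> (\<Pi>\<^sub>E i\<in>UNIV. B i)" "finite {i. B i \<noteq> topspace (euclidean :: int topology)}" "(\<Pi>\<^sub>E i\<in>UNIV. B i) \<subseteq> U"
    by auto
  have "finite ((\<lambda>i. nat (\<bar>i\<bar> + 1)) ` {i. B i \<noteq> UNIV})" using B(2) by simp
  then obtain r where r: "\<And>i. B i \<noteq> UNIV \<Longrightarrow> nat (\<bar>i\<bar> + 1) \<le> r"
    unfolding finite_nat_set_iff_bounded_le by blast
  have "y \<in> U" if y: "\<forall>i. - int r \<le> i \<longrightarrow> i < int r \<longrightarrow> y i = x i" for y
  proof -
    have "y i \<in> B i" for i
    proof (cases "B i = UNIV")
      case False
      then have "- int r \<le> i" "i < int r" using r[OF False] by auto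
      then show ?thesis using y B(1) by auto
    qed simp
    then show ?thesis using B(3) by auto
  qed
  then show ?thesis by blast
qed

text \<open>For \<open>f\<close> bounded below, the largest minorant that depends on the window
  only.\<close>

definition window_inf :: "((int \<Rightarrow> int) \<Rightarrow> real) \<Rightarrow> nat \<Rightarrow> (int \<Rightarrow> int) \<Rightarrow> real" where
  "window_inf f r x = Inf (f ` {y. \<forall>i. - int r \<le> i \<longrightarrow> i < int r \<longrightarrow> y i = x i})"

lemma window_inf_le:
  assumes "\<And>y. c \<le> f y" shows "window_inf f r x \<le> f x"
  unfolding window_inf_def by (rule cINF_lower) (auto intro: bdd_belowI2 assms)

lemma window_inf_ge:
  assumes "\<And>y. (\<forall>i. - int r \<le> i \<longrightarrow> i < int r \<longrightarrow> y i = x i) \<Longrightarrow> c \<le> f y"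
  shows "c \<le> window_inf f r x"
  unfolding window_inf_def by (rule cINF_greatest) (use assms in auto)

lemma window_inf_determined: "window_determined r (window_inf f r -` B)"
  unfolding window_determined_def
proof (intro allI impI)
  fix x y :: "int \<Rightarrow> int" assume "\<forall>i. - int r \<le> i \<longrightarrow> i < int r \<longrightarrow> x i = y i" "x \<in> window_inf f r -` B"
  then show "y \<in> window_inf f r -` B" by (simp add: window_inf_def cong: conj_cong imp_cong)
qed

lemma measurable_window_inf: "window_inf f r \<in> borel_measurable borel"
  by (rule measurableI) (auto intro!: window_determined_sets window_inf_determined)

text \<open>Continuity provides a cylinder around \<open>x\<close> on which \<open>f\<close> exceeds
  any prescribed level below \<open>f x\<close>.\<close>

lemma window_inf_tendsto:
  assumes "continuous_on UNIV f" "\<And>y. c \<le> f y"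
  shows "(\<lambda>r. window_inf f r x) \<longlonglongrightarrow> f x"
proof (rule order_tendstoI)
  fix a assume "a < f x"
  define b where "b = (a + f x) / 2"
  have b: "a < b" "b < f x" using \<open>a < f x\<close> by (auto simp: b_def)
  have "open {y. b < f y}" using open_Collect_less[OF continuous_on_const assms(1)] .
  from open_contains_window[OF this, of x] b obtain r where
    r: "\<And>y. (\<forall>i. - int r \<le> i \<longrightarrow> i < int r \<longrightarrow> y i = x i) \<Longrightarrow> b < f y" by auto
  have "b \<le> window_inf f s x" if "r \<le> s" for s
    using r that by (intro window_inf_ge) (auto intro!: less_imp_le)
  then show "eventually (\<lambda>s. a < window_inf f s x) sequentially"
    using b by (intro eventually_mono[OF eventually_ge_at_top[of r]]) (auto intro: less_le_trans)
next
  fix a assume "f x < a"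
  then show "eventually (\<lambda>s. window_inf f s x < a) sequentially"
    using window_inf_le[of c f, OF assms(2)] by (auto intro: le_less_trans always_eventually)
qed

text \<open>A bounded continuous function is the limit from below of functions of finitely many
  coordinates, and so is its negative.\<close>

lemma weak_limit_windows:
  fixes N :: "nat \<Rightarrow> (int \<Rightarrow> int) measure"
  assumes N: "\<And>n. prob_space (N n)" "\<And>n. sets (N n) = sets borel"
    and L: "prob_space L" "sets L = sets borel"
    and eq: "\<And>n r A. r \<le> n \<Longrightarrow> window_determined r A \<Longrightarrow> emeasure (N n) A = emeasure L A"
  shows "is_weak_limit N L"
  unfolding is_weak_limit_def
proof (intro conjI allI impI)
  fix f :: "(int \<Rightarrow> int) \<Rightarrow> real" assume f: "continuous_on UNIV f" "bounded (range f)"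
  have meas: "g \<in> borel_measurable P" if "g \<in> borel_measurable borel" "sets P = sets borel"
    for g :: "(int \<Rightarrow> int) \<Rightarrow> real" and P
    using that measurable_cong_sets[of P borel borel borel] by simp
  \<comment> \<open>A one-sided bound, to be applied to \<open>f\<close> and to its negative: a
    window minorant whose mean under \<open>L\<close> is close to that of \<open>f\<close> has the
    same mean under \<open>N n\<close> as soon as \<open>n\<close> is at least its radius.\<close>
  have lower: "eventually (\<lambda>n. integral\<^sup>L L f - e < integral\<^sup>L (N n) f) sequentially"
    if f: "continuous_on UNIV f" "bounded (range f)" and e: "0 < e" for f :: "(int \<Rightarrow> int) \<Rightarrow> real" and e
  proof -
    obtain B where B: "\<bar>f x\<bar> \<le> B" for x using f(2) by (auto simp: bounded_iff)
    have le: "window_inf f r x \<le> f x" for r x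
      by (rule window_inf_le[of "- B"]) (use B in \<open>auto simp: abs_le_iff minus_le_iff\<close>)
    have ge: "- B \<le> window_inf f r x" for r x
      by (rule window_inf_ge) (use B in \<open>auto simp: abs_le_iff minus_le_iff\<close>)
    have wB: "\<bar>window_inf f r x\<bar> \<le> B" for r x
      using le[of r x] ge[of r x] B[of x] by auto
    have fm: "f \<in> borel_measurable borel" using f(1) by (rule borel_measurable_continuous_onI)
    have int: "integrable P f" "integrable P (window_inf f r)"
      if "prob_space P" "sets P = sets borel" for P r
    proof -
      interpret P: prob_space P by fact
      show "integrable P f" by (rule P.integrable_const_bound[of _ B]) (use B meas[OF fm that(2)] in auto)
      show "integrable P (window_inf f r)"
        by (rule P.integrable_const_bound[of _ B]) (use wB meas[OF measurable_window_inf that(2)] in auto)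
    qed
    interpret L: prob_space L by fact
    have "(\<lambda>r. integral\<^sup>L L (window_inf f r)) \<longlonglongrightarrow> integral\<^sup>L L f"
    proof (rule integral_dominated_convergence[where w="\<lambda>_. B"])
      show "f \<in> borel_measurable L" by (rule meas[OF fm L(2)])
      show "window_inf f r \<in> borel_measurable L" for r by (rule meas[OF measurable_window_inf L(2)])
      show "AE x in L. (\<lambda>r. window_inf f r x) \<longlonglongrightarrow> f x"
        using window_inf_tendsto[OF f(1), of "- B"] B by (auto simp: abs_le_iff minus_le_iff)
      show "AE x in L. norm (window_inf f r x) \<le> B" for r using wB by simp
    qed simp
    then have "eventually (\<lambda>r. integral\<^sup>L L f - e < integral\<^sup>L L (window_inf f r)) sequentially"
      using e by (intro order_tendstoD) auto
    then obtain r where r: "integral\<^sup>L L f - e < integral\<^sup>L L (window_inf f r)"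
      using eventually_happens by fastforce
    have "integral\<^sup>L L f - e < integral\<^sup>L (N n) f" if n: "r \<le> n" for n
    proof -
      have "distr (N n) borel (window_inf f r) = distr L borel (window_inf f r)"
      proof (rule measure_eqI)
        fix C assume "C \<in> sets (distr (N n) borel (window_inf f r))"
        then have C: "C \<in> sets borel" by simp
        have sp: "space (N n) = UNIV" "space L = UNIV"
          using sets_eq_imp_space_eq[OF N(2)] sets_eq_imp_space_eq[OF L(2)] by auto
        show "emeasure (distr (N n) borel (window_inf f r)) C = emeasure (distr L borel (window_inf f r)) C"
          using C meas[OF measurable_window_inf N(2)] meas[OF measurable_window_inf L(2)]
            eq[OF n window_inf_determined]
          by (simp add: emeasure_distr sp)
      qed simp
      moreover have "(\<integral>x. x \<partial>distr P borel (window_inf f r)) = integral\<^sup>L P (window_inf f r)"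
        if "sets P = sets borel" for P
        by (rule integral_distr[OF meas[OF measurable_window_inf that]]) simp
      ultimately have "integral\<^sup>L (N n) (window_inf f r) = integral\<^sup>L L (window_inf f r)"
        using N(2) L(2) by metis
      moreover have "integral\<^sup>L (N n) (window_inf f r) \<le> integral\<^sup>L (N n) f"
        using int[OF N] le by (intro integral_mono) auto
      ultimately show ?thesis using r by simp
    qed
    then show ?thesis by (intro eventually_mono[OF eventually_ge_at_top[of r]])
  qed
  show "(\<lambda>n. integral\<^sup>L (N n) f) \<longlonglongrightarrow> integral\<^sup>L L f"
  proof (rule order_tendstoI)
    fix a assume "a < integral\<^sup>L L f"
    then show "eventually (\<lambda>n. a < integral\<^sup>L (N n) f) sequentially"
      using lower[OF f, of "integral\<^sup>L L f - a"] by simp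
  next
    fix a assume a: "integral\<^sup>L L f < a"
    have "continuous_on UNIV (\<lambda>x. - f x)" "bounded (range (\<lambda>x. - f x))"
      using f by (auto intro: continuous_on_minus simp: bounded_iff)
    from lower[OF this, of "a - integral\<^sup>L L f"] a
    show "eventually (\<lambda>n. integral\<^sup>L (N n) f < a) sequentially" by simp
  qed
qed (use L in auto)

section \<open>Records of the walk and the theorem\<close>

lemma record_map_eqI:
  assumes "i < j" "0 \<le> (\<Sum>l\<in>{i..<j}. x l)" "\<And>k. i < k \<Longrightarrow> k < j \<Longrightarrow> (\<Sum>l\<in>{i..<k}. x l) < 0"
  shows "record_map x i = j"
proof -
  let ?J = "{j. i < j \<and> 0 \<le> (\<Sum>l\<in>{i..<j}. x l)}"
  have "j \<in> ?J" using assms by simp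
  moreover have "j \<le> k" if "k \<in> ?J" for k using that assms(3)[of k] by force
  ultimately have "Inf ?J = j" by (intro cInf_eq_minimum) auto
  then show ?thesis using \<open>j \<in> ?J\<close> unfolding record_map_def Let_def by auto
qed

lemma record_map_first_return:
  assumes "\<exists>j>i. 0 \<le> (\<Sum>l\<in>{i..<j}. x l)"
  obtains d where "record_map x i = i + int (Suc d)" "0 \<le> (\<Sum>l\<in>{i..<i + int (Suc d)}. x l)"
    "\<forall>k. 0 < k \<longrightarrow> k < Suc d \<longrightarrow> (\<Sum>l\<in>{i..<i + int k}. x l) < 0"
proof -
  define P where "P d \<longleftrightarrow> 0 \<le> (\<Sum>l\<in>{i..<i + int (Suc d)}. x l)" for d
  from assms obtain j where j: "i < j" "0 \<le> (\<Sum>l\<in>{i..<j}. x l)" by blast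
  then have "j = i + int (Suc (nat (j - i - 1)))" by simp
  then have "P (nat (j - i - 1))" using j(2) unfolding P_def by metis
  then obtain d where d: "P d" "\<And>e. e < d \<Longrightarrow> \<not> P e" by (metis exists_least_iff)
  have neg: "(\<Sum>l\<in>{i..<i + int k}. x l) < 0" if "0 < k" "k < Suc d" for k
    using d(2)[of "k - 1"] that unfolding P_def by (cases k) auto
  moreover have "record_map x i = i + int (Suc d)"
  proof (rule record_map_eqI)
    fix k assume "i < k" "k < i + int (Suc d)"
    then show "(\<Sum>l\<in>{i..<k}. x l) < 0" using neg[of "nat (k - i)"] by auto
  qed (use d(1) P_def in auto)
  ultimately show ?thesis using that d(1) unfolding P_def by blast
qed

subsection \<open>Records of the walk and the position of the bi-infinite path\<close>

text \<open>Latest step first: an exploration meets the degrees in the reverse order of the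
  walk.\<close>

definition degrees_upto :: "(int \<Rightarrow> int) \<Rightarrow> nat \<Rightarrow> nat list" where
  "degrees_upto x k = rev (map (\<lambda>l. nat (x (int l) + 1)) [0..<k])"

text \<open>\<open>foldr\<close> begins at the end of the list, that is, with the first step of the
  walk; the count of records starts from \<open>m\<close>.\<close>

definition walk_state :: "(int \<Rightarrow> int) \<Rightarrow> int \<Rightarrow> nat \<Rightarrow> nat \<times> int" where
  "walk_state x m k = foldr spine_back (degrees_upto x k) (0, m)"

lemma walk_state_0 [simp]: "walk_state x m 0 = (0, m)"
  by (simp add: walk_state_def degrees_upto_def)

lemma walk_state_Suc: "walk_state x m (Suc k) = spine_back (nat (x (int k) + 1)) (walk_state x m k)"
  by (simp add: walk_state_def degrees_upto_def)

lemma length_degrees_upto [simp]: "length (degrees_upto x k) = k"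
  by (simp add: degrees_upto_def)

lemma nth_degrees_upto: "j < k \<Longrightarrow> degrees_upto x k ! j = nat (x (int (k - 1 - j)) + 1)"
  by (simp add: degrees_upto_def rev_nth)

lemma drop_degrees_upto: "j \<le> k \<Longrightarrow> drop (k - j) (degrees_upto x k) = degrees_upto x j"
  by (simp add: degrees_upto_def drop_rev take_map)

text \<open>The count never decreases, and place zero is reached only through a new record. Hence a
  state \<open>(0, c)\<close> occurs at one time at most.\<close>

lemma walk_state_after:
  assumes "walk_state x m i = (0, c)" "i < k"
  shows "c < snd (walk_state x m k) \<or> (c = snd (walk_state x m k) \<and> 0 < fst (walk_state x m k))"
  using assms(2)
proof (induction k)
  case (Suc k)
  show ?case
  proof (cases "i = k")
    case True
    then show ?thesis using assms(1) by (auto simp: walk_state_Suc spine_back_def)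
  next
    case False
    then show ?thesis using Suc by (auto simp: walk_state_Suc spine_back_def)
  qed
qed simp

lemma walk_state_unique:
  assumes "walk_state x m i = (0, c)" "walk_state x m k = (0, c)" shows "i = k"
  using walk_state_after[OF assms(1), of k] walk_state_after[OF assms(2), of i] assms
  by (cases i k rule: linorder_cases) auto

text \<open>There is at most one record per step; this makes the segment between records long enough
  to contain the window.\<close>

lemma walk_state_count_le: "snd (walk_state x m (i + k)) \<le> snd (walk_state x m i) + int k"
  by (induction k) (auto simp: walk_state_Suc spine_back_def)

text \<open>Until the next record the first component is minus the sum since time \<open>i\<close>.
  From such a deficit \<open>D\<close>, a step \<open>x\<close> is counted iff
  \<open>D < x + 1\<close>, which over the integers is the weak inequality in
  \<open>record_map\<close>.\<close>

lemma walk_state_record: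
  assumes ge: "\<And>l. -1 \<le> x l" and ret: "\<exists>j>int i. 0 \<le> (\<Sum>l\<in>{int i..<j}. x l)"
    and st: "walk_state x m i = (0, c)"
  shows "\<exists>j. record_map x (int i) = int j \<and> walk_state x m j = (0, c + 1)"
proof -
  obtain d where d: "record_map x (int i) = int i + int (Suc d)"
    "0 \<le> (\<Sum>l\<in>{int i..<int i + int (Suc d)}. x l)"
    "\<forall>k. 0 < k \<longrightarrow> k < Suc d \<longrightarrow> (\<Sum>l\<in>{int i..<int i + int k}. x l) < 0"
    by (rule record_map_first_return[OF ret])
  have sumS: "(\<Sum>l\<in>{int i..<int i + int (Suc k)}. x l) = (\<Sum>l\<in>{int i..<int i + int k}. x l) + x (int i + int k)" for k
  proof -
    have "{int i..<int i + int (Suc k)} = insert (int i + int k) {int i..<int i + int k}" by auto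
    then show ?thesis by simp
  qed
  have below: "walk_state x m (i + k) = (nat (- (\<Sum>l\<in>{int i..<int i + int k}. x l)), c)" if "k \<le> d" for k
    using that
  proof (induction k)
    case (Suc k)
    then have IH: "walk_state x m (i + k) = (nat (- (\<Sum>l\<in>{int i..<int i + int k}. x l)), c)" by simp
    have "(\<Sum>l\<in>{int i..<int i + int (Suc k)}. x l) < 0" using d(3)[rule_format, of "Suc k"] Suc.prems by simp
    moreover have "(\<Sum>l\<in>{int i..<int i + int k}. x l) \<le> 0"
      using d(3)[rule_format, of k] Suc.prems by (cases "k = 0") (auto intro: less_imp_le)
    ultimately show ?case
      using IH ge[of "int i + int k"] unfolding sumS by (simp add: walk_state_Suc spine_back_def nat_less_iff)
  qed (use st in simp)
  have "(\<Sum>l\<in>{int i..<int i + int d}. x l) \<le> 0"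
    using d(3)[rule_format, of d] by (cases "d = 0") (auto intro: less_imp_le)
  then have "walk_state x m (i + Suc d) = (0, c + 1)"
    using below[of d] d(2) ge[of "int i + int d"] unfolding sumS
    by (simp add: walk_state_Suc spine_back_def)
  then show ?thesis using d(1) by (intro exI[of _ "i + Suc d"]) simp
qed

lemma walk_state_records:
  assumes ge: "\<And>l. -1 \<le> x l" and ret: "\<And>i. \<exists>j>i. 0 \<le> (\<Sum>l\<in>{i..<j}. x l)"
  shows "\<exists>t. (record_map x ^^ c) 0 = int t \<and> walk_state x m t = (0, m + int c)"
proof (induction c)
  case (Suc c)
  then obtain t where t: "(record_map x ^^ c) 0 = int t" "walk_state x m t = (0, m + int c)" by blast
  then show ?case using walk_state_record[OF ge ret t(2)] by (auto simp: algebra_simps)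
qed (auto intro: exI[of _ 0])

subsection \<open>Comparison of the walk with the tree\<close>

context skip_free_walk
begin

text \<open>The list is reversed so that the same \<open>ds\<close> can be used for an exploration
  of the tree.\<close>

definition walk_block :: "nat list \<Rightarrow> 'w set" where
  "walk_block ds = {\<omega> \<in> space M. \<forall>k<length ds. X (int k) \<omega> + 1 = int (rev ds ! k)}"

lemma walk_block_sets: "walk_block ds \<in> events"
proof -
  have "{\<omega> \<in> space M. X (int k) \<omega> + 1 = int (rev ds ! k)} \<in> events" for k
    by measurable
  then have "{\<omega> \<in> space M. \<forall>k\<in>{..<length ds}. X (int k) \<omega> + 1 = int (rev ds ! k)} \<in> events"
    by (intro sets.sets_Collect_finite_All) auto
  then show ?thesis by (simp add: walk_block_def)
qed

lemma prob_walk_block: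
  assumes \<pi>: "distr M (count_space UNIV) (\<lambda>\<omega>. X 0 \<omega> + 1) = measure_pmf (map_pmf int \<pi>)"
  shows "prob (walk_block ds) = (\<Prod>d\<leftarrow>ds. pmf \<pi> d)"
proof -
  have single: "prob (X i -` {int d - 1} \<inter> space M) = pmf \<pi> d" for i d
  proof -
    have "prob (X i -` {int d - 1} \<inter> space M) = measure (distr M (count_space UNIV) (X i)) {int d - 1}"
      by (simp add: measure_distr)
    also have "\<dots> = measure (distr M (count_space UNIV) (X 0)) {int d - 1}" using ident[of i] by simp
    also have "\<dots> = prob ((\<lambda>\<omega>. X 0 \<omega> + 1) -` {int d} \<inter> space M)"
      by (simp add: measure_distr) (rule arg_cong[where f=prob], auto)
    also have "\<dots> = measure (distr M (count_space UNIV) (\<lambda>\<omega>. X 0 \<omega> + 1)) {int d}"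
      by (rule measure_distr[symmetric]) (auto intro: measurable_compose[OF rv])
    also have "\<dots> = pmf (map_pmf int \<pi>) (int d)" unfolding \<pi> by (simp add: pmf.rep_eq)
    also have "\<dots> = pmf \<pi> d" by (rule pmf_map_inj') simp
    finally show ?thesis .
  qed
  show ?thesis
  proof (cases "ds = []")
    case True
    then show ?thesis by (simp add: walk_block_def prob_space)
  next
    case False
    let ?J = "int ` {..<length ds}"
    let ?A = "\<lambda>j. {int (rev ds ! nat j) - 1}"
    have "walk_block ds = (\<Inter>j\<in>?J. X j -` ?A j \<inter> space M)"
      using False by (auto simp: walk_block_def)
    also have "prob \<dots> = (\<Prod>j\<in>?J. prob (X j -` ?A j \<inter> space M))"
      by (rule indep_varsD[OF indep]) (use False in \<open>auto simp: lessThan_empty_iff\<close>)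
    also have "\<dots> = (\<Prod>j\<in>?J. pmf \<pi> (rev ds ! nat j))" using single by simp
    also have "\<dots> = (\<Prod>k<length ds. pmf \<pi> (rev ds ! k))" by (simp add: prod.reindex)
    also have "\<dots> = prod_list (map (pmf \<pi>) (rev ds))"
      by (simp add: prod.list_conv_set_nth lessThan_atLeast0)
    also have "\<dots> = (\<Prod>d\<leftarrow>ds. pmf \<pi> d)" by (simp add: prod_list.rev rev_map flip: rev_map)
    finally show ?thesis .
  qed
qed

lemma walk_block_degrees_upto:
  assumes "\<omega> \<in> space M" shows "\<omega> \<in> walk_block (degrees_upto (\<lambda>l. X l \<omega>) k)"
  using assms skip_free[OF assms] by (auto simp: walk_block_def degrees_upto_def) (smt (verit) nat_0_le)

lemma walk_block_eq_degrees_upto: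
  assumes "\<omega> \<in> walk_block ds" shows "ds = degrees_upto (\<lambda>l. X l \<omega>) (length ds)"
proof -
  have "rev ds = map (\<lambda>l. nat (X (int l) \<omega> + 1)) [0..<length ds]"
    using assms by (intro nth_equalityI) (auto simp: walk_block_def)
  then show ?thesis unfolding degrees_upto_def by (metis rev_rev_ident)
qed

text \<open>An iterate evaluates a random map at a random index; the index has countably many
  values, so measurability for each fixed index suffices.\<close>

lemma measurable_iterated_record:
  "(\<lambda>\<omega>. (record_map (\<lambda>i. X i \<omega>) ^^ n) 0) \<in> measurable M (count_space UNIV)"
proof -
  have rec: "(\<lambda>\<omega>. record_map (\<lambda>i. X i \<omega>) i) \<in> measurable M (count_space UNIV)" for i
  proof -
    have S: "(\<lambda>\<omega>. \<Sum>l\<in>{i..<j}. X l \<omega>) \<in> measurable M (count_space UNIV)" for j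
      by (rule measurable_sum_count_space[OF _ rv]) simp
    have P[measurable]: "Measurable.pred M (\<lambda>\<omega>. 0 \<le> (\<Sum>l\<in>{i..<j}. X l \<omega>))" for j
      by (rule measurable_compose[OF S]) simp
    \<comment> \<open>The default value \<open>i\<close> is separated from the genuine first return,
      so that the event becomes a countable combination of conditions on partial sums.\<close>
    have iff: "record_map (\<lambda>i. X i \<omega>) i = j \<longleftrightarrow>
       (if \<exists>k\<in>{i<..}. 0 \<le> (\<Sum>l\<in>{i..<k}. X l \<omega>)
        then i < j \<and> 0 \<le> (\<Sum>l\<in>{i..<j}. X l \<omega>) \<and> (\<forall>k\<in>{i<..<j}. \<not> 0 \<le> (\<Sum>l\<in>{i..<k}. X l \<omega>))
        else j = i)" for \<omega> j
    proof (cases "\<exists>k>i. 0 \<le> (\<Sum>l\<in>{i..<k}. X l \<omega>)")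
      case True
      then obtain d where d: "record_map (\<lambda>i. X i \<omega>) i = i + int (Suc d)"
        "0 \<le> (\<Sum>l\<in>{i..<i + int (Suc d)}. X l \<omega>)"
        "\<forall>k. 0 < k \<longrightarrow> k < Suc d \<longrightarrow> (\<Sum>l\<in>{i..<i + int k}. X l \<omega>) < 0"
        by (rule record_map_first_return)
      have "(\<Sum>l\<in>{i..<k}. X l \<omega>) < 0" if "i < k" "k < i + int (Suc d)" for k
        using d(3)[rule_format, of "nat (k - i)"] that by auto
      then have "record_map (\<lambda>i. X i \<omega>) i = j \<Longrightarrow> i < j \<and> 0 \<le> (\<Sum>l\<in>{i..<j}. X l \<omega>) \<and>
          (\<forall>k\<in>{i<..<j}. \<not> 0 \<le> (\<Sum>l\<in>{i..<k}. X l \<omega>))"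
        using d(1,2) by (auto simp: not_le)
      moreover have "i < j \<and> 0 \<le> (\<Sum>l\<in>{i..<j}. X l \<omega>) \<and>
          (\<forall>k\<in>{i<..<j}. \<not> 0 \<le> (\<Sum>l\<in>{i..<k}. X l \<omega>)) \<Longrightarrow> record_map (\<lambda>i. X i \<omega>) i = j"
        by (intro record_map_eqI) (auto simp: not_le)
      ultimately have "record_map (\<lambda>i. X i \<omega>) i = j \<longleftrightarrow> i < j \<and> 0 \<le> (\<Sum>l\<in>{i..<j}. X l \<omega>) \<and>
          (\<forall>k\<in>{i<..<j}. \<not> 0 \<le> (\<Sum>l\<in>{i..<k}. X l \<omega>))" by (rule iffI)
      moreover have ex: "\<exists>k\<in>{i<..}. 0 \<le> (\<Sum>l\<in>{i..<k}. X l \<omega>)" using True by auto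
      ultimately show ?thesis unfolding if_P[OF ex] by simp
    next
      case False
      then have ex: "\<not> (\<exists>k\<in>{i<..}. 0 \<le> (\<Sum>l\<in>{i..<k}. X l \<omega>))" by auto
      from False have "record_map (\<lambda>i. X i \<omega>) i = i" by (simp add: record_map_def)
      then show ?thesis unfolding if_not_P[OF ex] by auto
    qed
    have "{\<omega> \<in> space M. record_map (\<lambda>i. X i \<omega>) i = j} \<in> events" for j
      unfolding iff by measurable
    then have "(\<lambda>\<omega>. record_map (\<lambda>i. X i \<omega>) i) -` {j} \<inter> space M \<in> events" for j
      by (simp add: vimage_def Int_def conj_commute)
    then show ?thesis
      by (intro measurable_count_space_eq2_countable[THEN iffD2]) auto
  qed
  show ?thesis
  proof (induction n)
    case (Suc n)
    show ?case using measurable_compose_countable[OF rec Suc] by simp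
  qed simp
qed

lemma measurable_rooted_record:
  "(\<lambda>\<omega>. rooted_line ((record_map (\<lambda>i. X i \<omega>) ^^ n) 0) (\<lambda>i. X i \<omega>)) \<in> measurable M borel"
proof (rule measurable_borel_int_funI)
  fix i
  show "(\<lambda>\<omega>. rooted_line ((record_map (\<lambda>i. X i \<omega>) ^^ n) 0) (\<lambda>i. X i \<omega>) i) \<in> measurable M (count_space UNIV)"
    unfolding rooted_line_def
    using measurable_compose_countable[OF rv measurable_iterated_record, of "\<lambda>j. i + j" n]
      measurable_compose_countable[of "\<lambda>j. X (i + j)" M "count_space UNIV", OF rv measurable_iterated_record]
    by simp
qed

end

lemma window_determined_Compl: "window_determined r A \<Longrightarrow> window_determined r (- A)"
  unfolding window_determined_def by (metis ComplD ComplI)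

locale critical_walk = skip_free_walk M X + critical_offspring \<pi>
  for M :: "'w measure" and X :: "int \<Rightarrow> 'w \<Rightarrow> int" and \<pi> :: "nat pmf" +
  assumes offspring_law: "distr M (count_space UNIV) (\<lambda>\<omega>. X 0 \<omega> + 1) = measure_pmf (map_pmf int \<pi>)"
begin

abbreviation record_view :: "nat \<Rightarrow> 'w \<Rightarrow> int \<Rightarrow> int" where
  "record_view n \<omega> \<equiv> rooted_line ((record_map (\<lambda>i. X i \<omega>) ^^ n) 0) (\<lambda>i. X i \<omega>)"

lemma measurable_backward_sequence:
  "(\<lambda>\<omega>. backward_sequence (kesten_tree \<omega>)) \<in> measurable (kesten_space \<pi>) borel"
proof -
  have "(\<lambda>\<omega>. Phi_R (tree_class (kesten_tree \<omega>))) \<in> measurable (kesten_space \<pi>) borel"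
    by (rule measurable_compose[OF measurable_tree_class_kesten_tree])
       (auto intro: kesten_support_valid measurable_borel_int_funI measurable_Phi_R_coordinate)
  then show ?thesis
  proof (rule measurable_cong[THEN iffD1, rotated])
    fix \<omega> assume "\<omega> \<in> space (kesten_space \<pi>)"
    then have "valid_offspring \<omega>" using kesten_support_valid by (simp add: space_kesten_space)
    then show "Phi_R (tree_class (kesten_tree \<omega>)) = backward_sequence (kesten_tree \<omega>)"
      using Phi_R_tree_class ordered_family_tree_kesten_tree by blast
  qed
qed

lemma distr_EKT_Phi_R:
  "distr (EKT \<pi>) borel Phi_R = distr (kesten_space \<pi>) borel (\<lambda>\<omega>. backward_sequence (kesten_tree \<omega>))"
proof -
  have "distr (EKT \<pi>) borel Phi_R = distr (kesten_space \<pi>) borel (Phi_R \<circ> (\<lambda>\<omega>. tree_class (kesten_tree \<omega>)))"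
    unfolding EKT_def
    by (intro distr_distr measurable_tree_class_kesten_tree)
       (auto intro: kesten_support_valid measurable_borel_int_funI measurable_Phi_R_coordinate)
  also have "\<dots> = distr (kesten_space \<pi>) borel (\<lambda>\<omega>. backward_sequence (kesten_tree \<omega>))"
    using kesten_support_valid Phi_R_tree_class ordered_family_tree_kesten_tree
    by (intro distr_cong) (auto simp: space_kesten_space)
  finally show ?thesis .
qed

text \<open>Both sides are sums over the offspring sequences of the segment between the path vertices
  \<open>o_{-n}\<close> and \<open>o_r\<close>, that is, between the records number \<open>0\<close> and \<open>n + r\<close> of the walk.\<close>

lemma record_view_le_EKT:
  assumes r: "r \<le> n" and A: "window_determined r A"
  shows "emeasure (distr M borel (record_view n)) A \<le> emeasure (distr (EKT \<pi>) borel Phi_R) A"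
proof -
  let ?m = "- int n" and ?N = "int r"
  let ?E = "\<lambda>\<omega>. backward_sequence (kesten_tree \<omega>)"
  \<comment> \<open>One recurrent path with view in \<open>A\<close> is enough to admit a segment,
    because the segment determines the window \<open>[-r, r)\<close> for every path and every tree
    line that has it.\<close>
  define G where "G = {ds. foldr spine_back ds (0, ?m) = (0, ?N) \<and>
    (\<exists>\<omega>\<in>walk_block ds. (\<forall>i. \<exists>j>i. 0 \<le> (\<Sum>l\<in>{i..<j}. X l \<omega>)) \<and> record_view n \<omega> \<in> A)}"
  have As: "A \<in> sets borel" using A by (rule window_determined_sets)
  \<comment> \<open>The state \<open>(0, r)\<close> occurs at one time only, so a path has at most
    one such segment.\<close>
  have disjW: "disjoint_family_on walk_block G"
    unfolding disjoint_family_on_def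
  proof (intro ballI impI)
    fix ds ds' assume d: "ds \<in> G" "ds' \<in> G" "ds \<noteq> ds'"
    have "ds = ds'" if w: "\<omega> \<in> walk_block ds" "\<omega> \<in> walk_block ds'" for \<omega>
    proof -
      let ?x = "\<lambda>l. X l \<omega>"
      note e = walk_block_eq_degrees_upto[OF w(1)] walk_block_eq_degrees_upto[OF w(2)]
      have "walk_state ?x ?m (length ds) = (0, ?N)" "walk_state ?x ?m (length ds') = (0, ?N)"
        using d(1,2) e unfolding G_def walk_state_def by auto
      then have "length ds = length ds'" by (rule walk_state_unique)
      then show ?thesis using e by metis
    qed
    then show "walk_block ds \<inter> walk_block ds' = {}" using d(3) by blast
  qed
  \<comment> \<open>Recurrence gives record number \<open>n + r\<close> almost surely; with the
    count starting at \<open>-n\<close>, the state there is \<open>(0, r)\<close>.\<close>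
  have cover: "AE \<omega> in M. record_view n \<omega> \<in> A \<longrightarrow> \<omega> \<in> (\<Union>ds\<in>G. walk_block ds)"
    using AE_returns AE_space
  proof eventually_elim
    case (elim \<omega>)
    let ?x = "\<lambda>l. X l \<omega>"
    obtain t where t: "walk_state ?x ?m t = (0, ?m + int (n + r))"
      using walk_state_records[of ?x "n + r" ?m] elim skip_free by blast
    let ?ds = "degrees_upto ?x t"
    have w: "\<omega> \<in> walk_block ?ds" using elim(2) by (rule walk_block_degrees_upto)
    show ?case
    proof
      assume "record_view n \<omega> \<in> A"
      then have "?ds \<in> G" using w t elim(1) unfolding G_def walk_state_def by auto
      then show "\<omega> \<in> (\<Union>ds\<in>G. walk_block ds)" using w by blast
    qed
  qed
  have inA: "?E \<omega>' \<in> A" if ds: "ds \<in> G" and w': "\<omega>' \<in> explored ?N ?m ds" for ds \<omega>'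
  proof -
    from ds obtain \<omega> where w: "\<omega> \<in> walk_block ds" "\<And>i. \<exists>j>i. 0 \<le> (\<Sum>l\<in>{i..<j}. X l \<omega>)"
      "record_view n \<omega> \<in> A" and fold: "foldr spine_back ds (0, ?m) = (0, ?N)"
      unfolding G_def by blast
    let ?x = "\<lambda>l. X l \<omega>" and ?M = "length ds"
    have sp: "\<omega> \<in> space M" using w(1) by (simp add: walk_block_def)
    note e = walk_block_eq_degrees_upto[OF w(1)]
    have M: "walk_state ?x ?m ?M = (0, ?N)" using fold e by (simp add: walk_state_def)
    obtain t where t: "(record_map ?x ^^ n) 0 = int t" "walk_state ?x ?m t = (0, 0)"
      using walk_state_records[of ?x n ?m] w(2) skip_free[OF sp] by auto
    have tM: "t \<le> ?M" using walk_state_after[OF M, of t] t(2) by (cases "t \<le> ?M") auto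
    \<comment> \<open>The root is record number \<open>n\<close>, at time \<open>t\<close>; the
      \<open>K\<close> steps of the walk from time \<open>t\<close> on come first in the reversed
      list.\<close>
    define K where "K = ?M - t"
    have K: "K \<le> ?M" by (simp add: K_def)
    have "drop K ds = degrees_upto ?x t" using drop_degrees_upto[OF tM, of ?x] e by (simp add: K_def)
    then have K0: "foldr spine_back (drop K ds) (0, ?m) = (0, 0)" using t(2) by (simp add: walk_state_def)
    \<comment> \<open>With at most one record per step, the \<open>n\<close> records up to time
      \<open>t\<close> and the \<open>r\<close> records after it leave room for the window on both
      sides; on the left this uses \<open>r \<le> n\<close>.\<close>
    have "n \<le> t" using walk_state_count_le[of ?x ?m 0 t] t(2) by simp
    have "r \<le> K" using walk_state_count_le[of ?x ?m t K] t(2) M tM by (simp add: K_def)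
    have "record_view n \<omega> i = ?E \<omega>' i" if i: "- int r \<le> i" "i < int r" for i
    proof -
      define k where "k = nat (int K - 1 - i)"
      have k: "int k = int K - 1 - i" using i \<open>r \<le> K\<close> by (simp add: k_def)
      have kM: "k < ?M" using k i \<open>n \<le> t\<close> r tM K_def by linarith
      have "?E \<omega>' i = int (ds ! k) - 1"
        using backward_sequence_explored[OF w' K K0 kM] k by simp
      also have "ds ! k = nat (X (int (?M - 1 - k)) \<omega> + 1)"
        by (subst e) (rule nth_degrees_upto[OF kM])
      also have "int (?M - 1 - k) = i + int t" using k kM tM by (simp add: K_def of_nat_diff)
      finally show ?thesis
        using skip_free[OF sp, of "i + int t"] t(1) by (simp add: rooted_line_def)
    qed
    then show ?thesis using A w(3) unfolding window_determined_def by blast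
  qed
  have "emeasure (distr M borel (record_view n)) A = emeasure M {\<omega> \<in> space M. record_view n \<omega> \<in> A}"
    using As by (subst emeasure_distr[OF measurable_rooted_record]) (auto intro!: arg_cong[where f="emeasure M"])
  also have "\<dots> \<le> emeasure M (\<Union>ds\<in>G. walk_block ds)"
  proof (rule emeasure_mono_AE)
    show "AE \<omega> in M. \<omega> \<in> {\<omega> \<in> space M. record_view n \<omega> \<in> A} \<longrightarrow> \<omega> \<in> (\<Union>ds\<in>G. walk_block ds)"
      using cover by eventually_elim auto
    show "(\<Union>ds\<in>G. walk_block ds) \<in> events" using walk_block_sets by (intro sets.countable_UN') auto
  qed
  also have "\<dots> = (\<integral>\<^sup>+ds. emeasure M (walk_block ds) \<partial>count_space G)"
    using walk_block_sets disjW by (intro emeasure_UN_countable) auto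
  also have "\<dots> = (\<integral>\<^sup>+ds. emeasure (kesten_space \<pi>) (explored ?N ?m ds) \<partial>count_space G)"
  proof (rule nn_integral_cong)
    fix ds assume "ds \<in> space (count_space G)"
    then have "foldr spine_back ds (0, ?m) = (0, ?N)" by (simp add: G_def)
    then show "emeasure M (walk_block ds) = emeasure (kesten_space \<pi>) (explored ?N ?m ds)"
      using prob_walk_block[OF offspring_law, of ds] by (simp add: emeasure_explored emeasure_eq_measure)
  qed
  also have "\<dots> = emeasure (kesten_space \<pi>) (\<Union>ds\<in>G. explored ?N ?m ds)"
    using explored_sets explored_inj
    by (intro emeasure_UN_countable[symmetric]) (auto simp: disjoint_family_on_def)
  also have "\<dots> \<le> emeasure (kesten_space \<pi>) (?E -` A \<inter> space (kesten_space \<pi>))"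
  proof (rule emeasure_mono)
    show "(\<Union>ds\<in>G. explored ?N ?m ds) \<subseteq> ?E -` A \<inter> space (kesten_space \<pi>)"
      using inA by (auto simp: space_kesten_space explored_def)
    show "?E -` A \<inter> space (kesten_space \<pi>) \<in> sets (kesten_space \<pi>)"
      using measurable_backward_sequence As by (rule measurable_sets)
  qed
  also have "\<dots> = emeasure (distr (EKT \<pi>) borel Phi_R) A"
    using As by (simp add: distr_EKT_Phi_R emeasure_distr[OF measurable_backward_sequence])
  finally show ?thesis .
qed

lemma prob_space_EKT_Phi_R: "prob_space (distr (EKT \<pi>) borel Phi_R)"
  unfolding distr_EKT_Phi_R
  by (rule prob_space.prob_space_distr[OF prob_space_kesten_space measurable_backward_sequence])

lemma prob_space_record_view: "prob_space (distr M borel (record_view n))"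
  by (rule prob_space_distr[OF measurable_rooted_record])

text \<open>The complement of \<open>A\<close> is determined by the same window and both laws have
  total mass one, so the two inequalities force equality.\<close>

lemma record_view_eq_EKT:
  assumes r: "r \<le> n" and A: "window_determined r A"
  shows "emeasure (distr M borel (record_view n)) A = emeasure (distr (EKT \<pi>) borel Phi_R) A"
proof -
  interpret P: prob_space "distr M borel (record_view n)" by (rule prob_space_record_view)
  interpret Q: prob_space "distr (EKT \<pi>) borel Phi_R" by (rule prob_space_EKT_Phi_R)
  have As: "A \<in> sets borel" using A by (rule window_determined_sets)
  have "P.prob A \<le> Q.prob A" "P.prob (- A) \<le> Q.prob (- A)"
    using record_view_le_EKT[OF r A] record_view_le_EKT[OF r window_determined_Compl[OF A]]
    by (simp_all add: P.emeasure_eq_measure Q.emeasure_eq_measure)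
  moreover have "P.prob (- A) = 1 - P.prob A" "Q.prob (- A) = 1 - Q.prob A"
    using P.prob_compl[of A] Q.prob_compl[of A] As by (simp_all add: Compl_eq_Diff_UNIV)
  ultimately show ?thesis by (simp add: P.emeasure_eq_measure Q.emeasure_eq_measure)
qed

lemma is_R_probability_EKT: "is_R_probability M X (distr (EKT \<pi>) borel Phi_R)"
  unfolding is_R_probability_def
  by (rule weak_limit_windows)
     (use prob_space_record_view prob_space_EKT_Phi_R record_view_eq_EKT in auto)

end

theorem theorem101:
  fixes M :: "'w measure" and X :: "int \<Rightarrow> 'w \<Rightarrow> int" and \<pi> :: "nat pmf"
  assumes "skip_free_iid_increments M X"
    and "integral\<^sup>L M (\<lambda>\<omega>. real_of_int (X 0 \<omega>)) = 0"
    and "distr M (count_space UNIV) (\<lambda>\<omega>. X 0 \<omega> + 1) = measure_pmf (map_pmf int \<pi>)"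
  shows "is_R_probability M X (distr (EKT \<pi>) borel Phi_R)"
proof -
  interpret prob_space M using assms(1) by (simp add: skip_free_iid_increments_def)
  interpret skip_free_walk M X
    using assms(1,2) by unfold_locales (auto simp: skip_free_iid_increments_def)
  have "(\<integral>\<^sup>+k. ennreal (real k) \<partial>measure_pmf \<pi>) = (\<integral>\<^sup>+a. ennreal (real_of_int a) \<partial>measure_pmf (map_pmf int \<pi>))"
    by simp
  also have "\<dots> = (\<integral>\<^sup>+\<omega>. ennreal (real_of_int (X 0 \<omega> + 1)) \<partial>M)"
    unfolding assms(3)[symmetric] by (rule nn_integral_distr) (auto intro: measurable_compose[OF rv])
  also have "\<dots> = ennreal (expectation (\<lambda>\<omega>. real_of_int (X 0 \<omega>) + 1))"
  proof -
    have "0 \<le> real_of_int (X 0 \<omega>) + 1" if "\<omega> \<in> space M" for \<omega>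
      using skip_free[OF that, of 0] by linarith
    then show ?thesis
      using integrable_0 by (subst nn_integral_eq_integral[symmetric]) (auto intro!: AE_I2)
  qed
  also have "\<dots> = 1" using integrable_0 mean_0 by (simp add: prob_space)
  \<comment> \<open>The centred step gives \<open>\<pi>\<close> mean one, which makes the
    size-biased law a probability.\<close>
  finally interpret critical_walk M X \<pi>
    using assms(3) by unfold_locales
  show ?thesis by (rule is_R_probability_EKT)
qed

end
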